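(* Let $G$ be an Abelian Polish group (written additively, identity $0$) and let $\mu$ be a Borel probability measure on $G$. Let $G_s$ be the successful exact coupling set of $\mu$. Then the following hold: (a) $G_s = \{x \in G : \exists n \geq 1,\ \mu^n \wedge \theta_x^{-1}\mu^n \neq 0\}$. (b) For every $x \in G_s$ and every $n_0 \geq 1$ such that $\mu^{n_0} \wedge \theta_x^{-1}\mu^{n_0} \neq 0$, there is a constant $C = C(\mu,x,n_0) > 0$ such that for $S \sim \mathrm{RW}(0,\mu)$ and $S^x \sim \mathrm{RW}(x,\mu)$ under $\mathbf{P}$: - if $x$ has infinite order, then $\left\Vert \mathbf{P}(S_n \in \cdot) - \mathbf{P}(S^x_n \in \cdot)\right\Vert_{\mathrm{TV}} \leq \frac{C}{\sqrt{n}}$ for all $n \geq 1$; - if $x$ has finite order, then there is $\rho = \rho(\mu,x,n_0) \in (0,1)$ such that $\left\Vert \mathbf{P}(S_n \in \cdot) - \mathbf{P}(S^x_n \in \cdot)\right\Vert_{\mathrm{TV}} \leq C\rho^n$ for all $n \geq 1$. (c) Suppose $G$ is locally compact with Haar measure $\lambda$. If $G_s = G$, then $\mu$ is spread out. If $G$ is connected, the converse holds as well (i.e. if $\mu$ is spread out then $G_s = G$). (d) Suppose $\mu$ is purely atomic, with $A$ denoting the set of atoms of $\mu$. Then $G_s$ is the subgroup of $G$ generated by $A - A = \{a - a' : a, a' \in A\}$. (e) $G_s$ is a Borel measurable subgroup of $G$.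
   Context: A Polish group is a topological group whose topology is separable and completely metrizable. For $x \in G$, $\mathrm{RW}(x,\mu)$ is the law on $G^{\mathbb{N}}$ of the right random walk $S^x = \{S^x_n\}_{n=0}^\infty$ with $S^x_n = x X_1 X_2 \cdots X_n$ (additively, $x + X_1 + \dots + X_n$), where the $X_i$ are i.i.d. with distribution $\mu$. An exact coupling of $\mathrm{RW}(x,\mu)$ and $\mathrm{RW}(y,\mu)$ is a triple $(S^x,S^y,T)$ defined on one probability space $(\Omega,\mathcal{F},\mathbf{P})$ with $S^x \sim \mathrm{RW}(x,\mu)$, $S^y \sim \mathrm{RW}(y,\mu)$ and $T$ a random time (with values in $\{0,1,2,\dots\}\cup\{\infty\}$), called a coupling time, such that $S^x_n = S^y_n$ for all $n \geq T$. It is successful if $T < \infty$ almost surely. The successful exact coupling set $G_s$ is the set of all $x \in G$ such that there exists a successful exact coupling of $\mathrm{RW}(e,\mu)$ and $\mathrm{RW}(x,\mu)$, where $e$ is the identity of $G$ ($e=0$ in the Abelian case). For a Borel measure $\nu$ on $G$, $\nu^n$ is the $n$-fold convolution of $\nu$ with itself. The shift $\theta_x\nu$ is $\theta_x\nu(B) = \nu(x^{-1}B)$, so $\theta_x^{-1}\nu(B) = \nu(xB)$ (additively, $\nu(x+B)$). $\nu_1 \wedge \nu_2$ is the largest measure that is $\leq \nu_1$ and $\leq \nu_2$, and $0$ denotes the zero measure. The total variation of a finite signed measure is $\Vert\nu\Vert_{\mathrm{TV}} = \sup_B \nu(B) - \inf_B \nu(B)$ (over Borel sets $B$). When $G$ is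 locally compact with (left-invariant) Haar measure $\lambda$, $\mu$ is spread out if for some $n \geq 1$ there is a Borel $f \geq 0$, not $\lambda$-a.e. zero, with $\mu^n(B) \geq \int_B f\,d\lambda$ for all Borel $B$. *)

theory Defs
  imports
    "HOL-Probability.Probability"
    "HOL-Computational_Algebra.Group_Closure"
begin

text \<open>
  A Polish group is rendered by the sort of \<^class>\<open>polish_space\<close> and
  \<^class>\<open>topological_ab_group_add\<close>.  The class \<^class>\<open>polish_space\<close> carries a complete
  compatible metric, about which no invariance is assumed; nothing below mentions it.
\<close>

section \<open>Random walks and exact couplings\<close>

text \<open>
  The coordinate \<open>X i\<close> of the product space is the step that takes the walk from time \<open>i\<close>
  to time \<open>i + 1\<close>.
\<close>

definition RW :: "'a \<Rightarrow> 'a measure \<Rightarrow> (nat \<Rightarrow> 'a::{polish_space,topological_ab_group_add}) measure" where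
  "RW x \<mu> = distr (\<Pi>\<^sub>M i\<in>(UNIV::nat set). \<mu>) (\<Pi>\<^sub>M i\<in>(UNIV::nat set). borel)
     (\<lambda>X n. x + (\<Sum>i<n. X i))"

definition exact_coupling ::
  "'a::{polish_space,topological_ab_group_add} measure \<Rightarrow> 'a \<Rightarrow> 'a \<Rightarrow> 'w measure \<Rightarrow>
    ('w \<Rightarrow> nat \<Rightarrow> 'a) \<Rightarrow> ('w \<Rightarrow> nat \<Rightarrow> 'a) \<Rightarrow> ('w \<Rightarrow> enat) \<Rightarrow> bool" where
  "exact_coupling \<mu> x y M Sx Sy T \<longleftrightarrow>
     prob_space M \<and>
     Sx \<in> measurable M (\<Pi>\<^sub>M i\<in>UNIV. borel) \<and> distr M (\<Pi>\<^sub>M i\<in>UNIV. borel) Sx = RW x \<mu> \<and>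
     Sy \<in> measurable M (\<Pi>\<^sub>M i\<in>UNIV. borel) \<and> distr M (\<Pi>\<^sub>M i\<in>UNIV. borel) Sy = RW y \<mu> \<and>
     T \<in> measurable M (count_space UNIV) \<and>
     (\<forall>\<omega>\<in>space M. \<forall>n. T \<omega> \<le> enat n \<longrightarrow> Sx \<omega> n = Sy \<omega> n)"

definition successful_exact_coupling ::
  "'a::{polish_space,topological_ab_group_add} measure \<Rightarrow> 'a \<Rightarrow> 'a \<Rightarrow> 'w measure \<Rightarrow>
    ('w \<Rightarrow> nat \<Rightarrow> 'a) \<Rightarrow> ('w \<Rightarrow> nat \<Rightarrow> 'a) \<Rightarrow> ('w \<Rightarrow> enat) \<Rightarrow> bool" where
  "successful_exact_coupling \<mu> x y M Sx Sy T \<longleftrightarrow>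
     exact_coupling \<mu> x y M Sx Sy T \<and> (AE \<omega> in M. T \<omega> < \<infinity>)"

text \<open>
  HOL cannot quantify existentially over the type of sample points, so the definition uses
  one fixed type of sample points, with an arbitrary probability space on it.  Lemma
  \<open>successful_exact_coupling_imp_coupling_set\<close> below shows that this loses nothing: a
  coupling on a probability space over any type yields membership.
\<close>

definition coupling_set :: "'a::{polish_space,topological_ab_group_add} measure \<Rightarrow> 'a set" where
  "coupling_set \<mu> =
     {x. \<exists>(M :: ((nat \<Rightarrow> 'a) \<times> (nat \<Rightarrow> 'a) \<times> enat) measure) S Sx T.
           successful_exact_coupling \<mu> 0 x M S Sx T}"

lemma successful_exact_coupling_imp_coupling_set:
  fixes \<mu> :: "'a::{polish_space,topological_ab_group_add} measure"
  assumes "successful_exact_coupling \<mu> 0 x (M :: 'w measure) S Sx T"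
  shows "x \<in> coupling_set \<mu>"
proof -
  let ?P = "\<Pi>\<^sub>M i\<in>(UNIV::nat set). (borel :: 'a measure)"
  let ?N = "?P \<Otimes>\<^sub>M ?P \<Otimes>\<^sub>M count_space (UNIV :: enat set)"
  define D where "D = {(s :: nat \<Rightarrow> 'a, t :: nat \<Rightarrow> 'a, \<tau> :: enat).
    \<forall>n. \<tau> \<le> enat n \<longrightarrow> s n = t n}"
  define R where "R = restrict_space ?N D"
  define f where "f = (\<lambda>\<omega>. (S \<omega>, Sx \<omega>, T \<omega>))"
  have M: "prob_space M"
    and S: "S \<in> measurable M ?P" "distr M ?P S = RW 0 \<mu>"
    and Sx: "Sx \<in> measurable M ?P" "distr M ?P Sx = RW x \<mu>"
    and T: "T \<in> measurable M (count_space UNIV)"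
    and eq: "\<And>\<omega> n. \<omega> \<in> space M \<Longrightarrow> T \<omega> \<le> enat n \<Longrightarrow> S \<omega> n = Sx \<omega> n"
    and fin: "AE \<omega> in M. T \<omega> < \<infinity>"
    using assms unfolding successful_exact_coupling_def exact_coupling_def by auto
  have "f \<in> measurable M ?N"
    unfolding f_def using S(1) Sx(1) T by measurable
  then have f: "f \<in> measurable M R"
    unfolding R_def by (intro measurable_restrict_space2) (auto simp: D_def f_def eq)
  have p1: "fst \<in> measurable R ?P"
    and p2: "(\<lambda>z. fst (snd z)) \<in> measurable R ?P"
    and p3: "(\<lambda>z. snd (snd z)) \<in> measurable R (count_space UNIV)"
    unfolding R_def by (intro measurable_restrict_space1; measurable)+
  have R: "space R \<subseteq> D"
    by (auto simp: R_def space_restrict_space)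
  have T_meas: "{z \<in> space R. snd (snd z) < \<infinity>} \<in> sets R"
    using measurable_sets[OF p3, of "{..<\<infinity>}"]
    by (simp add: vimage_def Int_def conj_commute)
  have 1: "prob_space (distr M R f)"
    by (rule prob_space.prob_space_distr[OF M f])
  have 2: "distr (distr M R f) ?P fst = RW 0 \<mu>"
    unfolding distr_distr[OF p1 f] S(2)[symmetric] by (simp add: comp_def f_def)
  have 3: "distr (distr M R f) ?P (\<lambda>z. fst (snd z)) = RW x \<mu>"
    unfolding distr_distr[OF p2 f] Sx(2)[symmetric] by (simp add: comp_def f_def)
  have 4: "AE z in distr M R f. snd (snd z) < \<infinity>"
    unfolding AE_distr_iff[OF f T_meas] using fin by (simp add: f_def)
  have "successful_exact_coupling \<mu> 0 x (distr M R f) fst (\<lambda>z. fst (snd z)) (\<lambda>z. snd (snd z))"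
    unfolding successful_exact_coupling_def exact_coupling_def
    using R p1 p2 p3 1 2 3 4 by (auto simp: D_def)
  then show ?thesis
    unfolding coupling_set_def by blast
qed


section \<open>Convolution powers, shifts and the meet of two measures\<close>

text \<open>
  The library's \<^const>\<open>convolution\<close> is restricted to Euclidean spaces.
\<close>

definition conv :: "'a::{polish_space,topological_ab_group_add} measure \<Rightarrow> 'a measure \<Rightarrow> 'a measure" where
  "conv \<nu>1 \<nu>2 = distr (\<nu>1 \<Otimes>\<^sub>M \<nu>2) borel (\<lambda>(x, y). x + y)"

primrec conv_power :: "'a::{polish_space,topological_ab_group_add} measure \<Rightarrow> nat \<Rightarrow> 'a measure" where
  "conv_power \<nu> 0 = return borel 0"
| "conv_power \<nu> (Suc n) = conv (conv_power \<nu> n) \<nu>"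

definition shift :: "'a::{polish_space,topological_ab_group_add} \<Rightarrow> 'a measure \<Rightarrow> 'a measure" where
  "shift x \<nu> = distr \<nu> borel (\<lambda>y. x + y)"

lemma emeasure_shift:
  fixes \<nu> :: "'a::{polish_space,topological_ab_group_add} measure"
  assumes "sets \<nu> = sets borel" "B \<in> sets borel"
  shows "emeasure (shift x \<nu>) B = emeasure \<nu> ((\<lambda>y. - x + y) ` B)"
proof -
  have "(\<lambda>y. x + y) -` B \<inter> space \<nu> = (\<lambda>y. - x + y) ` B"
  proof -
    have "y \<in> (\<lambda>y. - x + y) ` B" if "x + y \<in> B" for y
      using imageI[OF that, of "\<lambda>y. - x + y"] by simp
    then show ?thesis
      using sets_eq_imp_space_eq[OF assms(1)] by auto
  qed
  moreover have "(\<lambda>y. x + y) \<in> measurable \<nu> borel"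
    unfolding measurable_cong_sets[OF assms(1) refl]
    by (intro borel_measurable_continuous_onI continuous_intros)
  ultimately show ?thesis
    using assms by (simp add: shift_def emeasure_distr)
qed

text \<open>
  \<open>\<nu>1 \<and> \<nu>2\<close> is the library's \<^term>\<open>inf \<nu>1 \<nu>2\<close> in the lattice of measures.  For two
  Borel measures it is again a Borel measure, so it is the largest Borel measure below
  both, in the setwise order.
\<close>

lemma inf_borel_measure:
  fixes \<nu>1 \<nu>2 :: "'a::topological_space measure"
  assumes "sets \<nu>1 = sets borel" "sets \<nu>2 = sets borel"
  shows sets_inf_borel_measure: "sets (inf \<nu>1 \<nu>2) = sets borel"
    and "B \<in> sets borel \<Longrightarrow> emeasure (inf \<nu>1 \<nu>2) B \<le> min (emeasure \<nu>1 B) (emeasure \<nu>2 B)"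
    and "\<lbrakk>sets \<kappa> = sets borel; \<And>B. B \<in> sets borel \<Longrightarrow> emeasure \<kappa> B \<le> emeasure \<nu>1 B;
      \<And>B. B \<in> sets borel \<Longrightarrow> emeasure \<kappa> B \<le> emeasure \<nu>2 B; B \<in> sets borel\<rbrakk>
      \<Longrightarrow> emeasure \<kappa> B \<le> emeasure (inf \<nu>1 \<nu>2) B"
proof -
  have "null_measure borel \<le> \<nu>1" "null_measure borel \<le> \<nu>2"
    by (simp_all add: le_measure assms)
  then have 1: "null_measure borel \<le> inf \<nu>1 \<nu>2"
    by simp
  have 2: "inf \<nu>1 \<nu>2 \<le> \<nu>1"
    by simp
  show *: "sets (inf \<nu>1 \<nu>2) = sets borel"
    using 1 2 sets_eq_imp_space_eq[OF assms(1)] assms(1)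
    by (auto simp: le_measure_iff split: if_splits)
  show "emeasure (inf \<nu>1 \<nu>2) B \<le> min (emeasure \<nu>1 B) (emeasure \<nu>2 B)" if "B \<in> sets borel"
    using that le_measure[of "inf \<nu>1 \<nu>2" \<nu>1] le_measure[of "inf \<nu>1 \<nu>2" \<nu>2] * assms by simp
  show "emeasure \<kappa> B \<le> emeasure (inf \<nu>1 \<nu>2) B"
    if "sets \<kappa> = sets borel" "\<And>B. B \<in> sets borel \<Longrightarrow> emeasure \<kappa> B \<le> emeasure \<nu>1 B"
      "\<And>B. B \<in> sets borel \<Longrightarrow> emeasure \<kappa> B \<le> emeasure \<nu>2 B" "B \<in> sets borel"
  proof -
    have "\<kappa> \<le> inf \<nu>1 \<nu>2"
      using that assms by (simp add: le_measure)
    then show ?thesis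
      using that le_measure[of \<kappa> "inf \<nu>1 \<nu>2"] * by (simp del: le_inf_iff)
  qed
qed

text \<open>The argument of \<open>tv_norm\<close> is a finite signed Borel measure, given by its values.\<close>

definition tv_norm :: "('a::topological_space set \<Rightarrow> real) \<Rightarrow> real" where
  "tv_norm \<nu> = (SUP B\<in>sets borel. \<nu> B) - (INF B\<in>sets borel. \<nu> B)"


section \<open>Haar measure, atoms and subgroups\<close>

text \<open>
  On a locally compact Polish group every Borel measure that is finite on compact sets is
  regular, so regularity is not required separately.
\<close>

definition haar_measure :: "'a::{polish_space,topological_ab_group_add} measure \<Rightarrow> bool" where
  "haar_measure \<eta> \<longleftrightarrow>
     sets \<eta> = sets borel \<and> \<eta> \<noteq> null_measure borel \<and>
     (\<forall>K. compact K \<longrightarrow> emeasure \<eta> K < \<infinity>) \<and>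
     (\<forall>x. \<forall>B\<in>sets borel. emeasure \<eta> ((\<lambda>y. x + y) ` B) = emeasure \<eta> B)"

definition spread_out ::
  "'a::{polish_space,topological_ab_group_add} measure \<Rightarrow> 'a measure \<Rightarrow> bool" where
  "spread_out \<eta> \<mu> \<longleftrightarrow>
     (\<exists>n\<ge>1. \<exists>f::'a \<Rightarrow> real. f \<in> borel_measurable borel \<and> (\<forall>x. f x \<ge> 0) \<and>
        \<not> (AE x in \<eta>. f x = 0) \<and>
        (\<forall>B\<in>sets borel. emeasure (conv_power \<mu> n) B \<ge> (\<integral>\<^sup>+x\<in>B. ennreal (f x) \<partial>\<eta>)))"

text \<open>For a finite Borel measure on a Polish space all atoms are, up to null sets, points.\<close>

definition atoms :: "'a measure \<Rightarrow> 'a set" where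
  "atoms \<mu> = {a. emeasure \<mu> {a} > 0}"

definition purely_atomic :: "'a measure \<Rightarrow> bool" where
  "purely_atomic \<mu> \<longleftrightarrow> (AE x in \<mu>. x \<in> atoms \<mu>)"

definition finite_order :: "'a::ab_group_add \<Rightarrow> bool" where
  "finite_order x \<longleftrightarrow> (\<exists>n\<ge>1. (\<Sum>i<(n::nat). x) = 0)"

definition is_subgroup :: "'a::ab_group_add set \<Rightarrow> bool" where
  "is_subgroup H \<longleftrightarrow> 0 \<in> H \<and> (\<forall>x\<in>H. \<forall>y\<in>H. x + y \<in> H) \<and> (\<forall>x\<in>H. - x \<in> H)"

end

theory Submission
  imports Defs "HOL-Analysis.Function_Metric"
begin

text \<open>
  Call \<open>x\<close> an overlap if for some \<open>n \<ge> 1\<close> there is a measure \<open>\<kappa> \<noteq> 0\<close> such that both \<open>\<kappa>\<close> and its translate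
  by \<open>x\<close> lie below \<open>\<mu>\<^sup>n\<close>.  The theorem is about the set of overlaps (\<open>overlap_set\<close>), which turns out
  to be the coupling set (\<open>coupling_set_eq_overlap_set\<close>).

  A successful coupling yields an overlap, since the walks have met by some time \<open>n\<close> with positive
  probability.  For the converse, let \<open>\<nu> = \<mu>\<^sup>n\<close> and let \<open>c\<close> be the mass of \<open>\<kappa>\<close>.  A step of law \<open>\<nu>\<close> contains,
  with probability \<open>c\<close>, a fair choice between adding \<open>x\<close> and not adding it.  In a commutative group
  these choices can be collected: \<open>j\<close> of them replace \<open>\<delta>\<^sub>0 - \<delta>\<^sub>x\<close> by its convolution with a symmetric
  binomial law on the multiples of \<open>x\<close>.  Its total variation is then of order \<open>1 / sqrt j\<close>
  (\<open>abs_avg_diff_le\<close>), and it decays geometrically if these multiples form a finite cycle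
  (\<open>abs_avg_diff_periodic_le\<close>).  About \<open>c * k\<close> choices occur in \<open>k\<close> steps; a recursion that is solved
  by an explicit bound accounts for their random number (\<open>merging_bound\<close>).  This gives the rates.

  It remains to couple two walks whose laws merge.  The laws of the paths after time \<open>k\<close> merge at the
  same rate as the positions (\<open>RW_tail\<close>).  At each time \<open>k\<close>, couple as much as possible of the mass not
  yet coupled, so that the coupled parts of the two path laws have the same law after time \<open>k\<close>; what
  is never coupled has mass zero (\<open>matching_weights\<close>).  The coupled parts have to be joined so that
  the paths really coincide after time \<open>k\<close>.  For this a path is recomputed from its continuation and
  an independent uniform variable (\<open>noise_outsourcing\<close>), which is possible in a Polish space because
  its points can be coded measurably by real numbers (\<open>polish_real_coding\<close>).

  The other claims concern overlaps only.  Overlaps form a subgroup because minorants can be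
  convolved.  They form a Borel set because two measures without common minorant are mutually
  singular, which can be tested on countably many open sets.  For an atomic \<open>\<mu>\<close> they are differences of
  sums of equally many atoms.  If \<open>\<mu>\<close> is not spread out, Fubini's theorem shows that almost no
  translation is an overlap; if it is spread out, a Steinhaus argument shows that small
  translations are, and an open subgroup of a connected group is everything.
\<close>

section \<open>Densities with values in the unit interval\<close>

lemma ennreal_add_le_self_imp_zero:
  fixes a c :: ennreal
  assumes "a + c \<le> c" "c < \<infinity>"
  shows "a = 0"
  using ennreal_add_left_cancel_le[of c a 0] assms by (auto simp: add.commute)

text \<open>
  A Radon-Nikodym derivative with values in \<open>[0, 1]\<close> at every point, not only almost
  everywhere, so that it can serve as a probability of selection.
\<close>

lemma bounded_density_exists:
  assumes fin: "finite_measure M" and sets: "sets N = sets M"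
    and le: "\<And>A. A \<in> sets M \<Longrightarrow> emeasure N A \<le> emeasure M A"
  obtains v :: "'a \<Rightarrow> real" where "v \<in> borel_measurable M" "\<And>x. 0 \<le> v x" "\<And>x. v x \<le> 1"
    "N = density M (\<lambda>x. ennreal (v x))"
proof -
  interpret finite_measure M by fact
  have "absolutely_continuous M N"
    unfolding absolutely_continuous_def
  proof
    fix A assume "A \<in> null_sets M"
    then show "A \<in> null_sets N" using le[of A] sets by (auto simp: null_sets_def)
  qed
  then have RN: "density M (RN_deriv M N) = N"
    using sets by (rule density_RN_deriv)
  define f where "f = RN_deriv M N"
  have [measurable]: "f \<in> borel_measurable M" by (simp add: f_def)
  define B where "B = {x\<in>space M. f x > 1}"
  have [measurable]: "B \<in> sets M" by (simp add: B_def)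
  have "(\<integral>\<^sup>+x. (f x - 1) * indicator B x \<partial>M) + emeasure M B = (\<integral>\<^sup>+x. (f x - 1) * indicator B x + indicator B x \<partial>M)"
    by (subst nn_integral_add) auto
  also have "\<dots> = (\<integral>\<^sup>+x. f x * indicator B x \<partial>M)"
    by (intro nn_integral_cong) (auto simp: B_def indicator_def diff_add_cancel_ennreal)
  also have "\<dots> = emeasure N B"
    by (subst RN[symmetric], subst emeasure_density) (auto simp: f_def)
  also have "\<dots> \<le> emeasure M B" by (rule le) simp
  finally have "(\<integral>\<^sup>+x. (f x - 1) * indicator B x \<partial>M) + emeasure M B \<le> emeasure M B" by simp
  then have "(\<integral>\<^sup>+x. (f x - 1) * indicator B x \<partial>M) = 0"
    by (rule ennreal_add_le_self_imp_zero) (simp add: less_top[symmetric])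
  then have "AE x in M. (f x - 1) * indicator B x = 0"
    by (subst (asm) nn_integral_0_iff_AE) auto
  then have le1: "AE x in M. f x \<le> 1"
  proof (rule AE_mp, intro AE_I2 impI)
    fix x assume "x \<in> space M" "(f x - 1) * indicator B x = 0"
    then show "f x \<le> 1"
      by (cases "x \<in> B") (auto simp: B_def diff_eq_0_iff_ennreal)
  qed
  show ?thesis
  proof
    show "(\<lambda>x. enn2real (min 1 (f x))) \<in> borel_measurable M" by measurable
    show "0 \<le> enn2real (min 1 (f x))" for x by simp
    show "enn2real (min 1 (f x)) \<le> 1" for x
      using enn2real_mono[of "min 1 (f x)" 1] by simp
    show "N = density M (\<lambda>x. ennreal (enn2real (min 1 (f x))))"
    proof -
      have "AE x in M. f x = ennreal (enn2real (min 1 (f x)))"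
        using le1 by eventually_elim (simp add: min_absorb2 le_less_trans[OF _ ennreal_one_less_top])
      then have "density M f = density M (\<lambda>x. ennreal (enn2real (min 1 (f x))))"
        by (intro density_cong) auto
      then show ?thesis using RN by (simp add: f_def)
    qed
  qed
qed

section \<open>Conditional laws as functions of an independent uniform variable\<close>

text \<open>
  A point is coded by the answers to countably many questions: does it lie within \<open>1 / (j + 1)\<close>
  of the \<open>i\<close>-th term of a dense sequence?  The answers are the digits \<open>0\<close> and \<open>1\<close> of a real number
  in base 3, where the digits after a place contribute at most half a unit of that place, so
  every digit can be read off measurably.  Decoding is a limit of terms of the dense sequence.
\<close>

lemma polish_real_coding:
  obtains c :: "'a::polish_space \<Rightarrow> real" and dec where "c \<in> borel_measurable borel"
    "dec \<in> borel_measurable borel" "\<And>a. dec (c a) = a" "\<And>a. 0 \<le> c a" "\<And>a. c a \<le> 1"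
proof -
  obtain D :: "'a set" where D: "countable D" "\<And>X. open X \<Longrightarrow> X \<noteq> {} \<Longrightarrow> \<exists>d\<in>D. d \<in> X"
    using countable_dense_exists by (metis (no_types))
  have "D \<noteq> {}" using D(2)[of UNIV] by auto
  define d where "d = from_nat_into D"
  have dense: "\<exists>i. dist a (d i) < e" if "e > 0" for a e
  proof -
    obtain x where "x \<in> D" "x \<in> ball a e" using D(2)[of "ball a e"] \<open>e > 0\<close> by force
    then show ?thesis
      using from_nat_into_surj[OF D(1), of x] by (auto simp: d_def)
  qed
  define val where "val \<epsilon> = (\<Sum>n. of_bool (\<epsilon> n) * (1/3) ^ Suc n :: real)" for \<epsilon> :: "nat \<Rightarrow> bool"
  have summ: "summable (\<lambda>n. of_bool (\<epsilon> n) * (1/3) ^ Suc n :: real)" for \<epsilon> :: "nat \<Rightarrow> bool"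
    by (rule summable_comparison_test[OF _ summable_geometric[of "1/3::real"]]) auto
  have val_Suc: "3 * val \<epsilon> = of_bool (\<epsilon> 0) + val (\<lambda>n. \<epsilon> (Suc n))" for \<epsilon>
  proof -
    have "val \<epsilon> = (\<Sum>n. of_bool (\<epsilon> (Suc n)) * (1/3) ^ Suc (Suc n)) + of_bool (\<epsilon> 0) * (1/3)"
      unfolding val_def using suminf_split_head[OF summ[of \<epsilon>]] by simp
    also have "(\<Sum>n. of_bool (\<epsilon> (Suc n)) * (1/3) ^ Suc (Suc n)) = val (\<lambda>n. \<epsilon> (Suc n)) * (1/3)"
      unfolding val_def by (subst suminf_mult2[OF summ]) (simp add: mult.assoc)
    finally show ?thesis by simp
  qed
  have val_nonneg: "0 \<le> val \<epsilon>" for \<epsilon>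
    unfolding val_def by (rule suminf_nonneg[OF summ]) simp
  have val_le: "val \<epsilon> \<le> 1/2" for \<epsilon>
  proof -
    have "(\<lambda>n. (1/3) ^ Suc n :: real) sums (1/3 * (1 / (1 - 1/3)))"
      unfolding power_Suc by (intro sums_mult geometric_sums) auto
    then have s: "(\<lambda>n. (1/3) ^ Suc n :: real) sums (1/2)" by simp
    have "val \<epsilon> \<le> (\<Sum>n. (1/3) ^ Suc n)"
      unfolding val_def by (rule suminf_le[OF _ summ sums_summable[OF s]]) auto
    then show ?thesis using sums_unique[OF s] by simp
  qed
  define T where "T x = (if 3 * x \<ge> 1 then 3 * x - 1 else 3 * x)" for x :: real
  have digit0: "3 * val \<epsilon> \<ge> 1 \<longleftrightarrow> \<epsilon> 0" for \<epsilon>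
    using val_Suc[of \<epsilon>] val_le[of "\<lambda>n. \<epsilon> (Suc n)"] val_nonneg[of "\<lambda>n. \<epsilon> (Suc n)"]
    by (cases "\<epsilon> 0") auto
  have T_val: "T (val \<epsilon>) = val (\<lambda>n. \<epsilon> (Suc n))" for \<epsilon>
    unfolding T_def digit0 using val_Suc[of \<epsilon>] by auto
  have T_iter: "(T ^^ k) (val \<epsilon>) = val (\<lambda>n. \<epsilon> (n + k))" for k \<epsilon>
    by (induction k) (auto simp: T_val)
  define bit where "bit k x \<longleftrightarrow> 3 * (T ^^ k) x \<ge> 1" for k x
  have bit_val: "bit k (val \<epsilon>) \<longleftrightarrow> \<epsilon> k" for k \<epsilon>
    unfolding bit_def T_iter digit0 by simp
  have [measurable]: "T \<in> borel_measurable borel" unfolding T_def by measurable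
  have [measurable]: "(T ^^ k) \<in> borel_measurable borel" for k
    by (induction k) (auto intro: measurable_compose simp: comp_def)
  have [measurable]: "Measurable.pred borel (bit k)" for k
    unfolding bit_def by measurable
  define near where "near a n \<longleftrightarrow>
    dist a (d (fst (prod_decode n))) < inverse (real (Suc (snd (prod_decode n))))" for a n
  define c where "c a = val (near a)" for a
  define u where "u j x = d (LEAST i. bit (prod_encode (i, j)) x)" for j x
  have [measurable]: "u j \<in> borel_measurable borel" for j
    unfolding u_def by measurable
  define dec where "dec x = (if Cauchy (\<lambda>j. u j x) then lim (\<lambda>j. u j x) else d 0)" for x
  have u_c: "(\<lambda>j. u j (c a)) \<longlonglongrightarrow> a" for a
  proof (rule metric_LIMSEQ_I)
    fix r :: real assume "r > 0"
    then obtain m where m: "inverse (real (Suc m)) < r" using reals_Archimedean by blast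
    have "dist (u j (c a)) a < r" if "j \<ge> m" for j
    proof -
      have "\<exists>i. bit (prod_encode (i, j)) (c a)"
        unfolding c_def bit_val near_def using dense[of "inverse (real (Suc j))" a] by simp
      then have "bit (prod_encode (LEAST i. bit (prod_encode (i, j)) (c a), j)) (c a)"
        by (rule LeastI_ex)
      then have "dist a (u j (c a)) < inverse (real (Suc j))"
        unfolding c_def bit_val near_def by (simp add: u_def c_def bit_val near_def)
      also have "\<dots> \<le> inverse (real (Suc m))" using that by (simp add: field_simps)
      finally show ?thesis using m by (simp add: dist_commute)
    qed
    then show "\<exists>m. \<forall>j\<ge>m. dist (u j (c a)) a < r" by blast
  qed
  show ?thesis
  proof
    show "c \<in> borel_measurable borel"
      unfolding c_def val_def near_def by measurable
    show "dec \<in> borel_measurable borel"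
    proof (rule borel_measurable_LIMSEQ_metric)
      show "(\<lambda>x. if Cauchy (\<lambda>j. u j x) then u i x else d 0) \<in> borel_measurable borel" for i
        by measurable
      show "(\<lambda>i. if Cauchy (\<lambda>j. u j x) then u i x else d 0) \<longlonglongrightarrow> dec x" for x
        unfolding dec_def by (auto simp: Cauchy_convergent_iff convergent_LIMSEQ_iff)
    qed
    show "dec (c a) = a" for a
      using u_c[of a] limI[OF u_c[of a]] LIMSEQ_imp_Cauchy[OF u_c[of a]] by (simp add: dec_def)
    show "0 \<le> c a" "c a \<le> 1" for a
      using val_nonneg[of "near a"] val_le[of "near a"] by (simp_all add: c_def)
  qed
qed

definition unif :: "real measure" where
  "unif = uniform_measure lborel {0..1}"

lemma prob_space_unif: "prob_space unif"
  unfolding unif_def by (intro prob_space_uniform_measure) auto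

lemma sets_unif [measurable_cong, simp]: "sets unif = sets borel"
  by (simp add: unif_def)

lemma space_unif [simp]: "space unif = UNIV"
  by (simp add: unif_def)

lemma AE_unif: "AE u in unif. 0 < u \<and> u \<le> 1"
proof -
  have "AE u in lborel. u \<in> {0..1} \<longrightarrow> 0 < u \<and> u \<le> (1::real)"
    using AE_lborel_singleton[of "0::real"] by eventually_elim auto
  then show ?thesis
    unfolding unif_def by (subst AE_uniform_measure) auto
qed

lemma emeasure_unif_Ioc:
  assumes "0 \<le> s" "s \<le> 1"
  shows "emeasure unif {0<..s} = ennreal s" "emeasure unif {0<..<s} = ennreal s"
proof -
  have "{0..1} \<inter> {0<..s} = {0<..s}" "{0..1} \<inter> {0<..<s} = {0<..<s}" using assms by auto
  then show "emeasure unif {0<..s} = ennreal s" "emeasure unif {0<..<s} = ennreal s"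
    using assms by (simp_all add: unif_def divide_ennreal_def)
qed

text \<open>
  The set is an interval from \<open>0\<close> to \<open>Sup A\<close>, possibly without its right end.
\<close>

lemma emeasure_unif_below_Sup:
  assumes "A \<subseteq> {0..1}" "countable A"
  shows "emeasure unif {u. 0 < u \<and> u \<le> 1 \<and> (\<exists>a\<in>A. u \<le> a)} = (SUP a\<in>A. ennreal a)"
proof (cases "A = {}")
  case True
  then show ?thesis by (simp add: bot_ennreal)
next
  case False
  define s where "s = Sup A"
  have bdd: "bdd_above A" using assms(1) by (auto intro!: bdd_aboveI[of _ 1])
  obtain a where "a \<in> A" using False by auto
  then have s: "0 \<le> s" "s \<le> 1"
  proof -
    show "0 \<le> s" using assms(1) cSup_upper[OF \<open>a \<in> A\<close> bdd] \<open>a \<in> A\<close> unfolding s_def by force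
    show "s \<le> 1" using assms(1) unfolding s_def by (intro cSup_least False) auto
  qed
  let ?B = "{u. 0 < u \<and> u \<le> 1 \<and> (\<exists>a\<in>A. u \<le> a)}"
  have [measurable]: "?B \<in> sets borel"
  proof -
    have "?B = (\<Union>a\<in>A. {0<..min 1 a})" by auto
    also have "\<dots> \<in> sets borel" using assms(2) by (intro sets.countable_UN') auto
    finally show ?thesis .
  qed
  have "?B \<subseteq> {0<..s}" using cSup_upper[OF _ bdd] by (force simp: s_def intro: order_trans)
  moreover have "{0<..<s} \<subseteq> ?B"
  proof
    fix u assume "u \<in> {0<..<s}"
    then obtain b where "b \<in> A" "u < b" unfolding s_def using less_cSup_iff[OF False bdd] by auto
    then show "u \<in> ?B" using \<open>u \<in> {0<..<s}\<close> s by (auto intro!: bexI[of _ b])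
  qed
  ultimately have "emeasure unif ?B \<le> s" "s \<le> emeasure unif ?B"
    using emeasure_mono[of ?B "{0<..s}" unif] emeasure_mono[of "{0<..<s}" ?B unif]
    unfolding emeasure_unif_Ioc[OF s] by auto
  then have "emeasure unif ?B = ennreal s" by (rule antisym)
  also have "\<dots> = (SUP a\<in>A. ennreal a)"
  proof (rule antisym)
    define t where "t = (SUP a\<in>A. ennreal a)"
    have "t \<le> ennreal s"
      unfolding t_def s_def by (intro SUP_least ennreal_leI cSup_upper bdd)
    then show "(SUP a\<in>A. ennreal a) \<le> ennreal s" by (simp add: t_def)
    from \<open>t \<le> ennreal s\<close> obtain r where r: "t = ennreal r" "0 \<le> r" by (cases t) (auto simp: top_unique)
    have "b \<le> r" if "b \<in> A" for b
      using SUP_upper[OF that, of ennreal] r unfolding t_def[symmetric] by simp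
    then have "s \<le> r" unfolding s_def by (intro cSup_least False) auto
    then show "ennreal s \<le> (SUP a\<in>A. ennreal a)" using r by (simp add: ennreal_leI t_def[symmetric])
  qed
  finally show ?thesis .
qed

lemma measure_eqI_pair_rectangles:
  assumes "finite_measure M" "sets M = sets (A \<Otimes>\<^sub>M B)" "sets N = sets (A \<Otimes>\<^sub>M B)"
    and "\<And>X Y. X \<in> sets A \<Longrightarrow> Y \<in> sets B \<Longrightarrow> emeasure M (X \<times> Y) = emeasure N (X \<times> Y)"
  shows "M = N"
proof (rule measure_eqI_generator_eq[where E = "{a \<times> b | a b. a \<in> sets A \<and> b \<in> sets B}"
    and \<Omega> = "space A \<times> space B" and A = "\<lambda>_. space A \<times> space B"])
  interpret finite_measure M by fact
  show "Int_stable {a \<times> b | a b. a \<in> sets A \<and> b \<in> sets B}"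
    by (rule Int_stable_pair_measure_generator)
  show "{a \<times> b | a b. a \<in> sets A \<and> b \<in> sets B} \<subseteq> Pow (space A \<times> space B)"
    by (rule pair_measure_closed)
  show "emeasure M (space A \<times> space B) \<noteq> \<infinity>" by simp
  show "emeasure M X = emeasure N X" if "X \<in> {a \<times> b | a b. a \<in> sets A \<and> b \<in> sets B}" for X
    using that assms(4) by blast
  show "sets M = sigma_sets (space A \<times> space B) {a \<times> b | a b. a \<in> sets A \<and> b \<in> sets B}"
    "sets N = sigma_sets (space A \<times> space B) {a \<times> b | a b. a \<in> sets A \<and> b \<in> sets B}"
    unfolding assms(2,3) by (rule sets_pair_measure)+
  show "range (\<lambda>_::nat. space A \<times> space B) \<subseteq> {a \<times> b | a b. a \<in> sets A \<and> b \<in> sets B}"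
    by blast
qed simp

lemma emeasure_distr_restrict_space:
  assumes h: "h \<in> measurable M N" and Q: "{z\<in>space M. Q z} \<in> sets M" and D: "D \<in> sets N"
  shows "emeasure (distr (restrict_space M {z\<in>space M. Q z}) N h) D
    = emeasure M {z\<in>space M. Q z \<and> h z \<in> D}"
proof -
  have "{z\<in>space M. Q z} \<inter> space M \<in> sets M"
    using Q by (rule sets.Int) simp
  moreover have "h -` D \<inter> {z\<in>space M. Q z} \<subseteq> {z\<in>space M. Q z}" by blast
  moreover have "h -` D \<inter> space (restrict_space M {z\<in>space M. Q z}) = {z\<in>space M. Q z \<and> h z \<in> D}"
    by (auto simp: space_restrict_space)
  ultimately show ?thesis
    using D by (simp add: emeasure_distr[OF measurable_restrict_space1[OF h]])
      (subst emeasure_restrict_space, auto)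
qed

text \<open>
  The conditional probabilities \<open>F r y\<close> of \<open>g > r\<close> given \<open>f = y\<close>, for rational \<open>r\<close>, are
  Radon-Nikodym derivatives, and \<open>h (y, u)\<close> is the quantile that belongs to them: it exceeds \<open>x\<close>
  just when \<open>u \<le> F r y\<close> for some \<open>r > x\<close>.  For uniform \<open>u\<close> this has conditional probability
  \<open>SUP r. F r y\<close> over \<open>r > x\<close>.  Monotonicity of \<open>F\<close> in \<open>r\<close> holds almost surely, and the
  probability of \<open>g > x\<close> is continuous from the right in \<open>x\<close>; both together identify the integral
  of this supremum.
\<close>

lemma conditional_quantile:
  fixes g :: "'x \<Rightarrow> real" and Y :: "'b measure"
  assumes P: "prob_space P" and f [measurable]: "f \<in> measurable P Y"
    and g [measurable]: "g \<in> borel_measurable P"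
    and g01: "\<And>\<omega>. 0 \<le> g \<omega>" "\<And>\<omega>. g \<omega> \<le> 1"
  obtains h where "h \<in> borel_measurable (Y \<Otimes>\<^sub>M borel)"
    "distr (distr P Y f \<Otimes>\<^sub>M unif) (Y \<Otimes>\<^sub>M borel) (\<lambda>(y, u). (y, h (y, u)))
      = distr P (Y \<Otimes>\<^sub>M borel) (\<lambda>\<omega>. (f \<omega>, g \<omega>))"
proof -
  interpret P: prob_space P by fact
  define \<nu> where "\<nu> = distr P Y f"
  interpret \<nu>: prob_space \<nu> unfolding \<nu>_def by (rule P.prob_space_distr) simp
  interpret U: prob_space unif by (rule prob_space_unif)
  interpret \<nu>U: pair_prob_space \<nu> unif ..
  have [measurable_cong, simp]: "sets \<nu> = sets Y" and [simp]: "space \<nu> = space Y"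
    by (simp_all add: \<nu>_def)
  define H where "H C r = emeasure P {\<omega>\<in>space P. f \<omega> \<in> C \<and> r < g \<omega>}" for C and r :: real
  have "\<exists>v::'b \<Rightarrow> real. v \<in> borel_measurable Y \<and> (\<forall>y. 0 \<le> v y) \<and> (\<forall>y. v y \<le> 1) \<and>
    (\<forall>C\<in>sets Y. (\<integral>\<^sup>+y. ennreal (v y) * indicator C y \<partial>\<nu>) = H C r)" for r
  proof -
    define N where "N = distr (restrict_space P {\<omega>\<in>space P. r < g \<omega>}) Y f"
    have N: "emeasure N C = H C r" if [measurable]: "C \<in> sets Y" for C
      unfolding N_def using that
      by (subst emeasure_distr_restrict_space) (auto simp: H_def intro!: arg_cong[where f = "emeasure _"])
    obtain v :: "'b \<Rightarrow> real" where v: "v \<in> borel_measurable \<nu>" "\<And>x. 0 \<le> v x" "\<And>x. v x \<le> 1"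
      "N = density \<nu> (\<lambda>x. ennreal (v x))"
    proof (rule bounded_density_exists[of \<nu> N])
      show "emeasure N A \<le> emeasure \<nu> A" if "A \<in> sets \<nu>" for A
        using that N[of A] by (auto simp: \<nu>_def emeasure_distr H_def intro!: emeasure_mono)
    qed (use \<nu>.finite_measure_axioms in \<open>auto simp: N_def\<close>)
    have "(\<integral>\<^sup>+y. ennreal (v y) * indicator C y \<partial>\<nu>) = H C r" if "C \<in> sets Y" for C
      using that v(1) N[OF that] unfolding v(4) by (simp add: emeasure_density)
    moreover have "v \<in> borel_measurable Y" using v(1) by simp
    ultimately show ?thesis using v(2,3) by (intro exI[of _ v] conjI ballI allI)
  qed
  then obtain F :: "real \<Rightarrow> 'b \<Rightarrow> real" where F [measurable]: "\<And>r. F r \<in> borel_measurable Y"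
    and F01: "\<And>r y. 0 \<le> F r y" "\<And>r y. F r y \<le> 1"
    and FH: "\<And>r C. C \<in> sets Y \<Longrightarrow> (\<integral>\<^sup>+y. ennreal (F r y) * indicator C y \<partial>\<nu>) = H C r"
    by metis
  have anti: "AE y in \<nu>. F r y \<le> F x y" if "x \<le> r" for r x
  proof -
    define B where "B = {y\<in>space Y. F x y < F r y}"
    have [measurable]: "B \<in> sets Y" by (simp add: B_def)
    have "H B r \<le> H B x" unfolding H_def using that by (intro emeasure_mono) auto
    have "H B x < \<infinity>" unfolding H_def by (simp add: less_top[symmetric])
    have "(\<integral>\<^sup>+y. ennreal (F r y - F x y) * indicator B y \<partial>\<nu>) + H B x
       = (\<integral>\<^sup>+y. ennreal (F r y - F x y) * indicator B y + ennreal (F x y) * indicator B y \<partial>\<nu>)"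
      by (subst nn_integral_add) (auto simp: FH)
    also have "\<dots> = H B r"
      unfolding FH[OF \<open>B \<in> sets Y\<close>, symmetric] using F01
      by (intro nn_integral_cong) (auto simp: B_def indicator_def ennreal_plus[symmetric] simp del: ennreal_plus)
    finally have "(\<integral>\<^sup>+y. ennreal (F r y - F x y) * indicator B y \<partial>\<nu>) + H B x \<le> H B x"
      using \<open>H B r \<le> H B x\<close> by (simp only:)
    then have "(\<integral>\<^sup>+y. ennreal (F r y - F x y) * indicator B y \<partial>\<nu>) = 0"
      using \<open>H B x < \<infinity>\<close> by (rule ennreal_add_le_self_imp_zero)
    then have "AE y in \<nu>. ennreal (F r y - F x y) * indicator B y = 0"
      by (subst (asm) nn_integral_0_iff_AE) auto
    then show ?thesis
    proof (rule AE_mp, intro AE_I2 impI)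
      fix y assume "y \<in> space \<nu>" "ennreal (F r y - F x y) * indicator B y = 0"
      then show "F r y \<le> F x y"
        by (cases "y \<in> B") (auto simp: B_def ennreal_eq_0_iff)
    qed
  qed
  \<comment> \<open>The level \<open>- 1\<close> lies below all values of \<open>g\<close> and keeps the set of levels nonempty.\<close>
  define S where "S z = insert (-1) {r\<in>\<rat>. -1 \<le> r \<and> r \<le> 1 \<and> snd z \<le> F r (fst z)}" for z :: "'b \<times> real"
  define h where "h z = Sup (S z)" for z
  have S: "S z \<noteq> {}" "bdd_above (S z)" for z
  proof -
    show "S z \<noteq> {}" unfolding S_def by simp
    show "bdd_above (S z)" by (rule bdd_aboveI[of _ 1]) (auto simp: S_def)
  qed
  have h_gt: "x < h z \<longleftrightarrow> x < -1 \<or> (\<exists>r\<in>\<rat> \<inter> {-1..1}. x < r \<and> snd z \<le> F r (fst z))" for x z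
    unfolding h_def less_cSup_iff[OF S] by (auto simp: S_def)
  have [measurable]: "h \<in> borel_measurable (Y \<Otimes>\<^sub>M borel)"
  proof (rule borel_measurableI_greater)
    fix x :: real
    have "countable (\<rat> \<inter> {-1..1::real})" using countable_rat by auto
    then show "{z \<in> space (Y \<Otimes>\<^sub>M borel). x < h z} \<in> sets (Y \<Otimes>\<^sub>M borel)"
      unfolding h_gt by measurable
  qed
  have main: "emeasure (\<nu> \<Otimes>\<^sub>M unif) {z\<in>space (\<nu> \<Otimes>\<^sub>M unif). fst z \<in> C \<and> x < h z} = H C x"
    if C [measurable]: "C \<in> sets Y" for C x
  proof -
    define R where "R = \<rat> \<inter> {-1..1} \<inter> {x<..}"
    have R: "countable R" unfolding R_def using countable_rat by auto
    have "emeasure (\<nu> \<Otimes>\<^sub>M unif) {z\<in>space (\<nu> \<Otimes>\<^sub>M unif). fst z \<in> C \<and> x < h z}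
      = (\<integral>\<^sup>+y. emeasure unif (Pair y -` {z\<in>space (\<nu> \<Otimes>\<^sub>M unif). fst z \<in> C \<and> x < h z}) \<partial>\<nu>)"
      by (rule U.emeasure_pair_measure_alt) measurable
    also have "\<dots> = (\<integral>\<^sup>+y. (if x < -1 then 1 else (SUP r\<in>R. ennreal (F r y))) * indicator C y \<partial>\<nu>)"
    proof (rule nn_integral_cong)
      fix y assume y: "y \<in> space \<nu>"
      let ?A = "Pair y -` {z\<in>space (\<nu> \<Otimes>\<^sub>M unif). fst z \<in> C \<and> x < h z}"
      show "emeasure unif ?A = (if x < -1 then 1 else (SUP r\<in>R. ennreal (F r y))) * indicator C y"
      proof (cases "y \<in> C")
        case False
        then have "?A = {}" by auto
        then show ?thesis using False by simp
      next
        case True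
        show ?thesis
        proof (cases "x < -1")
          case True
          then have "?A = space unif" using \<open>y \<in> C\<close> y by (auto simp: h_gt space_pair_measure)
          then show ?thesis using \<open>y \<in> C\<close> True U.emeasure_space_1 by simp
        next
          case False
          have eq: "?A = {u. x < h (y, u)}" using \<open>y \<in> C\<close> y by (auto simp: space_pair_measure)
          have A: "?A = {u. \<exists>r\<in>R. u \<le> F r y}"
            unfolding eq using False by (auto simp: h_gt R_def)
          have mA: "?A \<in> sets unif"
            by (rule sets_Pair1) measurable
          have "emeasure unif ?A = emeasure unif {u. 0 < u \<and> u \<le> 1 \<and> (\<exists>a\<in>(\<lambda>r. F r y) ` R. u \<le> a)}"
          proof (rule emeasure_eq_AE)
            show "AE u in unif. (u \<in> ?A) = (u \<in> {u. 0 < u \<and> u \<le> 1 \<and> (\<exists>a\<in>(\<lambda>r. F r y) ` R. u \<le> a)})"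
              unfolding A using AE_unif by eventually_elim auto
            have "{u. 0 < u \<and> u \<le> 1 \<and> (\<exists>a\<in>(\<lambda>r. F r y) ` R. u \<le> a)} = {0<..1} \<inter> ?A"
              unfolding A by auto
            then show "{u. 0 < u \<and> u \<le> 1 \<and> (\<exists>a\<in>(\<lambda>r. F r y) ` R. u \<le> a)} \<in> sets unif"
              using mA by auto
          qed (rule mA)
          also have "\<dots> = (SUP a\<in>(\<lambda>r. F r y) ` R. ennreal a)"
            using R F01 by (intro emeasure_unif_below_Sup) auto
          finally show ?thesis using \<open>y \<in> C\<close> False by (simp add: image_image)
        qed
      qed
    qed
    also have "\<dots> = H C x"
    proof (cases "x < -1")
      case True
      then have "H C x = emeasure \<nu> C"
        using g01(1) by (auto simp: H_def \<nu>_def emeasure_distr intro!: arg_cong[where f = "emeasure P"]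
          intro: less_le_trans[of x 0])
      then show ?thesis using True by simp
    next
      case False
      have [measurable]: "(\<lambda>y. SUP r\<in>R. ennreal (F r y)) \<in> borel_measurable \<nu>"
        using R by (intro borel_measurable_SUP) auto
      have "AE y in \<nu>. \<forall>r\<in>R. F r y \<le> F x y"
        using R anti by (subst AE_ball_countable) (auto simp: R_def)
      then have "AE y in \<nu>. (SUP r\<in>R. ennreal (F r y)) * indicator C y \<le> ennreal (F x y) * indicator C y"
        by eventually_elim (auto simp: indicator_def intro!: SUP_least ennreal_leI)
      then have "(\<integral>\<^sup>+y. (SUP r\<in>R. ennreal (F r y)) * indicator C y \<partial>\<nu>)
          \<le> (\<integral>\<^sup>+y. ennreal (F x y) * indicator C y \<partial>\<nu>)"
        by (rule nn_integral_mono_AE)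
      then have le: "(\<integral>\<^sup>+y. (SUP r\<in>R. ennreal (F r y)) * indicator C y \<partial>\<nu>) \<le> H C x"
        using FH[OF C, of x] by simp
      have ge: "H C r \<le> (\<integral>\<^sup>+y. (SUP r\<in>R. ennreal (F r y)) * indicator C y \<partial>\<nu>)" if "r \<in> R" for r
        unfolding FH[OF C, symmetric] using that
        by (intro nn_integral_mono mult_right_mono) (auto intro: SUP_upper)
      \<comment> \<open>Continuity from the right in the level, along the sequence \<open>x + 1 / (n + 1)\<close>.\<close>
      have "H C x = (SUP n. H C (x + inverse (real (Suc n))))"
      proof -
        have "(SUP n. H C (x + inverse (real (Suc n)))) = emeasure P (\<Union>n. {\<omega>\<in>space P. f \<omega> \<in> C \<and> x + inverse (real (Suc n)) < g \<omega>})"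
          unfolding H_def
        proof (rule SUP_emeasure_incseq)
          show "incseq (\<lambda>n. {\<omega> \<in> space P. f \<omega> \<in> C \<and> x + inverse (real (Suc n)) < g \<omega>})"
          proof (rule incseq_SucI)
            fix n
            have "inverse (real (Suc (Suc n))) \<le> inverse (real (Suc n))" by (simp add: field_simps)
            then show "{\<omega> \<in> space P. f \<omega> \<in> C \<and> x + inverse (real (Suc n)) < g \<omega>}
              \<subseteq> {\<omega> \<in> space P. f \<omega> \<in> C \<and> x + inverse (real (Suc (Suc n))) < g \<omega>}"
              by (intro Collect_mono impI conjI; elim conjE; linarith?)
          qed
        qed auto
        also have "(\<Union>n. {\<omega>\<in>space P. f \<omega> \<in> C \<and> x + inverse (real (Suc n)) < g \<omega>})
          = {\<omega>\<in>space P. f \<omega> \<in> C \<and> x < g \<omega>}"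
        proof (safe; clarsimp)
          fix \<omega> n assume "x + inverse (1 + real n) < g \<omega>"
          moreover have "0 < inverse (1 + real n)" by simp
          ultimately show "x < g \<omega>" by linarith
        next
          fix \<omega> assume "x < g \<omega>"
          then obtain n where "inverse (real (Suc n)) < g \<omega> - x" using reals_Archimedean[of "g \<omega> - x"] by auto
          then show "\<exists>n. x + inverse (1 + real n) < g \<omega>" by (intro exI[of _ n]) (simp add: algebra_simps)
        qed
        finally show ?thesis by (simp add: H_def)
      qed
      also have "\<dots> \<le> (\<integral>\<^sup>+y. (SUP r\<in>R. ennreal (F r y)) * indicator C y \<partial>\<nu>)"
      proof (rule SUP_least)
        fix n
        show "H C (x + inverse (real (Suc n))) \<le> (\<integral>\<^sup>+y. (SUP r\<in>R. ennreal (F r y)) * indicator C y \<partial>\<nu>)"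
        proof (cases "x + inverse (real (Suc n)) < 1")
          case False
          then have "H C (x + inverse (real (Suc n))) = emeasure P {}"
            unfolding H_def using g01(2) by (intro arg_cong[where f = "emeasure P"]) (auto simp: not_less intro: order_trans)
          then show ?thesis by simp
        next
          case True
          obtain r where r: "r \<in> \<rat>" "x < r" "r < x + inverse (real (Suc n))"
            using Rats_dense_in_real[of x "x + inverse (real (Suc n))"] by auto
          then have "r \<in> R" using True False by (auto simp: R_def)
          have "H C (x + inverse (real (Suc n))) \<le> H C r"
            unfolding H_def using r by (intro emeasure_mono) auto
          then show ?thesis using ge[OF \<open>r \<in> R\<close>] by simp
        qed
      qed
      finally show ?thesis using le False by (simp add: antisym)
    qed
    finally show ?thesis .
  qed
  let ?L = "distr (\<nu> \<Otimes>\<^sub>M unif) (Y \<Otimes>\<^sub>M borel) (\<lambda>(y, u). (y, h (y, u)))"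
  let ?R = "distr P (Y \<Otimes>\<^sub>M borel) (\<lambda>\<omega>. (f \<omega>, g \<omega>))"
  have mL [measurable]: "(\<lambda>(y, u). (y, h (y, u))) \<in> measurable (\<nu> \<Otimes>\<^sub>M unif) (Y \<Otimes>\<^sub>M borel)"
    by measurable
  have mR [measurable]: "(\<lambda>\<omega>. (f \<omega>, g \<omega>)) \<in> measurable P (Y \<Otimes>\<^sub>M borel)"
    by measurable
  have "?L = ?R"
  proof (rule measure_eqI_pair_rectangles)
    show "finite_measure ?L"
      using \<nu>U.prob_space_distr[OF mL] by (rule prob_space.finite_measure)
    fix C D assume C [measurable]: "C \<in> sets Y" and D: "D \<in> sets (borel :: real measure)"
    define LC where "LC = distr (restrict_space (\<nu> \<Otimes>\<^sub>M unif) {z\<in>space (\<nu> \<Otimes>\<^sub>M unif). fst z \<in> C}) borel h"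
    define RC where "RC = distr (restrict_space P {\<omega>\<in>space P. f \<omega> \<in> C}) borel g"
    have LC: "emeasure LC D = emeasure (\<nu> \<Otimes>\<^sub>M unif) {z\<in>space (\<nu> \<Otimes>\<^sub>M unif). fst z \<in> C \<and> h z \<in> D}"
      if [measurable]: "D \<in> sets borel" for D
      unfolding LC_def using that by (intro emeasure_distr_restrict_space) measurable
    have RC: "emeasure RC D = emeasure P {\<omega>\<in>space P. f \<omega> \<in> C \<and> g \<omega> \<in> D}"
      if [measurable]: "D \<in> sets borel" for D
      unfolding RC_def using that by (intro emeasure_distr_restrict_space) measurable
    have "LC = RC"
    proof (rule measure_eqI_lessThan)
      show "emeasure LC {x<..} < \<infinity>" for x by (subst LC) (auto simp: less_top[symmetric])
      show "emeasure LC {x<..} = emeasure RC {x<..}" for x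
        using main[OF C, of x] by (simp add: LC RC H_def)
    qed (auto simp: LC_def RC_def)
    then have "emeasure LC D = emeasure RC D" by simp
    moreover have "emeasure ?L (C \<times> D) = emeasure LC D"
      unfolding LC[OF D] using D
      by (subst emeasure_distr[OF mL]) (auto intro!: arg_cong[where f = "emeasure _"])
    moreover have "emeasure ?R (C \<times> D) = emeasure RC D"
      unfolding RC[OF D] using D
      by (subst emeasure_distr[OF mR]) (auto intro!: arg_cong[where f = "emeasure _"])
    ultimately show "emeasure ?L (C \<times> D) = emeasure ?R (C \<times> D)" by simp
  qed (simp_all only: sets_distr)
  then show ?thesis using that[of h] unfolding \<nu>_def by simp
qed

text \<open>
  A joint law of a label \<open>f\<close> and a Polish variable \<open>g\<close> can be generated by computing the second
  variable from the label and an independent uniform one.  This does the work of a regular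
  conditional law of \<open>g\<close> given \<open>f\<close>.
\<close>

lemma noise_outsourcing:
  fixes g :: "'x \<Rightarrow> 'a::polish_space"
  assumes P: "prob_space P" and f [measurable]: "f \<in> measurable P Y"
    and g [measurable]: "g \<in> borel_measurable P"
  obtains h where "h \<in> borel_measurable (Y \<Otimes>\<^sub>M borel)"
    "distr (distr P Y f \<Otimes>\<^sub>M unif) (Y \<Otimes>\<^sub>M borel) (\<lambda>(y, u). (y, h (y, u)))
      = distr P (Y \<Otimes>\<^sub>M borel) (\<lambda>\<omega>. (f \<omega>, g \<omega>))"
proof -
  obtain c :: "'a \<Rightarrow> real" and dec where c [measurable]: "c \<in> borel_measurable borel"
    "dec \<in> borel_measurable borel" and c_dec: "\<And>a. dec (c a) = a" "\<And>a. 0 \<le> c a" "\<And>a. c a \<le> 1"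
    using polish_real_coding by metis
  obtain h where h [measurable]: "h \<in> borel_measurable (Y \<Otimes>\<^sub>M borel)" and
    eq: "distr (distr P Y f \<Otimes>\<^sub>M unif) (Y \<Otimes>\<^sub>M borel) (\<lambda>(y, u). (y, h (y, u)))
      = distr P (Y \<Otimes>\<^sub>M borel) (\<lambda>\<omega>. (f \<omega>, c (g \<omega>)))"
    by (rule conditional_quantile[OF P f, of "\<lambda>\<omega>. c (g \<omega>)"]) (use c_dec in auto)
  show ?thesis
  proof
    show "(\<lambda>z. dec (h z)) \<in> borel_measurable (Y \<Otimes>\<^sub>M borel)" by measurable
    have "distr (distr (distr P Y f \<Otimes>\<^sub>M unif) (Y \<Otimes>\<^sub>M borel) (\<lambda>(y, u). (y, h (y, u))))
        (Y \<Otimes>\<^sub>M borel) (\<lambda>(y, v). (y, dec v))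
      = distr (distr P (Y \<Otimes>\<^sub>M borel) (\<lambda>\<omega>. (f \<omega>, c (g \<omega>)))) (Y \<Otimes>\<^sub>M borel) (\<lambda>(y, v). (y, dec v))"
      by (simp add: eq)
    then show "distr (distr P Y f \<Otimes>\<^sub>M unif) (Y \<Otimes>\<^sub>M borel) (\<lambda>(y, u). (y, dec (h (y, u))))
      = distr P (Y \<Otimes>\<^sub>M borel) (\<lambda>\<omega>. (f \<omega>, g \<omega>))"
      by (subst (asm) (1 2) distr_distr) (auto simp: comp_def split_beta' c_dec)
  qed
qed

section \<open>Coupling two laws whose tails merge\<close>

text \<open>
  \<open>v\<close> and \<open>v'\<close> carve the common part \<open>\<rho> \<and> \<rho>'\<close> out of each of the two measures.  \<open>C\<close> is a Hahn set
  on which \<open>\<rho>\<close> is the larger one, so there the common part is all of \<open>\<rho>'\<close>, and all of \<open>\<rho>\<close> outside.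
  Hence the mass of \<open>\<rho>\<close> outside the common part is the difference of the two measures on \<open>C\<close>.
\<close>

lemma common_part_densities:
  assumes fin: "finite_measure \<rho>" "finite_measure \<rho>'" and sets: "sets \<rho> = sets Y" "sets \<rho>' = sets Y"
  obtains v v' :: "'y \<Rightarrow> real" and C where
    "v \<in> borel_measurable Y" "v' \<in> borel_measurable Y" "C \<in> sets Y"
    "\<And>y. 0 \<le> v y" "\<And>y. v y \<le> 1" "\<And>y. 0 \<le> v' y" "\<And>y. v' y \<le> 1"
    "\<And>y. y \<notin> C \<Longrightarrow> v y = 1" "\<And>y. y \<in> C \<Longrightarrow> v' y = 1"
    "density \<rho> (\<lambda>y. ennreal (v y)) = density \<rho>' (\<lambda>y. ennreal (v' y))"
proof -
  interpret \<rho>: finite_measure \<rho> by fact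
  interpret \<rho>': finite_measure \<rho>' by fact
  have space: "space \<rho> = space Y" "space \<rho>' = space Y"
    using sets by (auto dest: sets_eq_imp_space_eq)
  have meas: "borel_measurable \<rho> = borel_measurable Y" "borel_measurable \<rho>' = borel_measurable Y"
    by (intro measurable_cong_sets sets refl)+
  obtain C where C: "C \<in> sets Y"
    and le: "\<And>X. X \<in> sets Y \<Longrightarrow> X \<subseteq> C \<Longrightarrow> emeasure \<rho>' X \<le> emeasure \<rho> X"
    and ge: "\<And>X. X \<in> sets Y \<Longrightarrow> X \<inter> C = {} \<Longrightarrow> emeasure \<rho> X \<le> emeasure \<rho>' X"
    using finite_unsigned_Hahn_decomposition[OF fin] sets by metis
  have restr: "emeasure (density \<sigma> (indicator B)) A = emeasure \<sigma> (A \<inter> B)"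
    if "sets \<sigma> = sets Y" "A \<in> sets Y" "B \<in> sets Y" for \<sigma> A B
    using that by (simp add: emeasure_density nn_integral_cong[OF indicator_inter_arith[symmetric]]
        Int_commute flip: indicator_inter_arith)
  have "emeasure (density \<rho>' (indicator C)) A \<le> emeasure \<rho> A" if "A \<in> sets \<rho>" for A
  proof -
    have A: "A \<in> sets Y" using that sets by simp
    have "emeasure \<rho>' (A \<inter> C) \<le> emeasure \<rho> (A \<inter> C)" using A C by (intro le) auto
    also have "\<dots> \<le> emeasure \<rho> A" using that by (intro emeasure_mono) auto
    finally show ?thesis using restr[OF sets(2) A C] by simp
  qed
  then obtain v1 :: "'y \<Rightarrow> real" where v1: "v1 \<in> borel_measurable \<rho>" "\<And>x. 0 \<le> v1 x" "\<And>x. v1 x \<le> 1"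
    "density \<rho>' (indicator C) = density \<rho> (\<lambda>x. ennreal (v1 x))"
    using bounded_density_exists[OF fin(1), of "density \<rho>' (indicator C)"] sets by (metis sets_density)
  have "emeasure (density \<rho> (indicator (space Y - C))) A \<le> emeasure \<rho>' A" if "A \<in> sets \<rho>'" for A
  proof -
    have A: "A \<in> sets Y" using that sets by simp
    have "emeasure \<rho> (A \<inter> (space Y - C)) \<le> emeasure \<rho>' (A \<inter> (space Y - C))"
      using A C by (intro ge) auto
    also have "\<dots> \<le> emeasure \<rho>' A" using that by (intro emeasure_mono) auto
    finally show ?thesis using restr[OF sets(1) A, of "space Y - C"] C by simp
  qed
  then obtain v2 :: "'y \<Rightarrow> real" where v2: "v2 \<in> borel_measurable \<rho>'" "\<And>x. 0 \<le> v2 x" "\<And>x. v2 x \<le> 1"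
    "density \<rho> (indicator (space Y - C)) = density \<rho>' (\<lambda>x. ennreal (v2 x))"
    using bounded_density_exists[OF fin(2), of "density \<rho> (indicator (space Y - C))"] sets by (metis sets_density)
  define v where "v y = (if y \<in> C then v1 y else 1)" for y
  define v' where "v' y = (if y \<in> C then 1 else v2 y)" for y
  have m: "v1 \<in> borel_measurable Y" "v2 \<in> borel_measurable Y" using v1(1) v2(1) meas by auto
  have mv: "v \<in> borel_measurable Y" "v' \<in> borel_measurable Y"
    unfolding v_def v'_def using m C by measurable
  have split: "emeasure (density \<sigma> (\<lambda>y. ennreal (u y))) A
      = (\<integral>\<^sup>+y. ennreal (u y) * indicator (A \<inter> C) y \<partial>\<sigma>) + (\<integral>\<^sup>+y. ennreal (u y) * indicator (A - C) y \<partial>\<sigma>)"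
    if "sets \<sigma> = sets Y" "A \<in> sets Y" "u \<in> borel_measurable Y" for \<sigma> A and u :: "'y \<Rightarrow> real"
  proof -
    have [measurable]: "u \<in> borel_measurable \<sigma>" using that by (simp cong: measurable_cong_sets)
    have [measurable]: "A \<in> sets \<sigma>" "C \<in> sets \<sigma>" using that C by auto
    show ?thesis
      by (subst emeasure_density, simp, simp, subst nn_integral_add[symmetric])
        (auto intro!: nn_integral_cong simp: indicator_def)
  qed
  have part: "(\<integral>\<^sup>+y. indicator B y \<partial>\<sigma>) = emeasure \<sigma> B"
    if "sets \<sigma> = sets Y" "B \<in> sets Y" for \<sigma> B
    using that by simp
  have "density \<rho> (\<lambda>y. ennreal (v y)) = density \<rho>' (\<lambda>y. ennreal (v' y))"
  proof (rule measure_eqI)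
    fix A assume "A \<in> sets (density \<rho> (\<lambda>y. ennreal (v y)))"
    then have A: "A \<in> sets Y" using sets by simp
    have AC: "A \<inter> C \<in> sets Y" "A - C \<in> sets Y" using A C by auto
    have "(\<integral>\<^sup>+y. ennreal (v y) * indicator (A \<inter> C) y \<partial>\<rho>) = emeasure (density \<rho> (\<lambda>x. ennreal (v1 x))) (A \<inter> C)"
      using AC v1(1) sets by (subst emeasure_density) (auto intro!: nn_integral_cong simp: v_def indicator_def)
    also have "\<dots> = emeasure \<rho>' (A \<inter> C)"
      using restr[OF sets(2) AC(1) C] by (simp add: v1(4)[symmetric])
    also have "\<dots> = (\<integral>\<^sup>+y. ennreal (v' y) * indicator (A \<inter> C) y \<partial>\<rho>')"
      unfolding part[OF sets(2) AC(1), symmetric]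
      by (intro nn_integral_cong) (auto simp: v'_def indicator_def)
    finally have 1: "(\<integral>\<^sup>+y. ennreal (v y) * indicator (A \<inter> C) y \<partial>\<rho>) = \<dots>" .
    have "(\<integral>\<^sup>+y. ennreal (v' y) * indicator (A - C) y \<partial>\<rho>') = emeasure (density \<rho>' (\<lambda>x. ennreal (v2 x))) (A - C)"
      using AC v2(1) sets by (subst emeasure_density) (auto intro!: nn_integral_cong simp: v'_def indicator_def)
    also have "\<dots> = emeasure \<rho> (A - C)"
    proof -
      have "(A - C) \<inter> (space Y - C) = A - C" using sets.sets_into_space[OF A] by auto
      then show ?thesis using restr[OF sets(1) AC(2), of "space Y - C"] C by (simp add: v2(4)[symmetric])
    qed
    also have "\<dots> = (\<integral>\<^sup>+y. ennreal (v y) * indicator (A - C) y \<partial>\<rho>)"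
      unfolding part[OF sets(1) AC(2), symmetric]
      by (intro nn_integral_cong) (auto simp: v_def indicator_def)
    finally have 2: "(\<integral>\<^sup>+y. ennreal (v' y) * indicator (A - C) y \<partial>\<rho>') = \<dots>" .
    show "emeasure (density \<rho> (\<lambda>y. ennreal (v y))) A = emeasure (density \<rho>' (\<lambda>y. ennreal (v' y))) A"
      unfolding split[OF sets(1) A mv(1)] split[OF sets(2) A mv(2)] 1 2 ..
  qed (use sets in simp)
  then show ?thesis
    using that[OF mv C] v1(2,3) v2(2,3) by (auto simp: v_def v'_def)
qed

text \<open>
  The weights \<open>r\<close> and \<open>r'\<close> describe the mass not yet coupled under \<open>P\<close> and \<open>Q\<close>.  The step removes
  from both of them the largest parts that have the same law of \<open>f\<close>.  The mass left over is a
  difference of the two laws of \<open>f\<close> on a single set, which is how the rate of merging enters.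
\<close>

lemma thinning_step:
  fixes r r' :: "'e \<Rightarrow> real" and Y :: "'b measure"
  assumes P: "prob_space P" "sets P = sets N" and Q: "prob_space Q" "sets Q = sets N"
    and f [measurable]: "f \<in> measurable N Y"
    and r [measurable]: "r \<in> borel_measurable N" and r01: "\<And>s. 0 \<le> r s" "\<And>s. r s \<le> 1"
    and r' [measurable]: "r' \<in> borel_measurable N" and r'01: "\<And>s. 0 \<le> r' s" "\<And>s. r' s \<le> 1"
  obtains q q' :: "'e \<Rightarrow> real" and C where "q \<in> borel_measurable N" "q' \<in> borel_measurable N"
    "\<And>s. 0 \<le> q s" "\<And>s. q s \<le> r s" "\<And>s. 0 \<le> q' s" "\<And>s. q' s \<le> r' s"
    "\<And>B. B \<in> sets Y \<Longrightarrow> (\<integral>s. (r s - q s) * indicator B (f s) \<partial>P) = (\<integral>s. (r' s - q' s) * indicator B (f s) \<partial>Q)"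
    "C \<in> sets Y"
    "(\<integral>s. q s \<partial>P) = (\<integral>s. r s * indicator C (f s) \<partial>P) - (\<integral>s. r' s * indicator C (f s) \<partial>Q)"
    "(\<integral>s. q' s \<partial>Q) = (\<integral>s. r' s * indicator (space Y - C) (f s) \<partial>Q) - (\<integral>s. r s * indicator (space Y - C) (f s) \<partial>P)"
proof -
  interpret P: prob_space P by fact
  interpret Q: prob_space Q by fact
  note [measurable_cong] = P(2) Q(2)
  have spc: "space P = space N" "space Q = space N" using P(2) Q(2) by (auto dest: sets_eq_imp_space_eq)
  define \<rho> where "\<rho> = distr (density P (\<lambda>s. ennreal (r s))) Y f"
  define \<rho>' where "\<rho>' = distr (density Q (\<lambda>s. ennreal (r' s))) Y f"
  have sets: "sets \<rho> = sets Y" "sets \<rho>' = sets Y" by (simp_all add: \<rho>_def \<rho>'_def)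
  have fin: "finite_measure (distr (density R (\<lambda>s. ennreal (u s))) Y f)"
    if "prob_space R" "sets R = sets N" "u \<in> borel_measurable N" "\<And>s. u s \<le> 1" for R and u :: "'e \<Rightarrow> real"
  proof -
    interpret R: prob_space R by fact
    note [measurable_cong] = that(2) and [measurable] = that(3)
    have "(\<integral>\<^sup>+s. ennreal (u s) \<partial>R) \<le> (\<integral>\<^sup>+s. 1 \<partial>R)"
      by (intro nn_integral_mono) (use that(4) in \<open>simp add: ennreal_le_1\<close>)
    then have "(\<integral>\<^sup>+s. ennreal (u s) \<partial>R) < \<infinity>"
      by (simp add: R.emeasure_space_1 le_less_trans)
    then have "finite_measure (density R (\<lambda>s. ennreal (u s)))"
      by (intro finite_measureI) (simp add: emeasure_density cong: nn_integral_cong)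
    then show ?thesis by (rule finite_measure.finite_measure_distr) simp
  qed
  obtain v v' :: "'b \<Rightarrow> real" and C where v [measurable]: "v \<in> borel_measurable Y" "v' \<in> borel_measurable Y"
    and C [measurable]: "C \<in> sets Y"
    and v01: "\<And>y. 0 \<le> v y" "\<And>y. v y \<le> 1" "\<And>y. 0 \<le> v' y" "\<And>y. v' y \<le> 1"
    and v1: "\<And>y. y \<notin> C \<Longrightarrow> v y = 1" "\<And>y. y \<in> C \<Longrightarrow> v' y = 1"
    and eq: "density \<rho> (\<lambda>y. ennreal (v y)) = density \<rho>' (\<lambda>y. ennreal (v' y))"
    by (rule common_part_densities[OF fin[OF P r r01(2), folded \<rho>_def] fin[OF Q r' r'01(2), folded \<rho>'_def] sets];
      rule that; assumption)
  have dens: "emeasure (density (distr (density R (\<lambda>s. ennreal (u s))) Y f) (\<lambda>y. ennreal (w y))) B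
      = (\<integral>\<^sup>+s. ennreal (u s * w (f s) * indicator B (f s)) \<partial>R)"
    if "sets R = sets N" "u \<in> borel_measurable N" "w \<in> borel_measurable Y" "B \<in> sets Y"
      "\<And>s. 0 \<le> u s" "\<And>y. 0 \<le> w y" for R B and u :: "'e \<Rightarrow> real" and w :: "'b \<Rightarrow> real"
  proof -
    note [measurable_cong] = that(1) and [measurable] = that(2,3,4)
    have "emeasure (density (distr (density R (\<lambda>s. ennreal (u s))) Y f) (\<lambda>y. ennreal (w y))) B
      = (\<integral>\<^sup>+s. ennreal (u s) * (ennreal (w (f s)) * indicator B (f s)) \<partial>R)"
      by (subst emeasure_density, simp, simp, subst nn_integral_distr, simp, simp, subst nn_integral_density) auto
    also have "\<dots> = (\<integral>\<^sup>+s. ennreal (u s * w (f s) * indicator B (f s)) \<partial>R)"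
      using that(5,6) by (intro nn_integral_cong) (simp add: ennreal_mult ennreal_indicator[symmetric] mult.assoc)
    finally show ?thesis .
  qed
  have match: "(\<integral>s. r s * v (f s) * indicator B (f s) \<partial>P) = (\<integral>s. r' s * v' (f s) * indicator B (f s) \<partial>Q)"
    if [measurable]: "B \<in> sets Y" for B
  proof -
    have "(\<integral>\<^sup>+s. ennreal (r s * v (f s) * indicator B (f s)) \<partial>P) = (\<integral>\<^sup>+s. ennreal (r' s * v' (f s) * indicator B (f s)) \<partial>Q)"
      using dens[OF P(2) r v(1) that r01(1) v01(1)] dens[OF Q(2) r' v(2) that r'01(1) v01(3)] eq
      unfolding \<rho>_def \<rho>'_def by simp
    then show ?thesis
      using r01 r'01 v01 by (subst (1 2) integral_eq_nn_integral) auto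
  qed
  define q where "q s = r s * (1 - v (f s))" for s
  define q' where "q' s = r' s * (1 - v' (f s))" for s
  have intP: "integrable P (\<lambda>s. u s)" if "u \<in> borel_measurable N" "\<And>s. \<bar>u s\<bar> \<le> 1" for u :: "'e \<Rightarrow> real"
    using that by (intro P.integrable_const_bound[where B = 1]) (auto cong: measurable_cong_sets)
  have intQ: "integrable Q (\<lambda>s. u s)" if "u \<in> borel_measurable N" "\<And>s. \<bar>u s\<bar> \<le> 1" for u :: "'e \<Rightarrow> real"
    using that by (intro Q.integrable_const_bound[where B = 1]) (auto cong: measurable_cong_sets)
  have bd1: "\<bar>a * indicator X z\<bar> \<le> (1::real)"
    if "0 \<le> a" "a \<le> 1" for a and X :: "'b set" and z
    using that by (simp add: indicator_def)
  have bd: "\<bar>a * b * indicator X z\<bar> \<le> (1::real)"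
    if "0 \<le> a" "a \<le> 1" "0 \<le> b" "b \<le> 1" for a b and X :: "'b set" and z
    using that by (intro bd1 mult_le_one mult_nonneg_nonneg)
  have loss: "(\<integral>s. q s \<partial>P) = (\<integral>s. r s * indicator C (f s) \<partial>P) - (\<integral>s. r' s * indicator C (f s) \<partial>Q)"
  proof -
    have "(\<integral>s. q s \<partial>P) = (\<integral>s. r s * indicator C (f s) - r s * v (f s) * indicator C (f s) \<partial>P)"
      by (intro Bochner_Integration.integral_cong) (auto simp: q_def indicator_def v1 algebra_simps)
    also have "\<dots> = (\<integral>s. r s * indicator C (f s) \<partial>P) - (\<integral>s. r s * v (f s) * indicator C (f s) \<partial>P)"
      by (intro Bochner_Integration.integral_diff intP bd bd1) (use r01 v01 in auto)
    also have "(\<integral>s. r s * v (f s) * indicator C (f s) \<partial>P) = (\<integral>s. r' s * indicator C (f s) \<partial>Q)"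
      unfolding match[OF C] by (intro Bochner_Integration.integral_cong) (auto simp: indicator_def v1)
    finally show ?thesis .
  qed
  have loss': "(\<integral>s. q' s \<partial>Q) = (\<integral>s. r' s * indicator (space Y - C) (f s) \<partial>Q) - (\<integral>s. r s * indicator (space Y - C) (f s) \<partial>P)"
  proof -
    have fY: "f s \<in> space Y" if "s \<in> space N" for s using measurable_space[OF f that] .
    have "(\<integral>s. q' s \<partial>Q) = (\<integral>s. r' s * indicator (space Y - C) (f s) - r' s * v' (f s) * indicator (space Y - C) (f s) \<partial>Q)"
      by (intro Bochner_Integration.integral_cong) (auto simp: q'_def indicator_def v1 algebra_simps fY spc)
    also have "\<dots> = (\<integral>s. r' s * indicator (space Y - C) (f s) \<partial>Q) - (\<integral>s. r' s * v' (f s) * indicator (space Y - C) (f s) \<partial>Q)"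
      by (intro Bochner_Integration.integral_diff intQ bd bd1) (use r'01 v01 in auto)
    also have "(\<integral>s. r' s * v' (f s) * indicator (space Y - C) (f s) \<partial>Q) = (\<integral>s. r s * indicator (space Y - C) (f s) \<partial>P)"
      unfolding match[OF sets.compl_sets[OF C], symmetric]
      by (intro Bochner_Integration.integral_cong) (auto simp: indicator_def v1)
    finally show ?thesis .
  qed
  show ?thesis
  proof (rule that[of q q' C])
    show "q \<in> borel_measurable N" "q' \<in> borel_measurable N" unfolding q_def q'_def by measurable
    show "0 \<le> q s" "q s \<le> r s" "0 \<le> q' s" "q' s \<le> r' s" for s
      using r01 r'01 v01 by (auto simp: q_def q'_def mult_left_le)
    show "(\<integral>s. (r s - q s) * indicator B (f s) \<partial>P) = (\<integral>s. (r' s - q' s) * indicator B (f s) \<partial>Q)"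
      if "B \<in> sets Y" for B
      using match[OF that] by (simp add: q_def q'_def algebra_simps)
  qed (fact C loss loss')+
qed


text \<open>
  \<open>w k s\<close> is the probability with which the path \<open>s\<close> is coupled at time \<open>k\<close> under \<open>P\<close>, and likewise
  \<open>w'\<close> under \<open>Q\<close>; the coupled parts have equal laws of \<open>\<tau> k\<close>.  They are found greedily.  Removing
  parts with equal laws of \<open>\<tau> k\<close> leaves the difference of the laws of every later \<open>\<tau> j\<close> as it
  was, because \<open>\<tau> j\<close> is a function of \<open>\<tau> k\<close>.  So the mass that is still uncoupled after step \<open>k\<close> is
  bounded by the original discrepancy \<open>e k\<close>, and it vanishes in the limit.
\<close>

lemma matching_weights:
  fixes \<tau> :: "nat \<Rightarrow> 'e \<Rightarrow> 'e" and e :: "nat \<Rightarrow> real"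
  assumes P: "prob_space P" "sets P = sets N" and Q: "prob_space Q" "sets Q = sets N"
    and \<tau>: "\<And>k. \<tau> k \<in> measurable N N"
    and factor: "\<And>j k. k \<le> j \<Longrightarrow> \<exists>\<sigma>\<in>measurable N N. \<forall>s\<in>space N. \<tau> j s = \<sigma> (\<tau> k s)"
    and merge: "\<And>k B. B \<in> sets N \<Longrightarrow>
      \<bar>(\<integral>s. indicator B (\<tau> k s) \<partial>P) - (\<integral>s. indicator B (\<tau> k s) \<partial>Q)\<bar> \<le> e k"
    and e: "e \<longlonglongrightarrow> 0"
  obtains w w' :: "nat \<Rightarrow> 'e \<Rightarrow> real" where
    "\<And>k. w k \<in> borel_measurable N" "\<And>k. w' k \<in> borel_measurable N"
    "\<And>k s. 0 \<le> w k s" "\<And>k s. 0 \<le> w' k s"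
    "AE s in P. (\<lambda>k. w k s) sums 1" "AE s in Q. (\<lambda>k. w' k s) sums 1"
    "\<And>k B. B \<in> sets N \<Longrightarrow> (\<integral>\<^sup>+s. ennreal (w k s) * indicator B (\<tau> k s) \<partial>P)
      = (\<integral>\<^sup>+s. ennreal (w' k s) * indicator B (\<tau> k s) \<partial>Q)"
proof -
  interpret P: prob_space P by fact
  interpret Q: prob_space Q by fact
  note [measurable_cong] = P(2) Q(2)
  have spc: "space P = space N" "space Q = space N" using P(2) Q(2) by (auto dest: sets_eq_imp_space_eq)
  define ok where "ok u \<longleftrightarrow> u \<in> borel_measurable N \<and> (\<forall>s. 0 \<le> u s) \<and> (\<forall>s. u s \<le> 1)" for u :: "'e \<Rightarrow> real"
  \<comment> \<open>\<open>rel k\<close> relates the pair of weights before time \<open>k\<close> to the pair after it.\<close>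
  define rel where "rel k z z' \<longleftrightarrow> (\<forall>s. fst z' s \<le> fst z s) \<and> (\<forall>s. snd z' s \<le> snd z s) \<and>
    (\<forall>B\<in>sets N. (\<integral>s. (fst z s - fst z' s) * indicator B (\<tau> k s) \<partial>P) = (\<integral>s. (snd z s - snd z' s) * indicator B (\<tau> k s) \<partial>Q)) \<and>
    (\<exists>C\<in>sets N. (\<integral>s. fst z' s \<partial>P) = (\<integral>s. fst z s * indicator C (\<tau> k s) \<partial>P) - (\<integral>s. snd z s * indicator C (\<tau> k s) \<partial>Q)) \<and>
    (\<exists>C\<in>sets N. (\<integral>s. snd z' s \<partial>Q) = (\<integral>s. snd z s * indicator C (\<tau> k s) \<partial>Q) - (\<integral>s. fst z s * indicator C (\<tau> k s) \<partial>P))"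
    for k and z z' :: "('e \<Rightarrow> real) \<times> ('e \<Rightarrow> real)"
  have "\<exists>z. \<forall>k. ((ok (fst (z k)) \<and> ok (snd (z k))) \<and> (k = 0 \<longrightarrow> z k = (\<lambda>_. 1, \<lambda>_. 1))) \<and> rel k (z k) (z (Suc k))"
  proof (rule dependent_nat_choice)
    show "\<exists>x. (ok (fst x) \<and> ok (snd x)) \<and> ((0::nat) = 0 \<longrightarrow> x = (\<lambda>_. 1, \<lambda>_. 1))"
      by (intro exI[of _ "(\<lambda>_. 1, \<lambda>_. 1)"]) (simp add: ok_def)
  next
    fix z and k :: nat
    assume "(ok (fst z) \<and> ok (snd z)) \<and> (k = 0 \<longrightarrow> z = (\<lambda>_. 1, \<lambda>_. 1))"
    then have z: "ok (fst z)" "ok (snd z)" by auto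
    obtain q q' :: "'e \<Rightarrow> real" and C where q: "q \<in> borel_measurable N" "q' \<in> borel_measurable N"
      "\<And>s. 0 \<le> q s" "\<And>s. q s \<le> fst z s" "\<And>s. 0 \<le> q' s" "\<And>s. q' s \<le> snd z s"
      and match: "\<And>B. B \<in> sets N \<Longrightarrow> (\<integral>s. (fst z s - q s) * indicator B (\<tau> k s) \<partial>P) = (\<integral>s. (snd z s - q' s) * indicator B (\<tau> k s) \<partial>Q)"
      and C: "C \<in> sets N"
      "(\<integral>s. q s \<partial>P) = (\<integral>s. fst z s * indicator C (\<tau> k s) \<partial>P) - (\<integral>s. snd z s * indicator C (\<tau> k s) \<partial>Q)"
      "(\<integral>s. q' s \<partial>Q) = (\<integral>s. snd z s * indicator (space N - C) (\<tau> k s) \<partial>Q) - (\<integral>s. fst z s * indicator (space N - C) (\<tau> k s) \<partial>P)"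
      by (rule thinning_step[OF P Q \<tau>[of k], of "fst z" "snd z"];
        (rule that; assumption)?) (use z in \<open>auto simp: ok_def\<close>)
    have "ok q" "ok q'"
      using q z by (auto simp: ok_def intro: order_trans[OF q(4)] order_trans[OF q(6)])
    moreover have "rel k z (q, q')"
      unfolding rel_def fst_conv snd_conv
      by (intro conjI allI ballI q(4,6) match)
        (assumption, rule bexI[of _ C], rule C(2), rule C(1), rule bexI[of _ "space N - C"], rule C(3),
          simp add: C(1) sets.compl_sets)
    ultimately show "\<exists>y. ((ok (fst y) \<and> ok (snd y)) \<and> (Suc k = 0 \<longrightarrow> y = (\<lambda>_. 1, \<lambda>_. 1))) \<and> rel k z y"
      by (intro exI[of _ "(q, q')"]) auto
  qed
  then obtain z where z: "\<And>k. ok (fst (z k))" "\<And>k. ok (snd (z k))" "z 0 = (\<lambda>_. 1, \<lambda>_. 1)"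
    and rel: "\<And>k. rel k (z k) (z (Suc k))" by auto
  define r r' where "r k = fst (z k)" and "r' k = snd (z k)" for k
  have r: "r k \<in> borel_measurable N" "0 \<le> r k s" "r k s \<le> 1" and r': "r' k \<in> borel_measurable N" "0 \<le> r' k s" "r' k s \<le> 1" for k s
    using z(1,2)[of k] by (auto simp: ok_def r_def r'_def)
  have r0: "r 0 s = 1" "r' 0 s = 1" for s using z(3) by (simp_all add: r_def r'_def)
  have dec: "r (Suc k) s \<le> r k s" "r' (Suc k) s \<le> r' k s" for k s
    using rel[of k] by (auto simp: rel_def r_def r'_def)
  have match: "(\<integral>s. (r k s - r (Suc k) s) * indicator B (\<tau> k s) \<partial>P) = (\<integral>s. (r' k s - r' (Suc k) s) * indicator B (\<tau> k s) \<partial>Q)"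
    if "B \<in> sets N" for k B
    using rel[of k] that by (auto simp: rel_def r_def r'_def)
  have [measurable]: "r k \<in> borel_measurable N" "r' k \<in> borel_measurable N" "\<tau> k \<in> measurable N N" for k
    using r r' \<tau> by auto
  have intP: "integrable P u" if "u \<in> borel_measurable N" "\<And>s. \<bar>u s\<bar> \<le> 1" for u :: "'e \<Rightarrow> real"
    using that by (intro P.integrable_const_bound[where B = 1]) (auto cong: measurable_cong_sets)
  have intQ: "integrable Q u" if "u \<in> borel_measurable N" "\<And>s. \<bar>u s\<bar> \<le> 1" for u :: "'e \<Rightarrow> real"
    using that by (intro Q.integrable_const_bound[where B = 1]) (auto cong: measurable_cong_sets)
  have ir: "integrable P (\<lambda>s. r i s * indicator B (\<tau> j s))" "integrable Q (\<lambda>s. r' i s * indicator B (\<tau> j s))"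
    if [measurable]: "B \<in> sets N" for i j B
    using r r' by (auto intro!: intP intQ simp: indicator_def)
  \<comment> \<open>What has been removed so far does not change the difference of the laws of later \<open>\<tau> j\<close>.\<close>
  have balance: "(\<integral>s. r n s * indicator B (\<tau> j s) \<partial>P) - (\<integral>s. r' n s * indicator B (\<tau> j s) \<partial>Q)
      = (\<integral>s. indicator B (\<tau> j s) \<partial>P) - (\<integral>s. indicator B (\<tau> j s) \<partial>Q)"
    if B: "B \<in> sets N" and "n \<le> j" for n j B
    using \<open>n \<le> j\<close>
  proof (induction n)
    case 0
    then show ?case by (simp add: r0)
  next
    case (Suc n)
    obtain \<sigma> where \<sigma>: "\<sigma> \<in> measurable N N" "\<And>s. s \<in> space N \<Longrightarrow> \<tau> j s = \<sigma> (\<tau> n s)"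
      using factor[of n j] Suc.prems by auto
    define B' where "B' = \<sigma> -` B \<inter> space N"
    have B': "B' \<in> sets N" unfolding B'_def using \<sigma>(1) B by (rule measurable_sets)
    have ind: "indicator B' (\<tau> n s) = (indicator B (\<tau> j s) :: real)" if "s \<in> space N" for s
      using \<sigma>(2)[OF that] measurable_space[OF \<tau>[of n] that] by (simp add: B'_def indicator_def)
    have "(\<integral>s. (r n s - r (Suc n) s) * indicator B (\<tau> j s) \<partial>P) = (\<integral>s. (r n s - r (Suc n) s) * indicator B' (\<tau> n s) \<partial>P)"
      by (intro Bochner_Integration.integral_cong) (simp_all add: ind spc)
    also have "\<dots> = (\<integral>s. (r' n s - r' (Suc n) s) * indicator B' (\<tau> n s) \<partial>Q)"
      by (rule match[OF B'])
    also have "\<dots> = (\<integral>s. (r' n s - r' (Suc n) s) * indicator B (\<tau> j s) \<partial>Q)"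
      by (intro Bochner_Integration.integral_cong) (simp_all add: ind spc)
    finally have "(\<integral>s. r n s * indicator B (\<tau> j s) \<partial>P) - (\<integral>s. r (Suc n) s * indicator B (\<tau> j s) \<partial>P)
      = (\<integral>s. r' n s * indicator B (\<tau> j s) \<partial>Q) - (\<integral>s. r' (Suc n) s * indicator B (\<tau> j s) \<partial>Q)"
      by (simp add: left_diff_distrib ir[OF B])
    then show ?case using Suc by simp
  qed
  have small: "(\<integral>s. r (Suc k) s \<partial>P) \<le> e k" "(\<integral>s. r' (Suc k) s \<partial>Q) \<le> e k" for k
  proof -
    obtain C where "C \<in> sets N" "(\<integral>s. r (Suc k) s \<partial>P) = (\<integral>s. r k s * indicator C (\<tau> k s) \<partial>P) - (\<integral>s. r' k s * indicator C (\<tau> k s) \<partial>Q)"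
      using rel[of k] by (auto simp: rel_def r_def r'_def)
    then show "(\<integral>s. r (Suc k) s \<partial>P) \<le> e k"
      using balance[of C k k] merge[of C k] by simp
    obtain D where "D \<in> sets N" "(\<integral>s. r' (Suc k) s \<partial>Q) = (\<integral>s. r' k s * indicator D (\<tau> k s) \<partial>Q) - (\<integral>s. r k s * indicator D (\<tau> k s) \<partial>P)"
      using rel[of k] by (auto simp: rel_def r_def r'_def)
    then show "(\<integral>s. r' (Suc k) s \<partial>Q) \<le> e k"
      using balance[of D k k] merge[of D k] by simp
  qed
  \<comment> \<open>Decreasing weights whose integrals tend to zero tend to zero almost everywhere.\<close>
  have vanish: "AE s in R. (\<lambda>k. u k s) \<longlonglongrightarrow> 0"
    if R: "prob_space R" "sets R = sets N" and u: "\<And>k. u k \<in> borel_measurable N" "\<And>k s. 0 \<le> u k s" "\<And>k s. u k s \<le> 1"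
      "\<And>k s. u (Suc k) s \<le> u k s" and small: "\<And>k. (\<integral>s. u (Suc k) s \<partial>R) \<le> e k"
    for R and u :: "nat \<Rightarrow> 'e \<Rightarrow> real"
  proof -
    interpret R: prob_space R by fact
    note [measurable_cong] = R(2) and [measurable] = u(1)
    define l where "l s = (INF k. u k s)" for s
    have bdd: "bdd_below (range (\<lambda>k. u k s))" for s using u(2) by (intro bdd_belowI[of _ 0]) auto
    have lim: "(\<lambda>k. u k s) \<longlonglongrightarrow> l s" for s
      unfolding l_def by (rule LIMSEQ_decseq_INF[OF bdd]) (simp add: decseq_Suc_iff u(4))
    have [measurable]: "l \<in> borel_measurable N"
      by (rule borel_measurable_LIMSEQ_real[of N u]) (use lim in auto)
    have l: "0 \<le> l s" "l s \<le> u k s" for s k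
      unfolding l_def using u(2) by (auto intro!: cINF_greatest cINF_lower bdd)
    have intl: "integrable R l" "integrable R (u k)" for k
      using l u by (auto intro!: R.integrable_const_bound[where B = 1] simp: order_trans[OF l(2) u(3)])
    have "(\<integral>s. l s \<partial>R) \<le> e k" for k
      by (rule order_trans[OF integral_mono small[of k]]) (use intl l in auto)
    then have "(\<integral>s. l s \<partial>R) \<le> 0" by (intro LIMSEQ_le_const[OF e]) auto
    moreover have "0 \<le> (\<integral>s. l s \<partial>R)" using l by (intro integral_nonneg_AE) auto
    ultimately have "(\<integral>s. l s \<partial>R) = 0" by simp
    then have "AE s in R. l s = 0"
      using integral_nonneg_eq_0_iff_AE[OF intl(1)] l by auto
    then show ?thesis
    proof eventually_elim
      case (elim s)
      then show ?case using lim[of s] by simp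
    qed
  qed
  define w w' where "w k s = r k s - r (Suc k) s" and "w' k s = r' k s - r' (Suc k) s" for k s
  have tele: "(\<lambda>k. u k - u (Suc k)) sums (1::real)" if "u 0 = 1" "u \<longlonglongrightarrow> 0" for u
    using telescope_sums'[OF that(2)] that(1) by simp
  show ?thesis
  proof (rule that[of w w'])
    show "w k \<in> borel_measurable N" "w' k \<in> borel_measurable N" for k unfolding w_def w'_def by measurable
    show "0 \<le> w k s" "0 \<le> w' k s" for k s using dec by (auto simp: w_def w'_def)
    show "AE s in P. (\<lambda>k. w k s) sums 1"
      using vanish[OF P r dec(1) small(1)] unfolding w_def by eventually_elim (rule tele, simp_all add: r0)
    show "AE s in Q. (\<lambda>k. w' k s) sums 1"
      using vanish[OF Q r' dec(2) small(2)] unfolding w'_def by eventually_elim (rule tele, simp_all add: r0)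
    fix k B assume B [measurable]: "B \<in> sets N"
    have wb: "\<bar>w k s * indicator B (\<tau> k s)\<bar> \<le> 1" "\<bar>w' k s * indicator B (\<tau> k s)\<bar> \<le> 1"
       "0 \<le> w k s * indicator B (\<tau> k s)" "0 \<le> w' k s * indicator B (\<tau> k s)" for s
      using r(2,3)[of k s] r(2,3)[of "Suc k" s] r'(2,3)[of k s] r'(2,3)[of "Suc k" s] dec[of k s]
      by (auto simp: w_def w'_def indicator_def)
    have [measurable]: "w k \<in> borel_measurable N" "w' k \<in> borel_measurable N" unfolding w_def w'_def by measurable
    have "(\<integral>\<^sup>+s. ennreal (w k s) * indicator B (\<tau> k s) \<partial>P) = (\<integral>\<^sup>+s. ennreal (w k s * indicator B (\<tau> k s)) \<partial>P)"
      by (intro nn_integral_cong) (simp add: indicator_def)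
    also have "\<dots> = ennreal (\<integral>s. w k s * indicator B (\<tau> k s) \<partial>P)"
      using wb by (intro nn_integral_eq_integral intP) auto
    also have "(\<integral>s. w k s * indicator B (\<tau> k s) \<partial>P) = (\<integral>s. w' k s * indicator B (\<tau> k s) \<partial>Q)"
      using match[OF B, of k] by (simp add: w_def w'_def)
    also have "ennreal \<dots> = (\<integral>\<^sup>+s. ennreal (w' k s * indicator B (\<tau> k s)) \<partial>Q)"
      using wb by (intro nn_integral_eq_integral[symmetric] intQ) auto
    also have "\<dots> = (\<integral>\<^sup>+s. ennreal (w' k s) * indicator B (\<tau> k s) \<partial>Q)"
      by (intro nn_integral_cong) (simp add: indicator_def)
    finally show "(\<integral>\<^sup>+s. ennreal (w k s) * indicator B (\<tau> k s) \<partial>P) = (\<integral>\<^sup>+s. ennreal (w' k s) * indicator B (\<tau> k s) \<partial>Q)" .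
  qed
qed


text \<open>
  Two pairs whose labels have the same law can be defined on one space with one label: draw the
  label, then compute both second components from it with independent uniform variables.
\<close>

lemma coupling_over_common_label:
  fixes g g' :: "'x \<Rightarrow> 'a::polish_space" and Y :: "'y measure"
  assumes P: "prob_space P" "f \<in> measurable P Y" "g \<in> borel_measurable P"
    and Q: "prob_space Q" "f' \<in> measurable Q Y" "g' \<in> borel_measurable Q"
    and label: "distr P Y f = distr Q Y f'"
  obtains M :: "('y \<times> real \<times> real) measure" and L G G' where
    "prob_space M" "L \<in> measurable M Y" "G \<in> borel_measurable M" "G' \<in> borel_measurable M"
    "distr M (Y \<Otimes>\<^sub>M borel) (\<lambda>\<omega>. (L \<omega>, G \<omega>)) = distr P (Y \<Otimes>\<^sub>M borel) (\<lambda>\<omega>. (f \<omega>, g \<omega>))"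
    "distr M (Y \<Otimes>\<^sub>M borel) (\<lambda>\<omega>. (L \<omega>, G' \<omega>)) = distr Q (Y \<Otimes>\<^sub>M borel) (\<lambda>\<omega>. (f' \<omega>, g' \<omega>))"
proof -
  define \<nu> where "\<nu> = distr P Y f"
  have \<nu>': "\<nu> = distr Q Y f'" unfolding \<nu>_def by (rule label)
  interpret \<nu>: prob_space \<nu> unfolding \<nu>_def by (rule prob_space.prob_space_distr[OF P(1,2)])
  interpret U: prob_space unif by (rule prob_space_unif)
  interpret UU: pair_prob_space unif unif ..
  have sets_\<nu> [measurable_cong]: "sets \<nu> = sets Y" by (simp add: \<nu>_def)
  obtain h where h [measurable]: "h \<in> borel_measurable (Y \<Otimes>\<^sub>M borel)"
    and heq: "distr (\<nu> \<Otimes>\<^sub>M unif) (Y \<Otimes>\<^sub>M borel) (\<lambda>(y, u). (y, h (y, u)))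
      = distr P (Y \<Otimes>\<^sub>M borel) (\<lambda>\<omega>. (f \<omega>, g \<omega>))"
    unfolding \<nu>_def by (rule noise_outsourcing[OF P])
  obtain h' where h' [measurable]: "h' \<in> borel_measurable (Y \<Otimes>\<^sub>M borel)"
    and heq': "distr (\<nu> \<Otimes>\<^sub>M unif) (Y \<Otimes>\<^sub>M borel) (\<lambda>(y, u). (y, h' (y, u)))
      = distr Q (Y \<Otimes>\<^sub>M borel) (\<lambda>\<omega>. (f' \<omega>, g' \<omega>))"
    unfolding \<nu>' by (rule noise_outsourcing[OF Q])
  define M where "M = \<nu> \<Otimes>\<^sub>M (unif \<Otimes>\<^sub>M unif)"
  interpret M: pair_prob_space \<nu> "unif \<Otimes>\<^sub>M unif" ..
  define p p' where "p = (\<lambda>(y :: 'y, u :: real \<times> real). (y, fst u))"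
    and "p' = (\<lambda>(y :: 'y, u :: real \<times> real). (y, snd u))"
  have pm: "p \<in> measurable M (\<nu> \<Otimes>\<^sub>M unif)" "p' \<in> measurable M (\<nu> \<Otimes>\<^sub>M unif)"
    unfolding p_def p'_def M_def by measurable
  have Ufst: "distr (unif \<Otimes>\<^sub>M unif) unif fst = unif" by (rule U.distr_pair_fst)
  have Usnd: "distr (unif \<Otimes>\<^sub>M unif) unif snd = unif"
  proof -
    have "distr (unif \<Otimes>\<^sub>M unif) unif snd
        = distr (distr (unif \<Otimes>\<^sub>M unif) (unif \<Otimes>\<^sub>M unif) (\<lambda>(x, y). (y, x))) unif snd"
      by (subst UU.distr_pair_swap) simp
    also have "\<dots> = distr (unif \<Otimes>\<^sub>M unif) unif fst"
      by (subst distr_distr) (auto simp: comp_def split_beta')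
    finally show ?thesis using Ufst by simp
  qed
  have dp: "distr M (\<nu> \<Otimes>\<^sub>M unif) p = \<nu> \<Otimes>\<^sub>M unif" "distr M (\<nu> \<Otimes>\<^sub>M unif) p' = \<nu> \<Otimes>\<^sub>M unif"
    using pair_measure_distr[of "\<lambda>x. x" \<nu> \<nu> fst "unif \<Otimes>\<^sub>M unif" unif]
      pair_measure_distr[of "\<lambda>x. x" \<nu> \<nu> snd "unif \<Otimes>\<^sub>M unif" unif]
    unfolding Ufst Usnd M_def p_def p'_def by (simp_all add: distr_id U.sigma_finite_measure_axioms)
  have c: "sets (\<nu> \<Otimes>\<^sub>M unif) = sets (Y \<Otimes>\<^sub>M borel)"
    by (intro sets_pair_measure_cong sets_\<nu> sets_unif)
  have joint: "k \<circ> r \<in> borel_measurable M"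
      "distr M (Y \<Otimes>\<^sub>M borel) (\<lambda>\<omega>. (fst \<omega>, (k \<circ> r) \<omega>)) = distr (\<nu> \<Otimes>\<^sub>M unif) (Y \<Otimes>\<^sub>M borel) (\<lambda>(y, u). (y, k (y, u)))"
    if k: "k \<in> borel_measurable (Y \<Otimes>\<^sub>M borel)" and r: "r \<in> measurable M (\<nu> \<Otimes>\<^sub>M unif)"
      "distr M (\<nu> \<Otimes>\<^sub>M unif) r = \<nu> \<Otimes>\<^sub>M unif" "\<And>\<omega>. fst (r \<omega>) = fst \<omega>"
    for k :: "'y \<times> real \<Rightarrow> 'a" and r
  proof -
    have k\<nu>: "k \<in> borel_measurable (\<nu> \<Otimes>\<^sub>M unif)"
      using k unfolding measurable_cong_sets[OF c refl] .
    then show "k \<circ> r \<in> borel_measurable M" by (rule measurable_comp[OF r(1)])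
    have m: "(\<lambda>(y, u). (y, k (y, u))) \<in> measurable (\<nu> \<Otimes>\<^sub>M unif) (Y \<Otimes>\<^sub>M borel)"
      unfolding split_beta' using k\<nu> measurable_cong_sets[OF refl sets_\<nu>] by (intro measurable_Pair) auto
    have "distr (\<nu> \<Otimes>\<^sub>M unif) (Y \<Otimes>\<^sub>M borel) (\<lambda>(y, u). (y, k (y, u)))
        = distr (distr M (\<nu> \<Otimes>\<^sub>M unif) r) (Y \<Otimes>\<^sub>M borel) (\<lambda>(y, u). (y, k (y, u)))"
      unfolding r(2) ..
    also have "\<dots> = distr M (Y \<Otimes>\<^sub>M borel) (\<lambda>\<omega>. (fst \<omega>, (k \<circ> r) \<omega>))"
      by (subst distr_distr[OF m r(1)]) (simp add: comp_def split_beta' r(3))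
    finally show "distr M (Y \<Otimes>\<^sub>M borel) (\<lambda>\<omega>. (fst \<omega>, (k \<circ> r) \<omega>))
        = distr (\<nu> \<Otimes>\<^sub>M unif) (Y \<Otimes>\<^sub>M borel) (\<lambda>(y, u). (y, k (y, u)))" ..
  qed
  show ?thesis
  proof (rule that[of M fst "h \<circ> p" "h' \<circ> p'"])
    show "prob_space M" unfolding M_def by unfold_locales
    show "fst \<in> measurable M Y"
      using measurable_cong_sets[OF refl sets_\<nu>] unfolding M_def by auto
    note j = joint[OF h pm(1) dp(1)] joint[OF h' pm(2) dp(2)]
    show "h \<circ> p \<in> borel_measurable M" "h' \<circ> p' \<in> borel_measurable M"
      by (rule j, simp add: p_def split_beta') (rule j, simp add: p'_def split_beta')
    show "distr M (Y \<Otimes>\<^sub>M borel) (\<lambda>\<omega>. (fst \<omega>, (h \<circ> p) \<omega>)) = distr P (Y \<Otimes>\<^sub>M borel) (\<lambda>\<omega>. (f \<omega>, g \<omega>))"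
      unfolding heq[symmetric] by (rule j) (simp add: p_def split_beta')
    show "distr M (Y \<Otimes>\<^sub>M borel) (\<lambda>\<omega>. (fst \<omega>, (h' \<circ> p') \<omega>)) = distr Q (Y \<Otimes>\<^sub>M borel) (\<lambda>\<omega>. (f' \<omega>, g' \<omega>))"
      unfolding heq'[symmetric] by (rule j) (simp add: p'_def split_beta')
  qed
qed

text \<open>
  The law of a path with law \<open>R\<close> together with a time that is \<open>k\<close> with probability \<open>u k s\<close>, given the
  path \<open>s\<close>.
\<close>

definition weighted_times :: "'e measure \<Rightarrow> (nat \<Rightarrow> 'e \<Rightarrow> real) \<Rightarrow> ('e \<times> nat) measure" where
  "weighted_times R u = density (R \<Otimes>\<^sub>M count_space UNIV) (\<lambda>z. ennreal (u (snd z) (fst z)))"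

lemma sets_weighted_times:
  "sets R = sets N \<Longrightarrow> sets (weighted_times R u) = sets (N \<Otimes>\<^sub>M count_space UNIV)"
  unfolding weighted_times_def sets_density by (rule sets_pair_measure_cong[OF _ refl])

lemma emeasure_weighted_times:
  assumes R: "sets R = sets N" and u: "\<And>k. u k \<in> borel_measurable N"
    and X: "X \<in> sets (N \<Otimes>\<^sub>M count_space UNIV)"
  shows "emeasure (weighted_times R u) X = (\<Sum>k. \<integral>\<^sup>+s. ennreal (u k s) * indicator X (s, k) \<partial>R)"
proof -
  let ?C = "count_space (UNIV :: nat set)"
  interpret C: sigma_finite_measure ?C by (rule sigma_finite_measure_count_space)
  have c: "sets (R \<Otimes>\<^sub>M ?C) = sets (N \<Otimes>\<^sub>M ?C)" using R by (intro sets_pair_measure_cong) auto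
  have "(\<lambda>z. ennreal (u (snd z) (fst z))) \<in> borel_measurable (N \<Otimes>\<^sub>M ?C)"
    by (rule measurable_compose[OF _ measurable_ennreal],
        rule measurable_compose_countable[where f = "\<lambda>k z. u k (fst z)" and g = snd])
      (rule measurable_compose[OF measurable_fst u], rule measurable_snd)
  then have [measurable]: "(\<lambda>z. ennreal (u (snd z) (fst z))) \<in> borel_measurable (R \<Otimes>\<^sub>M ?C)"
    unfolding measurable_cong_sets[OF c refl] .
  have [measurable]: "X \<in> sets (R \<Otimes>\<^sub>M ?C)" using X c by simp
  have [measurable]: "(\<lambda>s. ennreal (u k s) * indicator X (s, k)) \<in> borel_measurable R" for k
  proof -
    have "(\<lambda>s. ennreal (u (snd (s, k)) (fst (s, k))) * indicator X (s, k)) \<in> borel_measurable R"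
      by measurable
    then show ?thesis by simp
  qed
  have "emeasure (weighted_times R u) X
      = (\<integral>\<^sup>+z. ennreal (u (snd z) (fst z)) * indicator X z \<partial>(R \<Otimes>\<^sub>M ?C))"
    unfolding weighted_times_def by (rule emeasure_density) measurable
  also have "\<dots> = (\<integral>\<^sup>+s. \<integral>\<^sup>+k. ennreal (u k s) * indicator X (s, k) \<partial>?C \<partial>R)"
    by (subst C.nn_integral_fst[symmetric]) auto
  also have "\<dots> = (\<integral>\<^sup>+s. (\<Sum>k. ennreal (u k s) * indicator X (s, k)) \<partial>R)"
    by (simp add: nn_integral_count_space_nat)
  also have "\<dots> = (\<Sum>k. \<integral>\<^sup>+s. ennreal (u k s) * indicator X (s, k) \<partial>R)"
    by (rule nn_integral_suminf) measurable
  finally show ?thesis .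
qed

lemma distr_weighted_times_fst:
  assumes R: "sets R = sets N" and u: "\<And>k. u k \<in> borel_measurable N" "\<And>k s. 0 \<le> u k s"
    and us: "AE s in R. (\<lambda>k. u k s) sums 1"
  shows "distr (weighted_times R u) N fst = R"
proof (rule measure_eqI)
  fix B assume "B \<in> sets (distr (weighted_times R u) N fst)"
  then have B: "B \<in> sets N" by simp
  have sp: "space (weighted_times R u) = space N \<times> UNIV"
    using sets_eq_imp_space_eq[OF sets_weighted_times[OF R]] by (simp add: space_pair_measure)
  have BU: "B \<times> UNIV \<in> sets (N \<Otimes>\<^sub>M count_space UNIV)" using B by auto
  have "emeasure (distr (weighted_times R u) N fst) B
      = emeasure (weighted_times R u) (fst -` B \<inter> space (weighted_times R u))"
    using B sets_weighted_times[OF R, of u] by (intro emeasure_distr) (auto cong: measurable_cong_sets)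
  also have "fst -` B \<inter> space (weighted_times R u) = B \<times> UNIV"
    using sets.sets_into_space[OF B] by (auto simp: sp)
  also have "emeasure (weighted_times R u) (B \<times> UNIV) = (\<Sum>k. \<integral>\<^sup>+s. ennreal (u k s) * indicator B s \<partial>R)"
    unfolding emeasure_weighted_times[OF R u(1) BU] by (simp add: indicator_def)
  also have "\<dots> = (\<integral>\<^sup>+s. (\<Sum>k. ennreal (u k s) * indicator B s) \<partial>R)"
    using u(1) B R by (intro nn_integral_suminf[symmetric]) (auto cong: measurable_cong_sets)
  also have "\<dots> = (\<integral>\<^sup>+s. indicator B s \<partial>R)"
  proof (rule nn_integral_cong_AE, use us in eventually_elim)
    fix s assume s: "(\<lambda>k. u k s) sums 1"
    have "(\<Sum>k. ennreal (u k s) * indicator B s) = (\<Sum>k. ennreal (u k s)) * indicator B s"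
      by simp
    also have "(\<Sum>k. ennreal (u k s)) = ennreal (\<Sum>k. u k s)"
      by (rule suminf_ennreal2[OF u(2) sums_summable[OF s]])
    also have "(\<Sum>k. u k s) = 1" using sums_unique[OF s] by (rule sym)
    finally show "(\<Sum>k. ennreal (u k s) * indicator B s) = indicator B s" by simp
  qed
  also have "\<dots> = emeasure R B" using B R by simp
  finally show "emeasure (distr (weighted_times R u) N fst) B = emeasure R B" .
qed (use R in simp)

lemma prob_space_weighted_times:
  assumes "prob_space R" and R: "sets R = sets N" and u: "\<And>k. u k \<in> borel_measurable N" "\<And>k s. 0 \<le> u k s"
    and us: "AE s in R. (\<lambda>k. u k s) sums 1"
  shows "prob_space (weighted_times R u)"
proof -
  have m: "fst \<in> measurable (weighted_times R u) N"
    using sets_weighted_times[OF R, of u] by (auto cong: measurable_cong_sets)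
  have "emeasure (weighted_times R u) (space (weighted_times R u))
      = emeasure (distr (weighted_times R u) N fst) (space N)"
    using measurable_space[OF m] by (subst emeasure_distr[OF m]) (auto intro!: arg_cong[where f = "emeasure _"])
  then show ?thesis
    unfolding distr_weighted_times_fst[OF R u us] using prob_space.emeasure_space_1[OF assms(1)] sets_eq_imp_space_eq[OF R]
    by (intro prob_spaceI) simp
qed

text \<open>
  Label a path by the time at which it is to be coupled and by its continuation from that time on.
  By the choice of the weights the label has the same law on both sides, and two paths with the
  same label agree from the coupling time on.
\<close>

lemma coupling_of_merging_laws:
  fixes P Q :: "(nat \<Rightarrow> 'a::polish_space) measure" and e :: "nat \<Rightarrow> real"
  defines "E \<equiv> \<Pi>\<^sub>M i\<in>(UNIV::nat set). (borel :: 'a measure)"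
  assumes P: "prob_space P" "sets P = sets E" and Q: "prob_space Q" "sets Q = sets E"
    and merge: "\<And>k B. B \<in> sets E \<Longrightarrow>
      \<bar>(\<integral>s. indicator B (\<lambda>n. s (n + k)) \<partial>P) - (\<integral>s. indicator B (\<lambda>n. s (n + k)) \<partial>Q)\<bar> \<le> e k"
    and e: "e \<longlonglongrightarrow> 0"
  obtains M :: "((nat \<times> (nat \<Rightarrow> 'a)) \<times> real \<times> real) measure" and S S' T where
    "prob_space M" "S \<in> measurable M E" "S' \<in> measurable M E" "distr M E S = P" "distr M E S' = Q"
    "T \<in> measurable M (count_space UNIV)"
    "\<And>\<omega> n. T \<omega> \<le> enat n \<Longrightarrow> S \<omega> n = S' \<omega> n" "AE \<omega> in M. T \<omega> < \<infinity>"
proof -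
  define \<tau> where "\<tau> k s = (\<lambda>n. s (n + k))" for k and s :: "nat \<Rightarrow> 'a"
  have \<tau>: "\<tau> k \<in> measurable E E" for k
    unfolding \<tau>_def E_def by (rule measurable_PiM_single') (auto simp: space_PiM)
  have factor: "\<exists>\<sigma>\<in>measurable E E. \<forall>s\<in>space E. \<tau> j s = \<sigma> (\<tau> k s)" if "k \<le> j" for j k
  proof (rule bexI[OF _ \<tau>[of "j - k"]])
    show "\<forall>s\<in>space E. \<tau> j s = \<tau> (j - k) (\<tau> k s)"
      using that by (simp add: \<tau>_def add.assoc)
  qed
  obtain w w' :: "nat \<Rightarrow> (nat \<Rightarrow> 'a) \<Rightarrow> real" where
    wm: "\<And>k. w k \<in> borel_measurable E" "\<And>k. w' k \<in> borel_measurable E"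
    and w0: "\<And>k s. 0 \<le> w k s" "\<And>k s. 0 \<le> w' k s"
    and ws: "AE s in P. (\<lambda>k. w k s) sums 1" "AE s in Q. (\<lambda>k. w' k s) sums 1"
    and match: "\<And>k B. B \<in> sets E \<Longrightarrow> (\<integral>\<^sup>+s. ennreal (w k s) * indicator B (\<tau> k s) \<partial>P)
      = (\<integral>\<^sup>+s. ennreal (w' k s) * indicator B (\<tau> k s) \<partial>Q)"
    by (rule matching_weights[OF P Q \<tau> factor _ e]; (rule that; assumption)?)
      (use merge in \<open>auto simp: \<tau>_def\<close>)
  let ?C = "count_space (UNIV :: nat set)"
  let ?Y = "?C \<Otimes>\<^sub>M E"
  have borelE: "sets (borel :: (nat \<Rightarrow> 'a) measure) = sets E"
    unfolding E_def by (rule sets_PiM_equal_borel[symmetric])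
  have mE: "h \<in> borel_measurable A \<longleftrightarrow> h \<in> measurable A E" for h and A :: "'z measure"
    using measurable_cong_sets[OF refl borelE] by blast
  define lab where "lab z = (snd z, \<tau> (snd z) (fst z))" for z :: "(nat \<Rightarrow> 'a) \<times> nat"
  have lab: "lab \<in> measurable (E \<Otimes>\<^sub>M ?C) ?Y"
    unfolding lab_def
    by (rule measurable_Pair[OF measurable_snd],
        rule measurable_compose_countable[where f = "\<lambda>k z. \<tau> k (fst z)" and g = snd])
      (rule measurable_compose[OF measurable_fst \<tau>], rule measurable_snd)
  have labm: "lab \<in> measurable (weighted_times R u) ?Y" "fst \<in> borel_measurable (weighted_times R u)"
    if "sets R = sets E" for R u
    using lab mE unfolding measurable_cong_sets[OF sets_weighted_times[OF that] refl] by auto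
  have lab_law: "emeasure (distr (weighted_times R u) ?Y lab) B
      = (\<Sum>k. \<integral>\<^sup>+s. ennreal (u k s) * indicator (Pair k -` B) (\<tau> k s) \<partial>R)"
    if R: "sets R = sets E" and u: "\<And>k. u k \<in> borel_measurable E" and B: "B \<in> sets ?Y" for R u B
  proof -
    have B': "lab -` B \<inter> space (E \<Otimes>\<^sub>M ?C) \<in> sets (E \<Otimes>\<^sub>M ?C)" by (rule measurable_sets[OF lab B])
    have "emeasure (distr (weighted_times R u) ?Y lab) B = emeasure (weighted_times R u) (lab -` B \<inter> space (E \<Otimes>\<^sub>M ?C))"
      unfolding sets_eq_imp_space_eq[OF sets_weighted_times[OF R, of u], symmetric]
      by (rule emeasure_distr[OF labm(1)[OF R] B])
    also have "\<dots> = (\<Sum>k. \<integral>\<^sup>+s. ennreal (u k s) * indicator (Pair k -` B) (\<tau> k s) \<partial>R)"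
      unfolding emeasure_weighted_times[OF R u B']
      by (intro suminf_cong nn_integral_cong)
        (simp add: lab_def indicator_def space_pair_measure sets_eq_imp_space_eq[OF R])
    finally show ?thesis .
  qed
  have label: "distr (weighted_times P w) ?Y lab = distr (weighted_times Q w') ?Y lab"
    by (rule measure_eqI)
      (simp_all add: lab_law[OF P(2) wm(1)] lab_law[OF Q(2) wm(2)] match sets_Pair1)
  obtain M :: "((nat \<times> (nat \<Rightarrow> 'a)) \<times> real \<times> real) measure" and L S S' where
    M: "prob_space M" and L: "L \<in> measurable M ?Y"
    and S: "S \<in> borel_measurable M" "S' \<in> borel_measurable M"
    and law: "distr M (?Y \<Otimes>\<^sub>M borel) (\<lambda>\<omega>. (L \<omega>, S \<omega>)) = distr (weighted_times P w) (?Y \<Otimes>\<^sub>M borel) (\<lambda>z. (lab z, fst z))"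
      "distr M (?Y \<Otimes>\<^sub>M borel) (\<lambda>\<omega>. (L \<omega>, S' \<omega>)) = distr (weighted_times Q w') (?Y \<Otimes>\<^sub>M borel) (\<lambda>z. (lab z, fst z))"
    by (rule coupling_over_common_label[OF prob_space_weighted_times[OF P wm(1) w0(1) ws(1)] labm[OF P(2)]
      prob_space_weighted_times[OF Q wm(2) w0(2) ws(2)] labm[OF Q(2)] label])
  have m3: "snd \<in> measurable (?Y \<Otimes>\<^sub>M (borel :: (nat \<Rightarrow> 'a) measure)) E"
    using mE by (metis measurable_snd)
  have side: "distr M E Z = R" "AE \<omega> in M. \<tau> (fst (L \<omega>)) (Z \<omega>) = snd (L \<omega>)"
    if Z: "Z \<in> borel_measurable M"
      and geq: "distr M (?Y \<Otimes>\<^sub>M borel) (\<lambda>\<omega>. (L \<omega>, Z \<omega>)) = distr (weighted_times R v) (?Y \<Otimes>\<^sub>M borel) (\<lambda>z. (lab z, fst z))"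
      and R: "sets R = sets E" "distr (weighted_times R v) E fst = R"
    for Z R v
  proof -
    let ?YB = "?Y \<Otimes>\<^sub>M (borel :: (nat \<Rightarrow> 'a) measure)"
    have m1: "(\<lambda>\<omega>. (L \<omega>, Z \<omega>)) \<in> measurable M ?YB" by (rule measurable_Pair[OF L Z])
    have m2: "(\<lambda>z. (lab z, fst z)) \<in> measurable (weighted_times R v) ?YB"
      by (rule measurable_Pair[OF labm[OF R(1)]])
    have "distr M E Z = distr (distr M ?YB (\<lambda>\<omega>. (L \<omega>, Z \<omega>))) E snd"
      by (subst distr_distr[OF m3 m1]) (simp add: comp_def)
    also have "\<dots> = distr (weighted_times R v) E fst"
      unfolding geq by (subst distr_distr[OF m3 m2]) (simp add: comp_def)
    finally show "distr M E Z = R" using R(2) by simp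
    have "(\<lambda>p. \<tau> (fst (fst p)) (snd p)) \<in> borel_measurable ?YB"
      unfolding mE
      by (rule measurable_compose_countable[where f = "\<lambda>k p. \<tau> k (snd p)" and g = "\<lambda>p. fst (fst p)"])
        (rule measurable_compose[OF m3 \<tau>], rule measurable_compose[OF measurable_fst measurable_fst])
    moreover have "(\<lambda>p. snd (fst p)) \<in> borel_measurable ?YB"
      unfolding mE by (rule measurable_compose[OF measurable_fst measurable_snd])
    ultimately have G: "{p\<in>space ?YB. \<tau> (fst (fst p)) (snd p) = snd (fst p)} \<in> sets ?YB"
      by (rule measurable_equality_set)
    have "AE p in distr (weighted_times R v) ?YB (\<lambda>z. (lab z, fst z)). \<tau> (fst (fst p)) (snd p) = snd (fst p)"
      by (subst AE_distr_iff[OF m2 G]) (simp add: lab_def)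
    then show "AE \<omega> in M. \<tau> (fst (L \<omega>)) (Z \<omega>) = snd (L \<omega>)"
      unfolding geq[symmetric] by (subst (asm) AE_distr_iff[OF m1 G]) simp
  qed
  note sideP = side[OF S(1) law(1) P(2) distr_weighted_times_fst[OF P(2) wm(1) w0(1) ws(1)]]
  note sideQ = side[OF S(2) law(2) Q(2) distr_weighted_times_fst[OF Q(2) wm(2) w0(2) ws(2)]]
  \<comment> \<open>Agreement after \<open>T\<close> is required at every sample point, so \<open>T\<close> is infinite on the null event
    where the continuations differ.\<close>
  define T where "T \<omega> = (if \<tau> (fst (L \<omega>)) (S \<omega>) = \<tau> (fst (L \<omega>)) (S' \<omega>) then enat (fst (L \<omega>)) else \<infinity>)" for \<omega>
  have fm: "(\<lambda>\<omega>. fst (L \<omega>)) \<in> measurable M ?C"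
    by (rule measurable_compose[OF L measurable_fst])
  have tm: "(\<lambda>\<omega>. \<tau> (fst (L \<omega>)) (Z \<omega>)) \<in> borel_measurable M" if "Z \<in> borel_measurable M" for Z
    unfolding mE
    by (rule measurable_compose_countable[where f = "\<lambda>k \<omega>. \<tau> k (Z \<omega>)" and g = "\<lambda>\<omega>. fst (L \<omega>)"])
      (rule measurable_compose[OF that[unfolded mE] \<tau>], rule fm)
  show ?thesis
  proof (rule that[of M S S' T])
    show "prob_space M" by (rule M)
    show "S \<in> measurable M E" "S' \<in> measurable M E" using S unfolding mE by auto
    show "distr M E S = P" "distr M E S' = Q" by (rule sideP(1), rule sideQ(1))
    have "{\<omega>\<in>space M. \<tau> (fst (L \<omega>)) (S \<omega>) = \<tau> (fst (L \<omega>)) (S' \<omega>)} \<in> sets M"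
      by (intro measurable_equality_set tm S)
    moreover have "(\<lambda>\<omega>. enat (fst (L \<omega>))) \<in> measurable M (count_space UNIV)"
      by (rule measurable_compose[OF fm]) simp
    ultimately show "T \<in> measurable M (count_space UNIV)"
      unfolding T_def by (intro measurable_If) auto
    show "S \<omega> n = S' \<omega> n" if "T \<omega> \<le> enat n" for \<omega> n
    proof -
      have *: "\<tau> (fst (L \<omega>)) (S \<omega>) = \<tau> (fst (L \<omega>)) (S' \<omega>)" "fst (L \<omega>) \<le> n"
        using that unfolding T_def by (auto split: if_splits)
      show ?thesis
        using fun_cong[OF *(1), of "n - fst (L \<omega>)"] *(2) by (simp add: \<tau>_def)
    qed
    show "AE \<omega> in M. T \<omega> < \<infinity>"
      using sideP(2) sideQ(2) by eventually_elim (simp add: T_def)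
  qed
qed

section \<open>Convolution\<close>

lemma measurable_translate [measurable]:
  "(\<lambda>y. x + y) \<in> measurable borel (borel :: 'a::{polish_space,topological_ab_group_add} measure)"
  by (intro borel_measurable_continuous_onI continuous_intros)

lemma sets_conv [simp, measurable_cong]: "sets (conv \<nu>1 \<nu>2) = sets borel"
  by (simp add: conv_def)

lemma space_conv [simp]: "space (conv \<nu>1 \<nu>2) = UNIV"
  by (simp add: conv_def)

lemma measurable_add_pair:
  fixes \<nu>1 \<nu>2 :: "'a::{polish_space,topological_ab_group_add} measure"
  assumes "sets \<nu>1 = sets borel" "sets \<nu>2 = sets borel"
  shows "(\<lambda>(x, y). x + y) \<in> borel_measurable (\<nu>1 \<Otimes>\<^sub>M \<nu>2)"
proof -
  have "(\<lambda>(x, y). x + y) \<in> borel_measurable (borel \<Otimes>\<^sub>M (borel :: 'a measure))"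
    by (simp add: split_beta')
  then show ?thesis
    using measurable_cong_sets[OF sets_pair_measure_cong[OF assms] refl] by blast
qed

lemma nn_integral_conv:
  fixes \<nu>1 \<nu>2 :: "'a::{polish_space,topological_ab_group_add} measure"
  assumes \<nu>1: "sets \<nu>1 = sets borel" and \<nu>2: "sets \<nu>2 = sets borel" "finite_measure \<nu>2"
    and f: "f \<in> borel_measurable borel"
  shows "(\<integral>\<^sup>+z. f z \<partial>conv \<nu>1 \<nu>2) = (\<integral>\<^sup>+x. \<integral>\<^sup>+y. f (x + y) \<partial>\<nu>2 \<partial>\<nu>1)"
proof -
  interpret \<nu>2: finite_measure \<nu>2 by fact
  have m: "(\<lambda>(x, y). x + y) \<in> borel_measurable (\<nu>1 \<Otimes>\<^sub>M \<nu>2)" by (rule measurable_add_pair[OF \<nu>1 \<nu>2(1)])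
  have "(\<integral>\<^sup>+z. f z \<partial>conv \<nu>1 \<nu>2) = (\<integral>\<^sup>+p. f (case p of (x, y) \<Rightarrow> x + y) \<partial>(\<nu>1 \<Otimes>\<^sub>M \<nu>2))"
    unfolding conv_def by (rule nn_integral_distr[OF m]) (use f in simp)
  also have "\<dots> = (\<integral>\<^sup>+x. \<integral>\<^sup>+y. f (x + y) \<partial>\<nu>2 \<partial>\<nu>1)"
    by (subst \<nu>2.nn_integral_fst[symmetric]) (use measurable_compose[OF m f] in auto)
  finally show ?thesis .
qed

lemma emeasure_conv:
  fixes \<nu>1 \<nu>2 :: "'a::{polish_space,topological_ab_group_add} measure"
  assumes "sets \<nu>1 = sets borel" "sets \<nu>2 = sets borel" "finite_measure \<nu>2" "B \<in> sets borel"
  shows "emeasure (conv \<nu>1 \<nu>2) B = (\<integral>\<^sup>+x. \<integral>\<^sup>+y. indicator B (x + y) \<partial>\<nu>2 \<partial>\<nu>1)"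
  using nn_integral_conv[OF assms(1-3), of "indicator B"] assms(4) by simp

lemma prob_space_conv:
  assumes "prob_space \<nu>1" "sets \<nu>1 = sets borel" "prob_space \<nu>2" "sets \<nu>2 = sets borel"
  shows "prob_space (conv \<nu>1 \<nu>2)"
proof -
  interpret \<nu>1: prob_space \<nu>1 by fact
  interpret \<nu>2: prob_space \<nu>2 by fact
  interpret pair_prob_space \<nu>1 \<nu>2 ..
  show ?thesis unfolding conv_def by (rule prob_space_distr[OF measurable_add_pair[OF assms(2,4)]])
qed

lemma integral_conv:
  fixes \<nu>1 \<nu>2 :: "'a::{polish_space,topological_ab_group_add} measure" and f :: "'a \<Rightarrow> real"
  assumes \<nu>: "prob_space \<nu>1" "sets \<nu>1 = sets borel" "prob_space \<nu>2" "sets \<nu>2 = sets borel"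
    and f: "f \<in> borel_measurable borel" "\<And>z. \<bar>f z\<bar> \<le> B"
  shows "(\<integral>z. f z \<partial>conv \<nu>1 \<nu>2) = (\<integral>x. \<integral>y. f (x + y) \<partial>\<nu>2 \<partial>\<nu>1)"
    and "(\<integral>z. f z \<partial>conv \<nu>1 \<nu>2) = (\<integral>y. \<integral>x. f (x + y) \<partial>\<nu>1 \<partial>\<nu>2)"
    and "(\<lambda>y. \<integral>x. f (x + y) \<partial>\<nu>1) \<in> borel_measurable borel"
proof -
  interpret \<nu>1: prob_space \<nu>1 by fact
  interpret \<nu>2: prob_space \<nu>2 by fact
  interpret pair_prob_space \<nu>1 \<nu>2 ..
  have m: "(\<lambda>(x, y). x + y) \<in> borel_measurable (\<nu>1 \<Otimes>\<^sub>M \<nu>2)" by (rule measurable_add_pair[OF \<nu>(2,4)])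
  have fm: "(\<lambda>(x, y). f (x + y)) \<in> borel_measurable (\<nu>1 \<Otimes>\<^sub>M \<nu>2)"
    using measurable_compose[OF m f(1)] by (simp add: split_beta')
  have int: "integrable (\<nu>1 \<Otimes>\<^sub>M \<nu>2) (\<lambda>(x, y). f (x + y))"
    using fm f(2) by (intro integrable_const_bound[where B = B]) auto
  have 1: "(\<integral>z. f z \<partial>conv \<nu>1 \<nu>2) = (\<integral>(x, y). f (x + y) \<partial>(\<nu>1 \<Otimes>\<^sub>M \<nu>2))"
    unfolding conv_def by (subst integral_distr[OF m f(1)]) (simp add: split_beta')
  show "(\<integral>z. f z \<partial>conv \<nu>1 \<nu>2) = (\<integral>x. \<integral>y. f (x + y) \<partial>\<nu>2 \<partial>\<nu>1)"
    unfolding 1 using integral_fst'[OF int] by simp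
  show "(\<integral>z. f z \<partial>conv \<nu>1 \<nu>2) = (\<integral>y. \<integral>x. f (x + y) \<partial>\<nu>1 \<partial>\<nu>2)"
    unfolding 1 using integral_snd[OF int] by simp
  have "(\<lambda>y. \<integral>x. f (x + y) \<partial>\<nu>1) \<in> borel_measurable \<nu>2"
  proof (rule \<nu>1.borel_measurable_lebesgue_integral)
    have "(\<lambda>(y, x). y + x) \<in> borel_measurable (\<nu>2 \<Otimes>\<^sub>M \<nu>1)" by (rule measurable_add_pair[OF \<nu>(4,2)])
    from measurable_compose[OF this f(1)]
    show "(\<lambda>(y, x). f (x + y)) \<in> borel_measurable (\<nu>2 \<Otimes>\<^sub>M \<nu>1)"
      by (simp add: split_beta' add.commute)
  qed
  then show "(\<lambda>y. \<integral>x. f (x + y) \<partial>\<nu>1) \<in> borel_measurable borel"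
    using measurable_cong_sets[OF \<nu>(4) refl] by blast
qed

lemma conv_assoc:
  fixes \<nu>1 \<nu>2 \<nu>3 :: "'a::{polish_space,topological_ab_group_add} measure"
  assumes "sets \<nu>1 = sets borel" "prob_space \<nu>2" "sets \<nu>2 = sets borel" "prob_space \<nu>3" "sets \<nu>3 = sets borel"
  shows "conv (conv \<nu>1 \<nu>2) \<nu>3 = conv \<nu>1 (conv \<nu>2 \<nu>3)"
proof (rule measure_eqI)
  fix B assume "B \<in> sets (conv (conv \<nu>1 \<nu>2) \<nu>3)"
  then have B: "B \<in> sets (borel :: 'a measure)" by simp
  interpret \<nu>2: prob_space \<nu>2 by fact
  interpret \<nu>3: prob_space \<nu>3 by fact
  interpret c: prob_space "conv \<nu>2 \<nu>3" by (rule prob_space_conv[OF assms(2-5)])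
  have m: "(\<lambda>x. \<integral>\<^sup>+y. indicator B (x + y) \<partial>\<nu>3) \<in> borel_measurable borel"
  proof -
    have "(\<lambda>(x, y). x + y) \<in> borel_measurable (borel \<Otimes>\<^sub>M \<nu>3)" by (rule measurable_add_pair[OF refl assms(5)])
    from measurable_compose[OF this, of "indicator B :: _ \<Rightarrow> ennreal"] B
    show ?thesis by (intro \<nu>3.borel_measurable_nn_integral) (simp add: split_beta')
  qed
  have m2: "indicator (B) \<circ> (\<lambda>y. x + y) \<in> borel_measurable borel" for x
    using B by (intro measurable_comp[OF measurable_translate]) auto
  have "emeasure (conv (conv \<nu>1 \<nu>2) \<nu>3) B = (\<integral>\<^sup>+x. \<integral>\<^sup>+y. \<integral>\<^sup>+z. indicator B (x + y + z) \<partial>\<nu>3 \<partial>\<nu>2 \<partial>\<nu>1)"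
    by (subst emeasure_conv[OF sets_conv assms(5) \<nu>3.finite_measure_axioms B],
        subst nn_integral_conv[OF assms(1,3) \<nu>2.finite_measure_axioms m]) simp
  also have "\<dots> = (\<integral>\<^sup>+x. \<integral>\<^sup>+w. indicator B (x + w) \<partial>conv \<nu>2 \<nu>3 \<partial>\<nu>1)"
    using nn_integral_conv[OF assms(3,5) \<nu>3.finite_measure_axioms m2]
    by (simp add: comp_def add.assoc)
  also have "\<dots> = emeasure (conv \<nu>1 (conv \<nu>2 \<nu>3)) B"
    by (rule emeasure_conv[OF assms(1) sets_conv c.finite_measure_axioms B, symmetric])
  finally show "emeasure (conv (conv \<nu>1 \<nu>2) \<nu>3) B = emeasure (conv \<nu>1 (conv \<nu>2 \<nu>3)) B" .
qed simp

lemma conv_return_zero: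
  fixes \<nu> :: "'a::{polish_space,topological_ab_group_add} measure"
  assumes "sets \<nu> = sets borel"
  shows "conv \<nu> (return borel 0) = \<nu>"
proof (rule measure_eqI)
  fix B assume "B \<in> sets (conv \<nu> (return borel 0))"
  then have B: "B \<in> sets (borel :: 'a measure)" by simp
  have m: "(\<lambda>y. indicator B (x + y) :: ennreal) \<in> borel_measurable borel" for x
    using measurable_compose[OF measurable_translate, of "indicator B :: _ \<Rightarrow> ennreal"] B by simp
  show "emeasure (conv \<nu> (return borel 0)) B = emeasure \<nu> B"
    using B assms by (subst emeasure_conv)
      (auto simp: nn_integral_return[OF _ m] prob_space.finite_measure prob_space_return)
qed (simp add: assms)

lemma sets_conv_power [simp, measurable_cong]: "sets (conv_power \<mu> n) = sets borel"
  by (cases n) simp_all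

lemma space_conv_power [simp]: "space (conv_power \<mu> n) = UNIV"
  using sets_eq_imp_space_eq[OF sets_conv_power[of \<mu> n]] by simp

lemma prob_space_conv_power:
  assumes "prob_space \<mu>" "sets \<mu> = sets borel"
  shows "prob_space (conv_power \<mu> n)"
  by (induction n) (auto intro!: prob_space_return prob_space_conv assms)

lemma conv_power_add:
  assumes "prob_space \<mu>" "sets \<mu> = sets borel"
  shows "conv_power \<mu> (m + n) = conv (conv_power \<mu> m) (conv_power \<mu> n)"
  by (induction n) (simp_all add: conv_return_zero conv_assoc assms prob_space_conv_power)

lemma conv_power_mult:
  assumes "prob_space \<mu>" "sets \<mu> = sets borel"
  shows "conv_power (conv_power \<mu> m) k = conv_power \<mu> (k * m)"
  by (induction k) (simp_all add: conv_power_add[OF assms, symmetric] add.commute)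

section \<open>Overlap of a law with its translate\<close>

text \<open>
  A common minorant \<open>\<kappa>\<close> can be translated, convolved and restricted, which is awkward to do with
  the infimum in the lattice of measures.
\<close>

definition overlaps :: "'a::topological_space measure \<Rightarrow> 'a measure \<Rightarrow> bool" where
  "overlaps \<nu>1 \<nu>2 \<longleftrightarrow> (\<exists>\<kappa>. sets \<kappa> = sets borel \<and> emeasure \<kappa> UNIV \<noteq> 0 \<and>
     (\<forall>B\<in>sets borel. emeasure \<kappa> B \<le> emeasure \<nu>1 B \<and> emeasure \<kappa> B \<le> emeasure \<nu>2 B))"

lemma inf_neq_null_measure_iff:
  fixes \<nu>1 \<nu>2 :: "'a::topological_space measure"
  assumes "sets \<nu>1 = sets borel" "sets \<nu>2 = sets borel"
  shows "inf \<nu>1 \<nu>2 \<noteq> null_measure borel \<longleftrightarrow> overlaps \<nu>1 \<nu>2"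
proof
  assume neq: "inf \<nu>1 \<nu>2 \<noteq> null_measure borel"
  have s: "sets (inf \<nu>1 \<nu>2) = sets borel" by (rule sets_inf_borel_measure[OF assms])
  have "emeasure (inf \<nu>1 \<nu>2) UNIV \<noteq> 0"
  proof
    assume 0: "emeasure (inf \<nu>1 \<nu>2) UNIV = 0"
    have "inf \<nu>1 \<nu>2 = null_measure borel"
    proof (rule measure_eqI)
      fix A assume "A \<in> sets (inf \<nu>1 \<nu>2)"
      then have "emeasure (inf \<nu>1 \<nu>2) A \<le> emeasure (inf \<nu>1 \<nu>2) UNIV"
        by (intro emeasure_mono) (auto simp: s)
      then show "emeasure (inf \<nu>1 \<nu>2) A = emeasure (null_measure borel) A" using 0 by simp
    qed (simp add: s)
    then show False using neq by simp
  qed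
  then show "overlaps \<nu>1 \<nu>2"
    unfolding overlaps_def using s inf_borel_measure(2)[OF assms] by (intro exI[of _ "inf \<nu>1 \<nu>2"]) auto
next
  assume "overlaps \<nu>1 \<nu>2"
  then obtain \<kappa> where \<kappa>: "sets \<kappa> = sets borel" "emeasure \<kappa> UNIV \<noteq> 0"
    "\<And>B. B \<in> sets borel \<Longrightarrow> emeasure \<kappa> B \<le> emeasure \<nu>1 B" "\<And>B. B \<in> sets borel \<Longrightarrow> emeasure \<kappa> B \<le> emeasure \<nu>2 B"
    unfolding overlaps_def by blast
  have "emeasure \<kappa> UNIV \<le> emeasure (inf \<nu>1 \<nu>2) UNIV"
    by (rule inf_borel_measure(3)[OF assms \<kappa>(1,3,4)]) simp_all
  then show "inf \<nu>1 \<nu>2 \<noteq> null_measure borel" using \<kappa>(2) by auto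
qed

lemma sets_shift [simp, measurable_cong]: "sets (shift x \<nu>) = sets borel"
  by (simp add: shift_def)

lemma emeasure_shift_vimage:
  fixes \<nu> :: "'a::{polish_space,topological_ab_group_add} measure"
  assumes "sets \<nu> = sets borel" "B \<in> sets borel"
  shows "emeasure (shift x \<nu>) B = emeasure \<nu> ((\<lambda>y. x + y) -` B)"
proof -
  have "(\<lambda>y. x + y) \<in> borel_measurable \<nu>"
    using measurable_translate measurable_cong_sets[OF assms(1) refl] by blast
  then show ?thesis
    unfolding shift_def using assms sets_eq_imp_space_eq[OF assms(1)] by (simp add: emeasure_distr)
qed

lemma sets_translate_vimage:
  fixes B :: "'a::{polish_space,topological_ab_group_add} set"
  shows "B \<in> sets borel \<Longrightarrow> (\<lambda>y. x + y) -` B \<in> sets borel"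
  using measurable_sets[OF measurable_translate, of B x] by simp

text \<open>
  Translating the second bound by \<open>x\<close> gives the symmetric form of an overlap: both \<open>\<kappa>\<close> and its
  translate lie below \<open>\<nu>\<close>.
\<close>

lemma overlaps_shift_obtain:
  fixes \<nu> :: "'a::{polish_space,topological_ab_group_add} measure"
  assumes \<nu>: "sets \<nu> = sets borel" and "overlaps \<nu> (shift (- x) \<nu>)"
  obtains \<kappa> where "sets \<kappa> = sets borel" "emeasure \<kappa> UNIV \<noteq> 0"
    "\<And>B. B \<in> sets borel \<Longrightarrow> emeasure \<kappa> B \<le> emeasure \<nu> B"
    "\<And>B. B \<in> sets borel \<Longrightarrow> emeasure (shift x \<kappa>) B \<le> emeasure \<nu> B"
proof -
  obtain \<kappa> where \<kappa>: "sets \<kappa> = sets borel" "emeasure \<kappa> UNIV \<noteq> 0"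
    "\<And>B. B \<in> sets borel \<Longrightarrow> emeasure \<kappa> B \<le> emeasure \<nu> B" "\<And>B. B \<in> sets borel \<Longrightarrow> emeasure \<kappa> B \<le> emeasure (shift (- x) \<nu>) B"
    using assms(2) unfolding overlaps_def by blast
  have "emeasure (shift x \<kappa>) B \<le> emeasure \<nu> B" if B: "B \<in> sets borel" for B
  proof -
    have "emeasure (shift x \<kappa>) B \<le> emeasure (shift (- x) \<nu>) ((\<lambda>y. x + y) -` B)"
      unfolding emeasure_shift_vimage[OF \<kappa>(1) B] by (rule \<kappa>(4)[OF sets_translate_vimage[OF B]])
    also have "\<dots> = emeasure \<nu> B"
      unfolding emeasure_shift_vimage[OF \<nu> sets_translate_vimage[OF B]] by (simp add: vimage_def)
    finally show ?thesis .
  qed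
  then show ?thesis using that \<kappa> by blast
qed

lemma overlaps_shiftI:
  fixes \<nu> :: "'a::{polish_space,topological_ab_group_add} measure"
  assumes \<nu>: "sets \<nu> = sets borel" and \<kappa>: "sets \<kappa> = sets borel" "emeasure \<kappa> UNIV \<noteq> 0"
    "\<And>B. B \<in> sets borel \<Longrightarrow> emeasure \<kappa> B \<le> emeasure \<nu> B"
    "\<And>B. B \<in> sets borel \<Longrightarrow> emeasure (shift x \<kappa>) B \<le> emeasure \<nu> B"
  shows "overlaps \<nu> (shift (- x) \<nu>)"
  unfolding overlaps_def
proof (intro exI[of _ \<kappa>] conjI ballI \<kappa>)
  fix B assume B: "B \<in> sets (borel :: 'a measure)"
  have "emeasure \<kappa> B = emeasure (shift x \<kappa>) ((\<lambda>y. - x + y) -` B)"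
    unfolding emeasure_shift_vimage[OF \<kappa>(1) sets_translate_vimage[OF B]] by (simp add: vimage_def)
  also have "\<dots> \<le> emeasure \<nu> ((\<lambda>y. - x + y) -` B)"
    by (rule \<kappa>(4)[OF sets_translate_vimage[OF B]])
  finally show "emeasure \<kappa> B \<le> emeasure (shift (- x) \<nu>) B"
    unfolding emeasure_shift_vimage[OF \<nu> B] .
qed

section \<open>Averaged differences of bounded sequences\<close>

text \<open>
  The \<open>j\<close>-fold average \<open>((1 + \<theta>) / 2)\<^sup>j\<close> of the difference sequence \<open>g - \<theta> g\<close>, where \<open>\<theta>\<close> shifts
  sequences by one place.
\<close>

primrec avg_diff :: "nat \<Rightarrow> (nat \<Rightarrow> real) \<Rightarrow> nat \<Rightarrow> real" where
  "avg_diff 0 g i = g i - g (Suc i)"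
| "avg_diff (Suc j) g i = (avg_diff j g i + avg_diff j g (Suc i)) / 2"

lemma sum_pascal:
  fixes f :: "nat \<Rightarrow> real"
  shows "(\<Sum>k\<le>Suc n. real (Suc n choose k) * f k) = (\<Sum>k\<le>n. real (n choose k) * (f k + f (Suc k)))"
proof -
  have 1: "(\<Sum>k\<le>Suc n. real (Suc n choose k) * f k)
      = f 0 + ((\<Sum>k\<le>n. real (n choose Suc k) * f (Suc k)) + (\<Sum>k\<le>n. real (n choose k) * f (Suc k)))"
    by (simp only: sum.atMost_Suc_shift) (simp add: sum.distrib algebra_simps)
  have "(\<Sum>k\<le>Suc n. real (n choose k) * f k) = f 0 + (\<Sum>k\<le>n. real (n choose Suc k) * f (Suc k))"
    by (simp only: sum.atMost_Suc_shift) simp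
  then have 2: "(\<Sum>k\<le>n. real (n choose k) * f k) = f 0 + (\<Sum>k\<le>n. real (n choose Suc k) * f (Suc k))"
    by (simp add: binomial_eq_0)
  show ?thesis
    unfolding 1 distrib_left sum.distrib 2 by simp
qed

lemma sum_binomial: "(\<Sum>k\<le>n. real (n choose k)) = 2 ^ n"
  using choose_row_sum[of n] by (simp flip: of_nat_sum)

text \<open>
  \<open>((1 + \<theta>) / 2)\<^sup>l\<close> has binomial coefficients.
\<close>

lemma avg_diff_add:
  "2 ^ l * avg_diff (l + j) g i = (\<Sum>k\<le>l. real (l choose k) * avg_diff j g (i + k))"
proof (induction l arbitrary: i)
  case (Suc l)
  have "2 ^ Suc l * avg_diff (Suc l + j) g i = 2 ^ l * avg_diff (l + j) g i + 2 ^ l * avg_diff (l + j) g (Suc i)"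
    by (simp add: algebra_simps)
  then show ?case
    unfolding Suc sum_pascal by (simp add: sum.distrib algebra_simps)
qed simp

text \<open>
  The variance of a sum of \<open>n\<close> fair signs, \<open>k\<close> of which are negative.
\<close>

lemma sum_binomial_square_deviation:
  "(\<Sum>k\<le>n. real (n choose k) * (real n - 2 * real k)\<^sup>2) = real n * 2 ^ n"
proof -
  show ?thesis
  proof (induction n)
    case (Suc n)
    have "(\<Sum>k\<le>Suc n. real (Suc n choose k) * (real (Suc n) - 2 * real k)\<^sup>2)
       = (\<Sum>k\<le>n. real (n choose k) * (2 * (real n - 2 * real k)\<^sup>2 + 2))"
      unfolding sum_pascal by (intro sum.cong refl) (simp add: power2_eq_square algebra_simps)
    also have "\<dots> = 2 * (\<Sum>k\<le>n. real (n choose k) * (real n - 2 * real k)\<^sup>2) + 2 * (\<Sum>k\<le>n. real (n choose k))"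
      by (simp add: sum_distrib_left sum.distrib distrib_left mult.left_commute mult.commute)
    also have "\<dots> = 2 * (real n * 2 ^ n) + 2 * 2 ^ n"
      unfolding Suc sum_binomial ..
    finally show ?case by (simp add: algebra_simps)
  qed simp
qed

text \<open>
  Summation by parts moves the difference from \<open>g\<close> to the binomial coefficients, and with
  \<open>n = j + 1\<close> the differences of row \<open>j\<close> are \<open>(n choose k) * (n - 2 * k) / n\<close>.  These have small
  sum of absolute values, by Cauchy-Schwarz, since a binomial variable deviates from its mean by
  about \<open>sqrt n\<close> only.
\<close>

lemma abs_avg_diff_le:
  assumes "\<And>i. \<bar>g i\<bar> \<le> 1"
  shows "\<bar>avg_diff j g i\<bar> \<le> 2 / sqrt (real j + 1)"
proof -
  define n where "n = Suc j"
  have parts: "real n * (2 ^ j * avg_diff j g i)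
      = (\<Sum>k\<le>n. real (n choose k) * (real n - 2 * real k) * g (i + k))"
  proof -
    define U V where "U = (\<Sum>k\<le>j. real (j choose k) * g (i + k))"
      and "V = (\<Sum>k\<le>j. real (j choose k) * g (i + Suc k))"
    have "2 ^ j * avg_diff j g i = U - V"
      using avg_diff_add[of j 0 g i] by (simp add: U_def V_def sum_subtractf algebra_simps)
    moreover have "(\<Sum>k\<le>n. real (n choose k) * g (i + k)) = U + V"
      unfolding n_def sum_pascal U_def V_def by (simp add: sum.distrib algebra_simps)
    moreover have "(\<Sum>k\<le>n. real (k * (n choose k)) * g (i + k)) = real n * V"
    proof -
      have "(\<Sum>k\<le>n. real (k * (n choose k)) * g (i + k))
         = (\<Sum>k\<le>j. real (Suc k * (Suc j choose Suc k)) * g (i + Suc k))"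
        unfolding n_def by (simp only: sum.atMost_Suc_shift mult_0 of_nat_0 mult_zero_left add_0)
      then show ?thesis
        unfolding Suc_times_binomial n_def V_def by (simp add: sum_distrib_left algebra_simps)
    qed
    moreover have "(\<Sum>k\<le>n. real (n choose k) * (real n - 2 * real k) * g (i + k))
       = real n * (\<Sum>k\<le>n. real (n choose k) * g (i + k)) - 2 * (\<Sum>k\<le>n. real (k * (n choose k)) * g (i + k))"
      unfolding sum_distrib_left sum_subtractf[symmetric]
      by (intro sum.cong refl) (simp add: algebra_simps)
    ultimately show ?thesis by (simp only:) (simp add: algebra_simps)
  qed
  have "(real n * (2 ^ j * avg_diff j g i))\<^sup>2
      = (\<Sum>k\<le>n. (sqrt (real (n choose k)) * (real n - 2 * real k)) * (sqrt (real (n choose k)) * g (i + k)))\<^sup>2"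
    unfolding parts
    by (intro arg_cong[where f = "\<lambda>x. x\<^sup>2"] sum.cong refl) simp
  also have "\<dots> \<le> (\<Sum>k\<le>n. (sqrt (real (n choose k)) * (real n - 2 * real k))\<^sup>2)
      * (\<Sum>k\<le>n. (sqrt (real (n choose k)) * g (i + k))\<^sup>2)"
    by (rule Cauchy_Schwarz_ineq_sum)
  also have "(\<Sum>k\<le>n. (sqrt (real (n choose k)) * (real n - 2 * real k))\<^sup>2) = real n * 2 ^ n"
    unfolding sum_binomial_square_deviation[symmetric]
    by (intro sum.cong refl) (simp add: power_mult_distrib)
  also have "real n * 2 ^ n * (\<Sum>k\<le>n. (sqrt (real (n choose k)) * g (i + k))\<^sup>2)
      \<le> real n * 2 ^ n * (\<Sum>k\<le>n. real (n choose k))"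
  proof (intro mult_left_mono sum_mono)
    fix k
    have "(g (i + k))\<^sup>2 \<le> 1" using assms[of "i+k"] by (simp add: abs_square_le_1)
    then show "(sqrt (real (n choose k)) * g (i + k))\<^sup>2 \<le> real (n choose k)"
      by (simp add: power_mult_distrib mult_left_le)
  qed simp
  also have "(\<Sum>k\<le>n. real (n choose k)) = 2 ^ n"
    by (rule sum_binomial)
  finally have "(real n * (2 ^ j * avg_diff j g i))\<^sup>2 \<le> real n * (2 * 2 ^ j)\<^sup>2"
    by (simp add: n_def power2_eq_square algebra_simps)
  then have "(sqrt (real n) * avg_diff j g i)\<^sup>2 * (real n * (2 ^ j)\<^sup>2) \<le> 2\<^sup>2 * (real n * (2 ^ j)\<^sup>2)"
    by (simp add: power_mult_distrib power2_eq_square algebra_simps n_def)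
  then have "(sqrt (real n) * avg_diff j g i)\<^sup>2 \<le> 2\<^sup>2"
    by (rule mult_right_le_imp_le) (simp add: n_def)
  then have "\<bar>sqrt (real n) * avg_diff j g i\<bar> \<le> 2"
    by (metis abs_le_square_iff abs_numeral)
  then show ?thesis
    by (simp add: n_def abs_mult field_simps)
qed

text \<open>
  Differences of a periodic sequence sum to zero over a period, and averaging preserves this.
  So in the binomial average over \<open>m\<close> steps each of the \<open>m\<close> coefficients with \<open>k < m\<close>, being at
  least \<open>1\<close>, can be lowered by \<open>1\<close> without changing the value.
\<close>

lemma avg_diff_periodic_contract:
  assumes m: "m \<ge> 1" and per: "\<And>i. g (i + m) = g i"
    and b: "\<And>i. \<bar>avg_diff j g i\<bar> \<le> b"
  shows "\<bar>avg_diff (m + j) g i\<bar> \<le> (1 - m / 2 ^ m) * b"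
proof -
  define d where "d = avg_diff j g"
  have zero: "(\<Sum>k<m. d (i + k)) = 0" for i
    unfolding d_def
  proof (induction j arbitrary: i)
    case 0
    have "(\<Sum>k<l. g (i + k) - g (Suc (i + k))) = g i - g (i + l)" for l
      by (induction l) auto
    then show ?case using per by simp
  next
    case (Suc j)
    then show ?case
      using Suc[of i] Suc[of "Suc i"] by (simp add: sum.distrib flip: sum_divide_distrib)
  qed
  have pos: "1 \<le> real (m choose k)" if "k \<le> m" for k
    using that by (simp add: Suc_le_eq)
  have "2 ^ m * avg_diff (m + j) g i = (\<Sum>k\<le>m. real (m choose k) * d (i + k)) - (\<Sum>k<m. d (i + k))"
    unfolding zero avg_diff_add by (simp add: d_def)
  also have "\<dots> = (\<Sum>k<m. (real (m choose k) - 1) * d (i + k)) + d (i + m)"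
    by (simp add: lessThan_Suc_atMost[symmetric] sum_subtractf algebra_simps)
  also have "\<bar>\<dots>\<bar> \<le> (\<Sum>k<m. (real (m choose k) - 1) * b) + b"
  proof -
    have "\<bar>(\<Sum>k<m. (real (m choose k) - 1) * d (i + k))\<bar> \<le> (\<Sum>k<m. (real (m choose k) - 1) * b)"
      by (rule order_trans[OF sum_abs], rule sum_mono)
        (use pos b in \<open>auto simp: abs_mult d_def intro!: mult_mono\<close>)
    moreover have "\<bar>d (i + m)\<bar> \<le> b" using b by (simp add: d_def)
    ultimately show ?thesis by linarith
  qed
  also have "\<dots> = ((\<Sum>k\<le>m. real (m choose k)) - m) * b"
    by (simp add: lessThan_Suc_atMost[symmetric] sum_subtractf algebra_simps flip: sum_distrib_left)
  also have "(\<Sum>k\<le>m. real (m choose k)) = 2 ^ m"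
    by (rule sum_binomial)
  finally show ?thesis
    by (simp add: abs_mult field_simps)
qed

text \<open>
  \<open>r\<close> is the \<open>m\<close>-th root of the factor gained by \<open>m\<close> averagings, and the factor \<open>1 / r ^ m\<close> in \<open>B\<close>
  pays for an initial stretch shorter than a period.
\<close>

lemma abs_avg_diff_periodic_le:
  assumes m: "m \<ge> 1"
  obtains B r :: real where "B > 0" "0 < r" "r < 1"
    "\<forall>g j i. (\<forall>i. g (i + m) = g i) \<longrightarrow> (\<forall>i. \<bar>g i\<bar> \<le> 1) \<longrightarrow> \<bar>avg_diff j g i\<bar> \<le> B * r ^ j"
proof -
  define q where "q = 1 - m / 2 ^ m"
  have q: "0 < q" "q < 1"
    using m less_exp[of m] unfolding q_def by (simp_all add: field_simps flip: of_nat_power)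
  define r where "r = root m q"
  have r: "0 < r" "r < 1" "r ^ m = q"
    unfolding r_def using q m by auto
  define B where "B = 2 / r ^ m"
  have "B > 0" using r q by (simp add: B_def)
  moreover have "\<bar>avg_diff j g i\<bar> \<le> B * r ^ j"
    if per: "\<And>i. g (i + m) = g i" and bd: "\<And>i. \<bar>g i\<bar> \<le> 1" for g j i
  proof (induction j arbitrary: i rule: less_induct)
    case (less j)
    show ?case
    proof (cases "j < m")
      case True
      have "\<bar>avg_diff j g i\<bar> \<le> 2"
      proof -
        have "\<bar>avg_diff j g i\<bar> \<le> 2 / sqrt (real j + 1)" using abs_avg_diff_le[OF bd] by simp
        also have "\<dots> \<le> 2 / 1" by (intro divide_left_mono) auto
        finally show ?thesis by simp
      qed
      also have "\<dots> \<le> B * r ^ j"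
      proof -
        have "r ^ m \<le> r ^ j" using r True by (intro power_decreasing) auto
        then show ?thesis using r q by (simp add: B_def field_simps)
      qed
      finally show ?thesis .
    next
      case False
      then have "\<bar>avg_diff (m + (j - m)) g i\<bar> \<le> (1 - m / 2 ^ m) * (B * r ^ (j - m))"
        using m by (intro avg_diff_periodic_contract[where b = "B * r ^ (j - m)"] less per) auto
      also have "\<dots> = B * (r ^ m * r ^ (j - m))"
        using r by (simp add: q_def)
      finally show ?thesis using False by (simp flip: power_add)
    qed
  qed
  ultimately show ?thesis using that r by blast
qed

section \<open>Rate of merging of the convolution powers\<close>

text \<open>
  The averaged differences of \<open>f\<close> along the orbit \<open>y, y + x, y + 2 x, \<dots>\<close>.
\<close>

definition orbit_diff ::
  "'a::{polish_space,topological_ab_group_add} \<Rightarrow> nat \<Rightarrow> ('a \<Rightarrow> real) \<Rightarrow> 'a \<Rightarrow> real" where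
  "orbit_diff x j f y = avg_diff j (\<lambda>i. f (y + (\<Sum>l<i. x))) 0"

lemma avg_diff_shift: "avg_diff j (\<lambda>i. g (Suc i)) i = avg_diff j g (Suc i)"
  by (induction j arbitrary: i) auto

lemma orbit_diff_0: "orbit_diff x 0 f y = f y - f (y + x)"
  by (simp add: orbit_diff_def)

lemma orbit_diff_Suc: "orbit_diff x (Suc j) f y = (orbit_diff x j f y + orbit_diff x j f (y + x)) / 2"
proof -
  have "f (y + x + (\<Sum>l<i. x)) = f (y + (\<Sum>l<Suc i. x))" for i
    by (simp add: algebra_simps)
  then have "orbit_diff x j f (y + x) = avg_diff j (\<lambda>i. f (y + (\<Sum>l<Suc i. x))) 0"
    by (simp add: orbit_diff_def)
  then show ?thesis
    using avg_diff_shift[of j "\<lambda>i. f (y + (\<Sum>l<i. x))" 0] by (simp add: orbit_diff_def)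
qed

lemma orbit_diff_translate: "orbit_diff x j f (z + w) = orbit_diff x j (\<lambda>v. f (v + w)) z"
  by (simp add: orbit_diff_def algebra_simps)

lemma orbit_diff_measurable:
  assumes [measurable]: "f \<in> borel_measurable borel"
  shows "orbit_diff x j f \<in> borel_measurable borel"
proof (induction j)
  case 0
  show ?case unfolding orbit_diff_0[abs_def] by measurable
next
  case (Suc j)
  note [measurable] = Suc
  show ?case unfolding orbit_diff_Suc[abs_def] by measurable
qed

lemma orbit_diff_le_2:
  assumes "\<And>z. \<bar>f z\<bar> \<le> 1"
  shows "\<bar>orbit_diff x j f y\<bar> \<le> 2"
proof -
  have "\<bar>orbit_diff x j f y\<bar> \<le> 2 / sqrt (real j + 1)"
    unfolding orbit_diff_def by (rule abs_avg_diff_le) (rule assms)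
  also have "\<dots> \<le> 2 / 1" by (intro divide_left_mono) auto
  finally show ?thesis by simp
qed

text \<open>
  Half of \<open>\<kappa>\<close> and half of its translate fit into \<open>\<nu>\<close> together.  Against this part, of mass \<open>c\<close>,
  integration averages \<open>H w\<close> and \<open>H (w + x)\<close>; the rest has mass \<open>1 - c\<close>.
\<close>

lemma integral_le_of_overlap:
  fixes \<nu> :: "'a::{polish_space,topological_ab_group_add} measure"
  assumes \<nu>: "prob_space \<nu>" "sets \<nu> = sets borel" and ov: "overlaps \<nu> (shift (- x) \<nu>)"
  obtains c where "0 < c" "c \<le> 1"
    "\<forall>(H :: 'a \<Rightarrow> real) a b. H \<in> borel_measurable borel \<longrightarrow> (\<forall>w. \<bar>(H w + H (w + x)) / 2\<bar> \<le> a) \<longrightarrow> (\<forall>w. \<bar>H w\<bar> \<le> b) \<longrightarrow>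
      \<bar>\<integral>w. H w \<partial>\<nu>\<bar> \<le> c * a + (1 - c) * b"
proof -
  interpret \<nu>: prob_space \<nu> by fact
  have sp: "space \<nu> = UNIV" using sets_eq_imp_space_eq[OF \<nu>(2)] by simp
  obtain \<kappa> where \<kappa>: "sets \<kappa> = sets borel" "emeasure \<kappa> UNIV \<noteq> 0"
    "\<And>B. B \<in> sets borel \<Longrightarrow> emeasure \<kappa> B \<le> emeasure \<nu> B"
    "\<And>B. B \<in> sets borel \<Longrightarrow> emeasure (shift x \<kappa>) B \<le> emeasure \<nu> B"
    by (rule overlaps_shift_obtain[OF \<nu>(2) ov]; rule that; assumption)
  have sp\<kappa>: "space \<kappa> = UNIV" using sets_eq_imp_space_eq[OF \<kappa>(1)] by simp
  have fin: "emeasure \<kappa> UNIV \<le> 1"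
    using \<kappa>(3)[of UNIV] \<nu>.emeasure_space_1 by (simp add: sp)
  interpret \<kappa>: finite_measure \<kappa>
    by (rule finite_measureI) (use fin in \<open>auto simp: sp\<kappa> top_unique\<close>)
  define c where "c = measure \<kappa> UNIV"
  have c: "0 < c" "c \<le> 1"
  proof -
    have e: "emeasure \<kappa> UNIV = ennreal c" by (simp add: c_def \<kappa>.emeasure_eq_measure)
    show "0 < c" using \<kappa>(2) unfolding e by (simp add: ennreal_eq_0_iff)
    show "c \<le> 1" using fin unfolding e by (simp add: ennreal_le_1)
  qed
  have tr: "(\<lambda>y. x + y) \<in> borel_measurable \<kappa>"
    using measurable_translate measurable_cong_sets[OF \<kappa>(1) refl] by blast
  obtain h1 :: "'a \<Rightarrow> real" where h1: "h1 \<in> borel_measurable \<nu>" "\<And>y. 0 \<le> h1 y" "\<And>y. h1 y \<le> 1"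
    "\<kappa> = density \<nu> (\<lambda>y. ennreal (h1 y))"
    by (rule bounded_density_exists[OF \<nu>.finite_measure_axioms, of \<kappa>]; (rule that; assumption)?) (use \<kappa> \<nu> in auto)
  obtain h2 :: "'a \<Rightarrow> real" where h2: "h2 \<in> borel_measurable \<nu>" "\<And>y. 0 \<le> h2 y" "\<And>y. h2 y \<le> 1"
    "shift x \<kappa> = density \<nu> (\<lambda>y. ennreal (h2 y))"
    by (rule bounded_density_exists[OF \<nu>.finite_measure_axioms, of "shift x \<kappa>"]; (rule that; assumption)?) (use \<kappa> \<nu> in auto)
  show ?thesis
  proof (rule that[OF c], intro allI impI)
    fix H :: "'a \<Rightarrow> real" and a b
    assume "H \<in> borel_measurable borel" "\<forall>w. \<bar>(H w + H (w + x)) / 2\<bar> \<le> a" "\<forall>w. \<bar>H w\<bar> \<le> b"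
    then have H: "H \<in> borel_measurable borel" "\<And>w. \<bar>(H w + H (w + x)) / 2\<bar> \<le> a" "\<And>w. \<bar>H w\<bar> \<le> b"
      by auto
    have bc: "borel_measurable \<nu> = borel_measurable borel" "borel_measurable \<kappa> = borel_measurable borel"
      by (intro measurable_cong_sets \<nu> \<kappa> refl)+
    have [measurable]: "H \<in> borel_measurable \<nu>" "h1 \<in> borel_measurable \<nu>" "h2 \<in> borel_measurable \<nu>"
      using H h1 h2 by (simp_all add: bc)
    have b0: "0 \<le> b" using H(3)[of 0] by linarith
    have bd: "\<bar>u y * H y\<bar> \<le> b" if "0 \<le> u y" "u y \<le> 1" for u :: "'a \<Rightarrow> real" and y
      using mult_mono[of "u y" 1 "\<bar>H y\<bar>" b] H(3)[of y] that by (simp add: abs_mult)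
    have int: "integrable \<nu> (\<lambda>y. u y * H y)" if "u \<in> borel_measurable \<nu>" "\<And>y. 0 \<le> u y" "\<And>y. u y \<le> 1" for u
      using that bd[of u] by (intro \<nu>.integrable_const_bound[where B = b]) auto
    have inth: "integrable \<nu> h1" "integrable \<nu> h2"
      using h1 h2 by (auto intro!: \<nu>.integrable_const_bound[where B = 1])
    have H\<kappa>: "integrable \<kappa> (\<lambda>y. H (v + y))" for v
      using H(1,3) measurable_compose[OF measurable_translate H(1)]
      by (intro \<kappa>.integrable_const_bound[where B = b]) (auto simp: bc)
    have 1: "(\<integral>y. h1 y * H y \<partial>\<nu>) = (\<integral>y. H y \<partial>\<kappa>)"
      unfolding h1(4) using h1(2) by (subst integral_density) auto
    have "(\<integral>y. h2 y * H y \<partial>\<nu>) = (\<integral>y. H y \<partial>shift x \<kappa>)"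
      unfolding h2(4) using h2(2) by (subst integral_density) auto
    also have "\<dots> = (\<integral>y. H (x + y) \<partial>\<kappa>)"
      unfolding shift_def by (rule integral_distr[OF tr H(1)])
    finally have 2: "(\<integral>y. h2 y * H y \<partial>\<nu>) = (\<integral>y. H (x + y) \<partial>\<kappa>)" .
    have m1: "(\<integral>y. h1 y \<partial>\<nu>) = c"
    proof -
      have "(\<integral>y. 1 \<partial>\<kappa>) = (\<integral>y. h1 y \<partial>\<nu>)"
        unfolding h1(4) using h1(2) by (subst integral_density) auto
      then show ?thesis by (simp add: c_def sp\<kappa>)
    qed
    have m2: "(\<integral>y. h2 y \<partial>\<nu>) = c"
    proof -
      have "(\<integral>y. 1 \<partial>shift x \<kappa>) = (\<integral>y. h2 y \<partial>\<nu>)"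
        unfolding h2(4) using h2(2) by (subst integral_density) auto
      moreover have "(\<integral>y. 1 \<partial>shift x \<kappa>) = (\<integral>y. (1::real) \<partial>\<kappa>)"
        unfolding shift_def by (rule integral_distr[OF tr]) simp
      ultimately show ?thesis by (simp add: c_def sp\<kappa>)
    qed
    define h where "h y = (h1 y + h2 y) / 2" for y
    have h01: "0 \<le> h y" "h y \<le> 1" for y using h1(2,3)[of y] h2(2,3)[of y] by (auto simp: h_def)
    have [measurable]: "h \<in> borel_measurable \<nu>" unfolding h_def by measurable
    have "(\<integral>y. h y * H y \<partial>\<nu>) = (\<integral>y. (h1 y * H y + h2 y * H y) / 2 \<partial>\<nu>)"
      by (simp add: h_def algebra_simps add_divide_distrib)
    also have "\<dots> = ((\<integral>y. H y \<partial>\<kappa>) + (\<integral>y. H (x + y) \<partial>\<kappa>)) / 2"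
      using int[OF h1(1-3)] int[OF h2(1-3)] 1 2 by simp
    also have "\<dots> = (\<integral>y. (H y + H (y + x)) / 2 \<partial>\<kappa>)"
      using H\<kappa>[of 0] H\<kappa>[of x] by (simp add: add.commute)
    finally have hH: "(\<integral>y. h y * H y \<partial>\<nu>) = (\<integral>y. (H y + H (y + x)) / 2 \<partial>\<kappa>)" .
    have "\<bar>\<integral>y. (H y + H (y + x)) / 2 \<partial>\<kappa>\<bar> \<le> (\<integral>y. \<bar>(H y + H (y + x)) / 2\<bar> \<partial>\<kappa>)"
      by (rule integral_abs_bound)
    also have "\<dots> \<le> (\<integral>y. a \<partial>\<kappa>)"
      by (rule integral_mono) (use H\<kappa>[of 0] H\<kappa>[of x] H(2) in \<open>auto simp: add.commute\<close>)
    also have "\<dots> = c * a" by (simp add: c_def sp\<kappa>)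
    finally have A: "\<bar>\<integral>y. h y * H y \<partial>\<nu>\<bar> \<le> c * a" using hH by simp
    have "\<bar>\<integral>y. (1 - h y) * H y \<partial>\<nu>\<bar> \<le> (\<integral>y. \<bar>(1 - h y) * H y\<bar> \<partial>\<nu>)"
      by (rule integral_abs_bound)
    also have "\<dots> \<le> (\<integral>y. (1 - h y) * b \<partial>\<nu>)"
    proof (rule integral_mono)
      show "integrable \<nu> (\<lambda>y. \<bar>(1 - h y) * H y\<bar>)"
        using int[of "\<lambda>y. 1 - h y"] h01 by (intro integrable_abs) auto
      show "integrable \<nu> (\<lambda>y. (1 - h y) * b)"
        using inth by (auto simp: h_def)
      show "\<bar>(1 - h y) * H y\<bar> \<le> (1 - h y) * b" for y
        using h01[of y] H(3)[of y] by (simp add: abs_mult mult_left_mono)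
    qed
    also have "\<dots> = (1 - c) * b"
      using inth m1 m2 by (simp add: h_def \<nu>.prob_space)
    finally have B: "\<bar>\<integral>y. (1 - h y) * H y \<partial>\<nu>\<bar> \<le> (1 - c) * b" .
    have "(\<integral>y. H y \<partial>\<nu>) = (\<integral>y. h y * H y + (1 - h y) * H y \<partial>\<nu>)"
      by (simp add: algebra_simps)
    also have "\<dots> = (\<integral>y. h y * H y \<partial>\<nu>) + (\<integral>y. (1 - h y) * H y \<partial>\<nu>)"
      by (intro Bochner_Integration.integral_add int) (use h01 in auto)
    finally show "\<bar>\<integral>w. H w \<partial>\<nu>\<bar> \<le> c * a + (1 - c) * b" using A B by linarith
  qed
qed

text \<open>
  \<open>u k j\<close> bounds the effect of \<open>k\<close> steps of law \<open>\<nu>\<close> after \<open>j\<close> averagings.  Because the group is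
  commutative, a step turns \<open>j\<close> averagings into \<open>j + 1\<close> with weight \<open>c\<close>, whatever its position
  among the others.  A supersolution \<open>u\<close> of the resulting recursion replaces the explicit sum
  over the binomially distributed number of averagings.
\<close>

lemma orbit_diff_recursion_bound:
  fixes \<nu> :: "'a::{polish_space,topological_ab_group_add} measure"
  assumes \<nu>: "prob_space \<nu>" "sets \<nu> = sets borel"
    and c: "\<And>(H :: 'a \<Rightarrow> real) a b. H \<in> borel_measurable borel \<Longrightarrow> (\<And>w. \<bar>(H w + H (w + x)) / 2\<bar> \<le> a) \<Longrightarrow> (\<And>w. \<bar>H w\<bar> \<le> b) \<Longrightarrow>
      \<bar>\<integral>w. H w \<partial>\<nu>\<bar> \<le> c * a + (1 - c) * b"
    and u0: "\<And>f j y. (\<And>z. \<bar>f z\<bar> \<le> 1) \<Longrightarrow> \<bar>orbit_diff x j f y\<bar> \<le> u 0 j"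
    and uSuc: "\<And>k j. c * u k (Suc j) + (1 - c) * u k j \<le> u (Suc k) j"
    and f: "f \<in> borel_measurable borel" "\<And>z. \<bar>f z\<bar> \<le> 1"
  shows "\<bar>\<integral>z. orbit_diff x j f z \<partial>conv_power \<nu> k\<bar> \<le> u k j"
  using f
proof (induction k arbitrary: j f)
  case 0
  have "(\<integral>z. orbit_diff x j f z \<partial>conv_power \<nu> 0) = orbit_diff x j f 0"
    using orbit_diff_measurable[OF 0(1)] by (simp add: integral_return)
  then show ?case using u0[OF 0(2)] by simp
next
  case (Suc k)
  note p = prob_space_conv_power[OF \<nu>, of k] sets_conv_power[of \<nu> k]
  interpret K: prob_space "conv_power \<nu> k" by (rule p)
  have fw: "(\<lambda>v. f (v + w)) \<in> borel_measurable borel" for w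
    using Suc.prems(1) by measurable
  define H where "H w = (\<integral>z. orbit_diff x j f (z + w) \<partial>conv_power \<nu> k)" for w
  note ic = integral_conv[OF p \<nu> orbit_diff_measurable[OF Suc.prems(1)] orbit_diff_le_2[OF Suc.prems(2)]]
  have int: "integrable (conv_power \<nu> k) (orbit_diff x j (\<lambda>v. f (v + w)))" for w
  proof (rule K.integrable_const_bound[where B = 2])
    show "AE z in conv_power \<nu> k. norm (orbit_diff x j (\<lambda>v. f (v + w)) z) \<le> 2"
      using orbit_diff_le_2[of "\<lambda>v. f (v + w)"] Suc.prems(2) by simp
    show "orbit_diff x j (\<lambda>v. f (v + w)) \<in> borel_measurable (conv_power \<nu> k)"
      using orbit_diff_measurable[OF fw] by simp
  qed
  have H: "\<bar>H w\<bar> \<le> u k j" for w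
    unfolding H_def orbit_diff_translate by (rule Suc.IH) (use fw Suc.prems in auto)
  have "(H w + H (w + x)) / 2 = (\<integral>z. orbit_diff x (Suc j) (\<lambda>v. f (v + w)) z \<partial>conv_power \<nu> k)" for w
  proof -
    have eq: "orbit_diff x (Suc j) (\<lambda>v. f (v + w))
      = (\<lambda>z. (orbit_diff x j (\<lambda>v. f (v + w)) z + orbit_diff x j (\<lambda>v. f (v + (w + x))) z) / 2)"
      unfolding orbit_diff_Suc[abs_def] orbit_diff_translate[symmetric] by (simp add: ac_simps)
    show ?thesis
      unfolding H_def orbit_diff_translate eq using int[of w] int[of "w + x"] by simp
  qed
  then have H2: "\<bar>(H w + H (w + x)) / 2\<bar> \<le> u k (Suc j)" for w
    using Suc.IH[OF fw, of w "Suc j"] Suc.prems(2) by simp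
  have "(\<integral>z. orbit_diff x j f z \<partial>conv_power \<nu> (Suc k)) = (\<integral>w. H w \<partial>\<nu>)"
    unfolding conv_power.simps H_def by (rule ic(2))
  also have "\<bar>\<dots>\<bar> \<le> c * u k (Suc j) + (1 - c) * u k j"
    by (rule c) (use ic(3) H H2 in \<open>auto simp: H_def[abs_def]\<close>)
  finally show ?case using uSuc[of k j] by linarith
qed

text \<open>
  This makes \<open>1 / sqrt (j + 1 + c / 2 * k)\<close> a supersolution.  For \<open>t \<ge> 1\<close> the decrease of
  \<open>1 / sqrt t\<close> over a unit interval is at least half of what its slope at \<open>t\<close> predicts, so a step
  of length \<open>1\<close> with probability \<open>c\<close> outweighs a sure step of length \<open>c / 2\<close>.
\<close>

lemma inverse_sqrt_recursion:
  fixes c t :: real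
  assumes c: "0 < c" "c \<le> 1" and t: "t \<ge> 1"
  shows "c / sqrt (t + 1) + (1 - c) / sqrt t \<le> 1 / sqrt (t + c / 2)"
proof -
  define p q r where "p = sqrt t" and "q = sqrt (t + 1)" and "r = sqrt (t + c / 2)"
  have sq: "p\<^sup>2 = t" "q\<^sup>2 = t + 1" "r\<^sup>2 = t + c / 2" using c t by (simp_all add: p_def q_def r_def)
  have pos: "1 \<le> p" "0 < q" "0 < r" using c t by (simp_all add: p_def q_def r_def)
  have pr: "p \<le> r" using c by (simp add: p_def r_def)
  have q2: "q \<le> 3 / 2 * p"
  proof (rule power2_le_imp_le)
    have "(3 / 2 * p)\<^sup>2 = 9 / 4 * t" by (simp add: power_mult_distrib sq power_divide)
    then show "q\<^sup>2 \<le> (3 / 2 * p)\<^sup>2" using t by (simp add: sq)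
  qed (use pos in auto)
  have "1 / p - 1 / r \<le> c / (4 * p ^ 3)"
  proof -
    have "(r - p) * (r + p) = c / 2" using sq by (simp add: algebra_simps power2_eq_square)
    then have "r - p = c / (2 * (r + p))" using pos by (simp add: field_simps)
    moreover have "1 / p - 1 / r = (r - p) / (p * r)" using pos by (simp add: field_simps)
    ultimately have "1 / p - 1 / r = c / (2 * (r + p) * (p * r))" by simp
    also have "\<dots> \<le> c / (2 * (p + p) * (p * p))"
      using c pos pr by (intro divide_left_mono mult_mono mult_pos_pos) auto
    finally show ?thesis by (simp add: power3_eq_cube algebra_simps)
  qed
  moreover have "c / (4 * p ^ 3) \<le> c * (1 / p - 1 / q)"
  proof -
    have "(q - p) * (q + p) = 1" using sq by (simp add: algebra_simps power2_eq_square)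
    then have "q - p = 1 / (q + p)" using pos by (simp add: field_simps)
    moreover have "1 / p - 1 / q = (q - p) / (p * q)" using pos by (simp add: field_simps)
    ultimately have "1 / p - 1 / q = 1 / ((q + p) * (p * q))" by simp
    moreover have "(q + p) * (p * q) \<le> 4 * p ^ 3"
    proof -
      have "(q + p) * (p * q) \<le> (3 / 2 * p + p) * (p * (3 / 2 * p))"
        using pos q2 by (intro mult_mono) auto
      also have "\<dots> = 15 / 4 * p ^ 3" by (simp add: power3_eq_cube)
      also have "\<dots> \<le> 4 * p ^ 3" using pos by (intro mult_right_mono) auto
      finally show ?thesis .
    qed
    ultimately have "1 / (4 * p ^ 3) \<le> 1 / p - 1 / q"
      using pos by (auto intro!: divide_left_mono)
    then have "c * (1 / (4 * p ^ 3)) \<le> c * (1 / p - 1 / q)" using c by (intro mult_left_mono) auto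
    then show ?thesis by simp
  qed
  ultimately have "c / q + (1 - c) / p \<le> 1 / r" by (simp add: algebra_simps diff_divide_distrib)
  then show ?thesis by (simp add: p_def q_def r_def)
qed


text \<open>
  A bound for the total variation distance of \<open>\<nu>\<close> and its translate, in terms of test functions.
\<close>

definition translation_gap_le ::
  "'a::{polish_space,topological_ab_group_add} measure \<Rightarrow> 'a \<Rightarrow> real \<Rightarrow> bool" where
  "translation_gap_le \<nu> x e \<longleftrightarrow> (\<forall>f :: 'a \<Rightarrow> real. f \<in> borel_measurable borel \<longrightarrow>
     (\<forall>z. \<bar>f z\<bar> \<le> 1) \<longrightarrow> \<bar>\<integral>z. f z - f (z + x) \<partial>\<nu>\<bar> \<le> e)"

lemma translation_gap_le_mono:
  "translation_gap_le \<nu> x e \<Longrightarrow> e \<le> e' \<Longrightarrow> translation_gap_le \<nu> x e'"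
  unfolding translation_gap_le_def by (meson order_trans)

text \<open>
  Blocks of \<open>n0\<close> steps have the law \<open>\<mu>\<^sup>n\<^sup>0\<close>, to which the recursion applies.  The \<open>n mod n0\<close> steps
  left over cannot increase the distance.
\<close>

lemma merging_bound:
  fixes \<mu> :: "'a::{polish_space,topological_ab_group_add} measure"
  assumes \<mu>: "prob_space \<mu>" "sets \<mu> = sets borel"
    and ov: "overlaps (conv_power \<mu> n0) (shift (- x) (conv_power \<mu> n0))"
  obtains c where "0 < c" "c \<le> 1"
    "\<forall>u n. (\<forall>f j y. (\<forall>z. \<bar>f z\<bar> \<le> 1) \<longrightarrow> \<bar>orbit_diff x j f y\<bar> \<le> u 0 j) \<longrightarrow>
      (\<forall>k j. c * u k (Suc j) + (1 - c) * u k j \<le> u (Suc k) j) \<longrightarrow>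
      translation_gap_le (conv_power \<mu> n) x (u (n div n0) 0)"
proof -
  let ?\<nu> = "conv_power \<mu> n0"
  have \<nu>: "prob_space ?\<nu>" "sets ?\<nu> = sets borel"
    by (simp_all add: prob_space_conv_power[OF \<mu>])
  obtain c where c: "0 < c" "c \<le> 1"
    "\<forall>(H :: 'a \<Rightarrow> real) a b. H \<in> borel_measurable borel \<longrightarrow> (\<forall>w. \<bar>(H w + H (w + x)) / 2\<bar> \<le> a) \<longrightarrow> (\<forall>w. \<bar>H w\<bar> \<le> b) \<longrightarrow>
      \<bar>\<integral>w. H w \<partial>?\<nu>\<bar> \<le> c * a + (1 - c) * b"
    by (rule integral_le_of_overlap[OF \<nu> ov]; rule that; assumption)
  show ?thesis
  proof (rule that[OF c(1,2)], intro allI impI)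
    fix u :: "nat \<Rightarrow> nat \<Rightarrow> real" and n
    assume as: "\<forall>f j y. (\<forall>z. \<bar>f z\<bar> \<le> 1) \<longrightarrow> \<bar>orbit_diff x j f y\<bar> \<le> u 0 j"
      "\<forall>k j. c * u k (Suc j) + (1 - c) * u k j \<le> u (Suc k) j"
    then have u0: "\<And>f j y. (\<And>z. \<bar>f z\<bar> \<le> 1) \<Longrightarrow> \<bar>orbit_diff x j f y\<bar> \<le> u 0 j"
      and uSuc: "\<And>k j. c * u k (Suc j) + (1 - c) * u k j \<le> u (Suc k) j" by blast+
    show "translation_gap_le (conv_power \<mu> n) x (u (n div n0) 0)"
      unfolding translation_gap_le_def
    proof (intro allI impI)
      fix f :: "'a \<Rightarrow> real"
      assume "f \<in> borel_measurable borel" "\<forall>z. \<bar>f z\<bar> \<le> 1"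
      then have f: "f \<in> borel_measurable borel" "\<And>z. \<bar>f z\<bar> \<le> 1" by auto
      define k r where "k = n div n0" and "r = n mod n0"
      have n: "conv_power \<mu> n = conv (conv_power \<mu> r) (conv_power ?\<nu> k)"
        unfolding conv_power_mult[OF \<mu>] conv_power_add[OF \<mu>, symmetric] k_def r_def by simp
      have pr: "prob_space (conv_power \<mu> r)" "sets (conv_power \<mu> r) = sets borel"
        by (simp_all add: prob_space_conv_power[OF \<mu>])
      have pk: "prob_space (conv_power ?\<nu> k)" "sets (conv_power ?\<nu> k) = sets borel"
        by (simp_all add: prob_space_conv_power[OF \<nu>])
      interpret R: prob_space "conv_power \<mu> r" by (rule pr)
      have m: "orbit_diff x 0 f \<in> borel_measurable borel" by (rule orbit_diff_measurable[OF f(1)])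
      have fw: "(\<lambda>v. f (v + w)) \<in> borel_measurable borel" for w using f(1) by measurable
      define H where "H w = (\<integral>z. orbit_diff x 0 f (z + w) \<partial>conv_power ?\<nu> k)" for w
      have H: "\<bar>H w\<bar> \<le> u k 0" for w
        unfolding H_def orbit_diff_translate
        by (rule orbit_diff_recursion_bound[OF \<nu> c(3)[rule_format] u0 uSuc fw f(2)])
      have Hm: "H \<in> borel_measurable borel"
        unfolding H_def[abs_def] by (rule integral_conv(3)[OF pk pr m orbit_diff_le_2[OF f(2)]])
      have "(\<integral>z. f z - f (z + x) \<partial>conv_power \<mu> n) = (\<integral>w. H w \<partial>conv_power \<mu> r)"
        unfolding n orbit_diff_0[symmetric] H_def
        by (subst integral_conv(1)[OF pr pk m orbit_diff_le_2[OF f(2)]]) (simp add: add.commute)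
      also have "\<bar>\<dots>\<bar> \<le> (\<integral>w. \<bar>H w\<bar> \<partial>conv_power \<mu> r)" by (rule integral_abs_bound)
      also have "\<dots> \<le> (\<integral>w. u k 0 \<partial>conv_power \<mu> r)"
        by (intro integral_mono R.integrable_const_bound[where B = "u k 0"])
          (use H Hm order_trans[OF abs_ge_zero H] in auto)
      also have "\<dots> = u k 0" by (simp add: R.prob_space[simplified])
      finally show "\<bar>\<integral>z. f z - f (z + x) \<partial>conv_power \<mu> n\<bar> \<le> u (n div n0) 0"
        by (simp add: k_def)
    qed
  qed
qed

lemma merging_rate_sqrt:
  fixes \<mu> :: "'a::{polish_space,topological_ab_group_add} measure"
  assumes \<mu>: "prob_space \<mu>" "sets \<mu> = sets borel" and n0: "n0 \<ge> 1"
    and ov: "overlaps (conv_power \<mu> n0) (shift (- x) (conv_power \<mu> n0))"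
  obtains C where "C > 0" "\<forall>n\<ge>1. translation_gap_le (conv_power \<mu> n) x (C / sqrt (real n))"
proof -
  obtain c where c: "0 < c" "c \<le> 1"
    and bound: "\<forall>u n. (\<forall>f j y. (\<forall>z. \<bar>f z\<bar> \<le> 1) \<longrightarrow> \<bar>orbit_diff x j f y\<bar> \<le> u 0 j) \<longrightarrow>
      (\<forall>k j. c * u k (Suc j) + (1 - c) * u k j \<le> u (Suc k) j) \<longrightarrow>
      translation_gap_le (conv_power \<mu> n) x (u (n div n0) 0)"
    by (rule merging_bound[OF \<mu> ov]; rule that; assumption)
  define u where "u k j = 2 / sqrt (real j + 1 + c / 2 * real k)" for k j
  show ?thesis
  proof (rule that[of "2 / sqrt (c / (2 * real n0))"], use c n0 in simp, intro allI impI)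
    fix n :: nat
    assume n: "n \<ge> 1"
    have gap: "translation_gap_le (conv_power \<mu> n) x (u (n div n0) 0)"
    proof (rule bound[rule_format])
      show "\<bar>orbit_diff x j f y\<bar> \<le> u 0 j" if "\<And>z. \<bar>f z\<bar> \<le> 1" for f j y
        unfolding orbit_diff_def u_def using abs_avg_diff_le[of _ j 0] that by simp
      show "c * u k (Suc j) + (1 - c) * u k j \<le> u (Suc k) j" for k j
      proof -
        define t where "t = real j + 1 + c / 2 * real k"
        define a b d where "a = 1 / sqrt (t + 1)" and "b = 1 / sqrt t" and "d = 1 / sqrt (t + c / 2)"
        have "u k (Suc j) = 2 * a" "u k j = 2 * b" "u (Suc k) j = 2 * d"
          unfolding u_def t_def a_def b_def d_def by (simp_all add: algebra_simps add_divide_distrib)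
        moreover have "c * a + (1 - c) * b \<le> d"
          using inverse_sqrt_recursion[OF c, of t] c by (simp add: t_def a_def b_def d_def)
        ultimately show ?thesis by (simp add: algebra_simps)
      qed
    qed
    have "u (n div n0) 0 \<le> 2 / sqrt (c / (2 * real n0) * real n)"
    proof -
      have "n \<le> n0 * (n div n0 + 1)"
        using dividend_less_times_div[of n0 n] n0 by simp
      then have "real n \<le> real n0 * (real (n div n0) + 1)"
        by (metis of_nat_le_iff of_nat_mult of_nat_add of_nat_1)
      then have "c / (2 * real n0) * real n \<le> c / (2 * real n0) * (real n0 * (real (n div n0) + 1))"
        using c n0 by (intro mult_left_mono) auto
      also have "\<dots> = c / 2 * (real (n div n0) + 1)" using n0 by simp
      also have "\<dots> \<le> 1 + c / 2 * real (n div n0)" using c by (simp add: algebra_simps)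
      finally show ?thesis
        unfolding u_def using c n n0
        by (intro divide_left_mono mult_pos_pos) (auto intro!: add_pos_nonneg)
    qed
    also have "\<dots> = 2 / sqrt (c / (2 * real n0)) / sqrt (real n)"
      by (simp only: real_sqrt_mult divide_divide_eq_left)
    finally show "translation_gap_le (conv_power \<mu> n) x (2 / sqrt (c / (2 * real n0)) / sqrt (real n))"
      by (rule translation_gap_le_mono[OF gap])
  qed
qed

text \<open>
  If \<open>m x = 0\<close>, functions are periodic along the orbits of \<open>x\<close>.  Then \<open>B * r ^ j * q ^ k\<close> solves the
  recursion for \<open>q = c * r + (1 - c)\<close>.
\<close>

lemma merging_rate_geometric:
  fixes \<mu> :: "'a::{polish_space,topological_ab_group_add} measure"
  assumes \<mu>: "prob_space \<mu>" "sets \<mu> = sets borel" and n0: "n0 \<ge> 1"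
    and ov: "overlaps (conv_power \<mu> n0) (shift (- x) (conv_power \<mu> n0))"
    and "finite_order x"
  obtains C \<rho> where "C > 0" "0 < \<rho>" "\<rho> < 1" "\<forall>n. translation_gap_le (conv_power \<mu> n) x (C * \<rho> ^ n)"
proof -
  obtain c where c: "0 < c" "c \<le> 1"
    and bound: "\<forall>u n. (\<forall>f j y. (\<forall>z. \<bar>f z\<bar> \<le> 1) \<longrightarrow> \<bar>orbit_diff x j f y\<bar> \<le> u 0 j) \<longrightarrow>
      (\<forall>k j. c * u k (Suc j) + (1 - c) * u k j \<le> u (Suc k) j) \<longrightarrow>
      translation_gap_le (conv_power \<mu> n) x (u (n div n0) 0)"
    by (rule merging_bound[OF \<mu> ov]; rule that; assumption)
  obtain m where m: "m \<ge> 1" "(\<Sum>i<(m::nat). x) = 0"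
    using \<open>finite_order x\<close> unfolding finite_order_def by blast
  have per: "(\<Sum>l<i + m. x) = (\<Sum>l<i. x)" for i
    by (induction i) (simp_all add: m(2))
  obtain B r :: real where B: "B > 0" and r: "0 < r" "r < 1"
    and Br: "\<forall>g j i. (\<forall>i. g (i + m) = g i) \<longrightarrow> (\<forall>i. \<bar>g i\<bar> \<le> 1) \<longrightarrow> \<bar>avg_diff j g i\<bar> \<le> B * r ^ j"
    by (rule abs_avg_diff_periodic_le[OF m(1)]; rule that; assumption)
  define q where "q = c * r + 1 - c"
  have q: "0 < q" "q < 1"
    using c r mult_pos_pos[OF c(1) r(1)] mult_strict_left_mono[OF r(2) c(1)] unfolding q_def by linarith+
  define \<rho> where "\<rho> = root n0 q"
  have \<rho>: "0 < \<rho>" "\<rho> < 1" "\<rho> ^ n0 = q"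
    unfolding \<rho>_def using q n0 by auto
  define u where "u k j = B * r ^ j * q ^ k" for k j
  show ?thesis
  proof (rule that[OF divide_pos_pos[OF B q(1)] \<rho>(1,2)], intro allI impI)
    fix n :: nat
    have gap: "translation_gap_le (conv_power \<mu> n) x (u (n div n0) 0)"
    proof (rule bound[rule_format])
      show "\<bar>orbit_diff x j f y\<bar> \<le> u 0 j" if "\<And>z. \<bar>f z\<bar> \<le> 1" for f j y
        unfolding orbit_diff_def u_def using Br[rule_format, of "\<lambda>i. f (y + (\<Sum>l<i. x))" j 0] that by (simp add: per)
      show "c * u k (Suc j) + (1 - c) * u k j \<le> u (Suc k) j" for k j
        by (simp add: u_def q_def algebra_simps)
    qed
    have "u (n div n0) 0 = B / q * q ^ Suc (n div n0)" using q by (simp add: u_def)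
    also have "\<dots> \<le> B / q * \<rho> ^ n"
    proof -
      have "n \<le> n0 * Suc (n div n0)"
        using dividend_less_times_div[of n0 n] n0 by simp
      then have "\<rho> ^ (n0 * Suc (n div n0)) \<le> \<rho> ^ n" using \<rho> by (intro power_decreasing) auto
      then have "q ^ Suc (n div n0) \<le> \<rho> ^ n" unfolding power_mult \<rho>(3) .
      then show ?thesis using B q by (intro mult_left_mono) auto
    qed
    finally show "translation_gap_le (conv_power \<mu> n) x (B / q * \<rho> ^ n)"
      by (rule translation_gap_le_mono[OF gap])
  qed
qed

section \<open>Marginal and tail laws of the random walk\<close>

definition walk :: "'a::{polish_space,topological_ab_group_add} \<Rightarrow> (nat \<Rightarrow> 'a) \<Rightarrow> nat \<Rightarrow> 'a" where
  "walk x X n = x + (\<Sum>i<n. X i)"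

lemma walk_measurable:
  assumes \<mu>: "sets \<mu> = sets borel"
  shows "(\<lambda>(x, X). walk x X) \<in> measurable (borel \<Otimes>\<^sub>M (\<Pi>\<^sub>M i\<in>(UNIV::nat set). \<mu>))
    (\<Pi>\<^sub>M i\<in>(UNIV::nat set). (borel :: 'a::{polish_space,topological_ab_group_add} measure))"
    and "walk x \<in> measurable (\<Pi>\<^sub>M i\<in>(UNIV::nat set). \<mu>) (\<Pi>\<^sub>M i\<in>(UNIV::nat set). borel)"
    and "(\<lambda>X. \<Sum>i<n. X i) \<in> borel_measurable (\<Pi>\<^sub>M i\<in>(UNIV::nat set). \<mu>)"
proof -
  have comp: "(\<lambda>X. X i) \<in> borel_measurable (\<Pi>\<^sub>M i\<in>(UNIV::nat set). \<mu>)" for i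
    using measurable_component_singleton[of i UNIV "\<lambda>_. \<mu>"] measurable_cong_sets[OF refl \<mu>] by blast
  show sum: "(\<lambda>X. \<Sum>i<n. X i) \<in> borel_measurable (\<Pi>\<^sub>M i\<in>(UNIV::nat set). \<mu>)" for n
    by (induction n) (auto intro!: borel_measurable_add comp)
  have c2: "(\<lambda>p. walk (fst p) (snd p) n) \<in> borel_measurable (borel \<Otimes>\<^sub>M (\<Pi>\<^sub>M i\<in>(UNIV::nat set). \<mu>))" for n
    unfolding walk_def by (intro borel_measurable_add measurable_fst measurable_compose[OF measurable_snd sum])
  show "(\<lambda>(x, X). walk x X) \<in> measurable (borel \<Otimes>\<^sub>M (\<Pi>\<^sub>M i\<in>(UNIV::nat set). \<mu>)) (\<Pi>\<^sub>M i\<in>(UNIV::nat set). borel)"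
    unfolding split_beta' by (rule measurable_PiM_single'[OF c2]) auto
  have c1: "(\<lambda>X. walk x X n) \<in> borel_measurable (\<Pi>\<^sub>M i\<in>(UNIV::nat set). \<mu>)" for n
    unfolding walk_def by (intro borel_measurable_add measurable_const sum) simp
  show "walk x \<in> measurable (\<Pi>\<^sub>M i\<in>(UNIV::nat set). \<mu>) (\<Pi>\<^sub>M i\<in>(UNIV::nat set). borel)"
    by (rule measurable_PiM_single'[OF c1]) auto
qed

lemma RW_eq: "RW x \<mu> = distr (\<Pi>\<^sub>M i\<in>(UNIV::nat set). \<mu>) (\<Pi>\<^sub>M i\<in>(UNIV::nat set). borel) (walk x)"
  unfolding RW_def walk_def[abs_def] ..

lemma sum_comb_seq: "(\<Sum>i<n + k. comb_seq k \<omega> \<omega>' i) = (\<Sum>i<k. \<omega> i) + (\<Sum>i<n. \<omega>' i)"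
  for \<omega> \<omega>' :: "nat \<Rightarrow> 'a::ab_group_add"
proof (induction n)
  case 0
  show ?case by (auto intro!: sum.cong simp: comb_seq_less)
next
  case (Suc n)
  then show ?case using comb_seq_add[of k \<omega> \<omega>' n] by (simp add: add.assoc)
qed

lemma distr_step_sum:
  fixes \<mu> :: "'a::{polish_space,topological_ab_group_add} measure"
  assumes \<mu>: "prob_space \<mu>" "sets \<mu> = sets borel"
  shows "distr (\<Pi>\<^sub>M i\<in>(UNIV::nat set). \<mu>) borel (\<lambda>X. \<Sum>i<n. X i) = conv_power \<mu> n"
proof (induction n)
  interpret prob_space \<mu> by (rule \<mu>)
  interpret sequence_space \<mu> ..
  case 0
  show ?case using P.prob_space_axioms by (auto intro!: measure_eqI simp: emeasure_distr P.emeasure_space_1 indicator_def)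
next
  interpret prob_space \<mu> by (rule \<mu>)
  interpret sequence_space \<mu> ..
  case (Suc n)
  have m0: "(\<lambda>X. X 0) \<in> measurable S \<mu>" by simp
  have d0: "distr S \<mu> (\<lambda>X. X 0) = \<mu>" using PiM_component[of 0] by simp
  have mc: "(\<lambda>(\<omega>, \<omega>'). comb_seq n \<omega> \<omega>') \<in> measurable (S \<Otimes>\<^sub>M S) S" by (rule measurable_comb_seq)
  have "distr S borel (\<lambda>X. \<Sum>i<Suc n. X i) = distr (distr (S \<Otimes>\<^sub>M S) S (\<lambda>(\<omega>, \<omega>'). comb_seq n \<omega> \<omega>')) borel (\<lambda>X. \<Sum>i<Suc n. X i)"
    by (simp only: PiM_comb_seq)
  also have "\<dots> = distr (S \<Otimes>\<^sub>M S) borel (\<lambda>(\<omega>, \<omega>'). (\<Sum>i<n. \<omega> i) + \<omega>' 0)"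
    unfolding distr_distr[OF walk_measurable(3)[OF \<mu>(2)] mc] comp_def
    using sum_comb_seq[where n = 1 and k = n] by (auto intro!: distr_cong simp: split_beta' lessThan_Suc)
  also have "\<dots> = distr (distr (S \<Otimes>\<^sub>M S) (borel \<Otimes>\<^sub>M \<mu>) (\<lambda>(\<omega>, \<omega>'). (\<Sum>i<n. \<omega> i, \<omega>' 0))) borel (\<lambda>(x, y). x + y)"
  proof (subst distr_distr)
    show "(\<lambda>(x, y). x + y) \<in> borel_measurable (borel \<Otimes>\<^sub>M \<mu>)" by (rule measurable_add_pair[OF refl \<mu>(2)])
    show "(\<lambda>(\<omega>, \<omega>'). (\<Sum>i<n. \<omega> i, \<omega>' 0)) \<in> measurable (S \<Otimes>\<^sub>M S) (borel \<Otimes>\<^sub>M \<mu>)"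
      unfolding split_beta'
      by (intro measurable_Pair measurable_compose[OF measurable_fst walk_measurable(3)[OF \<mu>(2)]]
        measurable_compose[OF measurable_snd m0])
  qed (simp add: comp_def split_beta')
  also have "distr (S \<Otimes>\<^sub>M S) (borel \<Otimes>\<^sub>M \<mu>) (\<lambda>(\<omega>, \<omega>'). (\<Sum>i<n. \<omega> i, \<omega>' 0))
      = distr S borel (\<lambda>X. \<Sum>i<n. X i) \<Otimes>\<^sub>M distr S \<mu> (\<lambda>X. X 0)"
    by (rule pair_measure_distr[symmetric, OF walk_measurable(3)[OF \<mu>(2)] m0])
      (simp add: d0 prob_space_imp_sigma_finite \<mu>(1))
  finally show ?case by (simp add: Suc d0 conv_def)
qed

text \<open>
  From time \<open>k\<close> on the walk is a new walk from its position at time \<open>k\<close>, and \<open>G y\<close> is the probability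
  that a walk from \<open>y\<close> lies in \<open>B\<close>.
\<close>

lemma RW_tail:
  fixes \<mu> :: "'a::{polish_space,topological_ab_group_add} measure"
  assumes \<mu>: "prob_space \<mu>" "sets \<mu> = sets borel"
    and B: "B \<in> sets (\<Pi>\<^sub>M i\<in>(UNIV::nat set). (borel :: 'a measure))"
  obtains G :: "'a \<Rightarrow> real" where "G \<in> borel_measurable borel" "\<And>z. \<bar>G z\<bar> \<le> 1"
    "\<And>x. (\<integral>s. indicator B (\<lambda>n. s (n + k)) \<partial>RW x \<mu>) = (\<integral>z. G (z + x) \<partial>conv_power \<mu> k)"
proof -
  interpret prob_space \<mu> by (rule \<mu>)
  interpret sequence_space \<mu> ..
  interpret SS: pair_prob_space S S ..
  let ?E = "\<Pi>\<^sub>M i\<in>(UNIV::nat set). (borel :: 'a measure)"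
  define G :: "'a \<Rightarrow> real" where "G y = (\<integral>X. indicator B (walk y X) \<partial>S)" for y
  have iB: "(indicator B :: _ \<Rightarrow> real) \<in> borel_measurable ?E" using B by simp
  have Gm: "G \<in> borel_measurable borel"
    unfolding G_def[abs_def]
    by (rule P.borel_measurable_lebesgue_integral)
      (use measurable_compose[OF walk_measurable(1)[OF \<mu>(2)] iB] in \<open>simp add: split_beta'\<close>)
  have Gb: "\<bar>G z\<bar> \<le> 1" for z
  proof -
    have "\<bar>G z\<bar> \<le> (\<integral>X. \<bar>indicator B (walk z X)\<bar> \<partial>S)" unfolding G_def by (rule integral_abs_bound)
    also have "\<dots> \<le> (\<integral>X. 1 \<partial>S)"
      by (intro integral_mono P.integrable_const_bound[where B = 1])
        (use measurable_compose[OF walk_measurable(2)[OF \<mu>(2)] iB] in \<open>auto simp: indicator_def\<close>)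
    finally show ?thesis by (simp add: P.prob_space)
  qed
  have shift: "(\<lambda>s n. s (n + k)) \<in> measurable ?E ?E"
    by (rule measurable_PiM_single') (auto simp: space_PiM)
  have mc: "(\<lambda>(\<omega>, \<omega>'). comb_seq k \<omega> \<omega>') \<in> measurable (S \<Otimes>\<^sub>M S) S" by (rule measurable_comb_seq)
  have "(\<integral>s. indicat_real B (\<lambda>n. s (n + k)) \<partial>RW x \<mu>) = (\<integral>z. G (z + x) \<partial>conv_power \<mu> k)" for x
  proof -
    have m1: "(\<lambda>X. indicat_real B (\<lambda>n. walk x X (n + k)) :: real) \<in> borel_measurable S"
      using measurable_compose[OF measurable_compose[OF walk_measurable(2)[OF \<mu>(2)] shift] iB] .
    have eq: "(\<lambda>n. walk x (comb_seq k \<omega> \<omega>') (n + k)) = walk (walk x \<omega> k) \<omega>'" for \<omega> \<omega>'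
      unfolding walk_def sum_comb_seq by (simp add: add.assoc)
    have "(\<integral>s. indicat_real B (\<lambda>n. s (n + k)) \<partial>RW x \<mu>) = (\<integral>X. indicat_real B (\<lambda>n. walk x X (n + k)) \<partial>S)"
      unfolding RW_eq
      by (rule integral_distr[OF walk_measurable(2)[OF \<mu>(2)] measurable_compose[OF shift iB]])
    also have "\<dots> = (\<integral>X. indicat_real B (\<lambda>n. walk x X (n + k)) \<partial>distr (S \<Otimes>\<^sub>M S) S (\<lambda>(\<omega>, \<omega>'). comb_seq k \<omega> \<omega>'))"
      by (simp only: PiM_comb_seq)
    also have "\<dots> = (\<integral>(\<omega>, \<omega>'). indicat_real B (walk (walk x \<omega> k) \<omega>') \<partial>(S \<Otimes>\<^sub>M S))"
      by (subst integral_distr[OF mc m1]) (simp add: split_beta' eq)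
    also have "\<dots> = (\<integral>\<omega>. G (walk x \<omega> k) \<partial>S)"
    proof -
      have m2: "(\<lambda>p. indicat_real B (\<lambda>n. walk x (comb_seq k (fst p) (snd p)) (n + k))) \<in> borel_measurable (S \<Otimes>\<^sub>M S)"
        using measurable_compose[OF mc m1] by (simp add: split_beta')
      have "integrable (S \<Otimes>\<^sub>M S) (\<lambda>(\<omega>, \<omega>'). indicat_real B (walk (walk x \<omega> k) \<omega>'))"
        using m2 unfolding eq by (intro SS.integrable_const_bound[where B = 1]) (auto simp: split_beta' indicator_def)
      from SS.integral_fst'[OF this] show ?thesis by (simp add: G_def)
    qed
    also have "\<dots> = (\<integral>z. G (z + x) \<partial>distr S borel (\<lambda>X. \<Sum>i<k. X i))"
      unfolding walk_def using Gm
      by (subst integral_distr[OF walk_measurable(3)[OF \<mu>(2)]]) (auto simp: add.commute)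
    finally show ?thesis unfolding distr_step_sum[OF \<mu>] .
  qed
  then show ?thesis using that Gm Gb by blast
qed

lemma RW_marginal:
  fixes \<mu> :: "'a::{polish_space,topological_ab_group_add} measure"
  assumes \<mu>: "prob_space \<mu>" "sets \<mu> = sets borel"
  shows "distr (RW x \<mu>) borel (\<lambda>s. s n) = shift x (conv_power \<mu> n)"
proof -
  have "distr (RW x \<mu>) borel (\<lambda>s. s n) = distr (\<Pi>\<^sub>M i\<in>(UNIV::nat set). \<mu>) borel (\<lambda>X. walk x X n)"
    unfolding RW_eq by (subst distr_distr[OF _ walk_measurable(2)[OF \<mu>(2)]]) (auto simp: comp_def)
  also have "\<dots> = shift x (distr (\<Pi>\<^sub>M i\<in>(UNIV::nat set). \<mu>) borel (\<lambda>X. \<Sum>i<n. X i))"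
    unfolding shift_def by (subst distr_distr[OF measurable_translate walk_measurable(3)[OF \<mu>(2)]]) (simp add: comp_def walk_def)
  finally show ?thesis unfolding distr_step_sum[OF \<mu>] .
qed

lemma prob_space_RW:
  assumes "prob_space \<mu>" "sets \<mu> = sets borel"
  shows "prob_space (RW x \<mu>)"
  unfolding RW_eq by (intro prob_space.prob_space_distr prob_space_PiM walk_measurable assms)

lemma sets_RW [simp]: "sets (RW x \<mu>) = sets (\<Pi>\<^sub>M i\<in>(UNIV::nat set). borel)"
  by (simp add: RW_def)

section \<open>The set of overlapping translations\<close>

definition overlap_set :: "'a::{polish_space,topological_ab_group_add} measure \<Rightarrow> 'a set" where
  "overlap_set \<mu> = {x. \<exists>n\<ge>1. overlaps (conv_power \<mu> n) (shift (- x) (conv_power \<mu> n))}"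

lemma nn_integral_mono_measure_le:
  assumes fin: "finite_measure \<nu>" and sets: "sets \<kappa> = sets \<nu>"
    and le: "\<And>B. B \<in> sets \<nu> \<Longrightarrow> emeasure \<kappa> B \<le> emeasure \<nu> B"
    and f: "f \<in> borel_measurable \<nu>"
  shows "(\<integral>\<^sup>+x. f x \<partial>\<kappa>) \<le> (\<integral>\<^sup>+x. f x \<partial>\<nu>)"
proof -
  obtain v :: "'a \<Rightarrow> real" where v: "v \<in> borel_measurable \<nu>" "\<And>x. 0 \<le> v x" "\<And>x. v x \<le> 1"
    "\<kappa> = density \<nu> (\<lambda>x. ennreal (v x))"
    by (rule bounded_density_exists[OF fin sets]; (rule that; assumption)?) (rule le)
  have "(\<integral>\<^sup>+x. f x \<partial>\<kappa>) = (\<integral>\<^sup>+x. ennreal (v x) * f x \<partial>\<nu>)"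
    unfolding v(4) using v(1) f by (intro nn_integral_density) auto
  also have "\<dots> \<le> (\<integral>\<^sup>+x. 1 * f x \<partial>\<nu>)"
    by (intro nn_integral_mono mult_right_mono) (use v(3) in \<open>simp_all add: ennreal_le_1\<close>)
  finally show ?thesis by simp
qed

lemma emeasure_conv_measurable:
  fixes \<nu> :: "'a::{polish_space,topological_ab_group_add} measure"
  assumes "finite_measure \<nu>" "sets \<nu> = sets borel" "B \<in> sets borel"
  shows "(\<lambda>x. \<integral>\<^sup>+y. indicator B (x + y) \<partial>\<nu>) \<in> borel_measurable borel"
    and "(\<lambda>y. indicator B (x + y) :: ennreal) \<in> borel_measurable borel"
proof -
  interpret finite_measure \<nu> by fact
  have iB: "(indicator B :: 'a \<Rightarrow> ennreal) \<in> borel_measurable borel" using assms(3) by simp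
  have "(\<lambda>(x, y). x + y) \<in> borel_measurable (borel \<Otimes>\<^sub>M \<nu>)" by (rule measurable_add_pair[OF refl assms(2)])
  from measurable_compose[OF this iB]
  show "(\<lambda>x. \<integral>\<^sup>+y. indicator B (x + y) \<partial>\<nu>) \<in> borel_measurable borel"
    by (intro borel_measurable_nn_integral) (simp add: split_beta')
  show "(\<lambda>y. indicator B (x + y) :: ennreal) \<in> borel_measurable borel"
    by (rule measurable_compose[OF measurable_translate iB])
qed

lemma shift_shift:
  fixes \<nu> :: "'a::{polish_space,topological_ab_group_add} measure"
  assumes "sets \<nu> = sets borel"
  shows "shift x (shift y \<nu>) = shift (x + y) \<nu>"
proof (rule measure_eqI)
  fix B assume "B \<in> sets (shift x (shift y \<nu>))"
  then have B: "B \<in> sets (borel :: 'a measure)" by simp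
  show "emeasure (shift x (shift y \<nu>)) B = emeasure (shift (x + y) \<nu>) B"
    using B sets_translate_vimage[OF B] assms by (simp add: emeasure_shift_vimage vimage_def add.assoc)
qed simp

text \<open>
  The convolution of minorants is a minorant of the convolution.
\<close>

lemma overlaps_conv:
  fixes \<nu> \<nu>' :: "'a::{polish_space,topological_ab_group_add} measure"
  assumes \<nu>: "prob_space \<nu>" "sets \<nu> = sets borel" and \<nu>': "prob_space \<nu>'" "sets \<nu>' = sets borel"
    and ov: "overlaps \<nu> (shift (- x) \<nu>)" "overlaps \<nu>' (shift (- y) \<nu>')"
  shows "overlaps (conv \<nu> \<nu>') (shift (- (x + y)) (conv \<nu> \<nu>'))"
proof -
  interpret \<nu>: prob_space \<nu> by fact
  interpret \<nu>': prob_space \<nu>' by fact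
  obtain \<kappa> where \<kappa>: "sets \<kappa> = sets borel" "emeasure \<kappa> UNIV \<noteq> 0"
    "\<And>B. B \<in> sets borel \<Longrightarrow> emeasure \<kappa> B \<le> emeasure \<nu> B"
    "\<And>B. B \<in> sets borel \<Longrightarrow> emeasure (shift x \<kappa>) B \<le> emeasure \<nu> B"
    by (rule overlaps_shift_obtain[OF \<nu>(2) ov(1)]; rule that; assumption)
  obtain \<kappa>' where \<kappa>': "sets \<kappa>' = sets borel" "emeasure \<kappa>' UNIV \<noteq> 0"
    "\<And>B. B \<in> sets borel \<Longrightarrow> emeasure \<kappa>' B \<le> emeasure \<nu>' B"
    "\<And>B. B \<in> sets borel \<Longrightarrow> emeasure (shift y \<kappa>') B \<le> emeasure \<nu>' B"
    by (rule overlaps_shift_obtain[OF \<nu>'(2) ov(2)]; rule that; assumption)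
  have sp: "space \<kappa> = UNIV" "space \<kappa>' = UNIV" "space \<nu> = UNIV" "space \<nu>' = UNIV"
    using \<kappa>(1) \<kappa>'(1) \<nu>(2) \<nu>'(2) by (auto dest: sets_eq_imp_space_eq)
  have sub: "finite_measure \<sigma>" if "sets \<sigma> = sets borel" "prob_space \<tau>" "sets \<tau> = sets borel"
    "\<And>B. B \<in> sets borel \<Longrightarrow> emeasure \<sigma> B \<le> emeasure \<tau> B" for \<sigma> \<tau> :: "'a measure"
  proof -
    have "emeasure \<sigma> UNIV \<le> emeasure \<tau> UNIV" by (rule that(4)) simp
    also have "\<dots> = 1" using prob_space.emeasure_space_1[OF that(2)] sets_eq_imp_space_eq[OF that(3)] by simp
    finally show ?thesis
      using sets_eq_imp_space_eq[OF that(1)] by (intro finite_measureI) (auto simp: top_unique)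
  qed
  have conv_le: "emeasure (conv \<sigma> \<sigma>') B \<le> emeasure (conv \<nu> \<nu>') B"
    if \<sigma>: "sets \<sigma> = sets borel" "\<And>B. B \<in> sets borel \<Longrightarrow> emeasure \<sigma> B \<le> emeasure \<nu> B"
      and \<sigma>': "sets \<sigma>' = sets borel" "\<And>B. B \<in> sets borel \<Longrightarrow> emeasure \<sigma>' B \<le> emeasure \<nu>' B"
      and B: "B \<in> sets borel" for \<sigma> \<sigma>' B
  proof -
    have f': "finite_measure \<sigma>'" by (rule sub[OF \<sigma>'(1) \<nu>' \<sigma>'(2)])
    have "emeasure (conv \<sigma> \<sigma>') B = (\<integral>\<^sup>+a. \<integral>\<^sup>+b. indicator B (a + b) \<partial>\<sigma>' \<partial>\<sigma>)"
      by (rule emeasure_conv[OF \<sigma>(1) \<sigma>'(1) f' B])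
    also have "\<dots> \<le> (\<integral>\<^sup>+a. \<integral>\<^sup>+b. indicator B (a + b) \<partial>\<nu>' \<partial>\<sigma>)"
    proof (rule nn_integral_mono)
      fix a
      show "(\<integral>\<^sup>+b. indicator B (a + b) \<partial>\<sigma>') \<le> (\<integral>\<^sup>+b. indicator B (a + b) \<partial>\<nu>')"
        by (rule nn_integral_mono_measure_le[OF \<nu>'.finite_measure_axioms])
          (use \<sigma>' \<nu>' emeasure_conv_measurable(2)[OF f' \<sigma>'(1) B, of a] in \<open>auto cong: measurable_cong_sets\<close>)
    qed
    also have "\<dots> \<le> (\<integral>\<^sup>+a. \<integral>\<^sup>+b. indicator B (a + b) \<partial>\<nu>' \<partial>\<nu>)"
      by (rule nn_integral_mono_measure_le[OF \<nu>.finite_measure_axioms])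
        (use \<sigma> \<nu> emeasure_conv_measurable(1)[OF \<nu>'.finite_measure_axioms \<nu>'(2) B] in \<open>auto cong: measurable_cong_sets\<close>)
    also have "\<dots> = emeasure (conv \<nu> \<nu>') B"
      by (rule emeasure_conv[OF \<nu>(2) \<nu>'(2) \<nu>'.finite_measure_axioms B, symmetric])
    finally show ?thesis .
  qed
  have f\<kappa>: "finite_measure \<kappa>'" by (rule sub[OF \<kappa>'(1) \<nu>' \<kappa>'(3)])
  have fs\<kappa>: "finite_measure (shift y \<kappa>')" by (rule sub[OF _ \<nu>' \<kappa>'(4)]) simp_all
  have shift_conv: "emeasure (shift (x + y) (conv \<kappa> \<kappa>')) B = emeasure (conv (shift x \<kappa>) (shift y \<kappa>')) B"
    if B: "B \<in> sets borel" for B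
  proof -
    have t: "(\<lambda>v. z + v) \<in> measurable \<kappa> borel" "(\<lambda>v. z + v) \<in> measurable \<kappa>' borel" for z
      using measurable_translate[of z] measurable_cong_sets[OF \<kappa>(1) refl] measurable_cong_sets[OF \<kappa>'(1) refl] by blast+
    have "emeasure (conv (shift x \<kappa>) (shift y \<kappa>')) B = (\<integral>\<^sup>+a. \<integral>\<^sup>+b. indicator B (a + b) \<partial>shift y \<kappa>' \<partial>shift x \<kappa>)"
      by (rule emeasure_conv[OF _ _ fs\<kappa> B]) simp_all
    also have "\<dots> = (\<integral>\<^sup>+a. \<integral>\<^sup>+b. indicator B (x + a + b) \<partial>shift y \<kappa>' \<partial>\<kappa>)"
      unfolding shift_def[of x]
      by (rule nn_integral_distr[OF t(1)])
        (use emeasure_conv_measurable(1)[OF fs\<kappa> sets_shift B] in simp)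
    also have "\<dots> = (\<integral>\<^sup>+a. \<integral>\<^sup>+b. indicator B (x + a + (y + b)) \<partial>\<kappa>' \<partial>\<kappa>)"
      unfolding shift_def[of y]
      by (intro nn_integral_cong nn_integral_distr[OF t(2)])
        (use emeasure_conv_measurable(2)[OF f\<kappa> \<kappa>'(1) B] in simp)
    also have "\<dots> = (\<integral>\<^sup>+a. \<integral>\<^sup>+b. indicator ((\<lambda>v. (x + y) + v) -` B) (a + b) \<partial>\<kappa>' \<partial>\<kappa>)"
      by (simp add: indicator_def ac_simps)
    also have "\<dots> = emeasure (conv \<kappa> \<kappa>') ((\<lambda>v. (x + y) + v) -` B)"
      by (rule emeasure_conv[OF \<kappa>(1) \<kappa>'(1) f\<kappa> sets_translate_vimage[OF B], symmetric])
    also have "\<dots> = emeasure (shift (x + y) (conv \<kappa> \<kappa>')) B"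
      by (rule emeasure_shift_vimage[OF sets_conv B, symmetric])
    finally show ?thesis by simp
  qed
  show ?thesis
  proof (rule overlaps_shiftI[where \<kappa> = "conv \<kappa> \<kappa>'"])
    have "emeasure (conv \<kappa> \<kappa>') UNIV = emeasure \<kappa>' UNIV * emeasure \<kappa> UNIV"
      using sp by (subst emeasure_conv[OF \<kappa>(1) \<kappa>'(1) f\<kappa>]) simp_all
    then show "emeasure (conv \<kappa> \<kappa>') UNIV \<noteq> 0" using \<kappa>(2) \<kappa>'(2) by simp
    show "emeasure (conv \<kappa> \<kappa>') B \<le> emeasure (conv \<nu> \<nu>') B" if "B \<in> sets borel" for B
      by (rule conv_le[OF \<kappa>(1,3) \<kappa>'(1,3) that])
    show "emeasure (shift (x + y) (conv \<kappa> \<kappa>')) B \<le> emeasure (conv \<nu> \<nu>') B" if "B \<in> sets borel" for B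
      unfolding shift_conv[OF that] by (rule conv_le[OF sets_shift \<kappa>(4) sets_shift \<kappa>'(4) that])
  qed simp_all
qed

lemma overlaps_shift_uminus:
  fixes \<nu> :: "'a::{polish_space,topological_ab_group_add} measure"
  assumes \<nu>: "sets \<nu> = sets borel" and ov: "overlaps \<nu> (shift (- x) \<nu>)"
  shows "overlaps \<nu> (shift x \<nu>)"
proof -
  obtain \<kappa> where \<kappa>: "sets \<kappa> = sets borel" "emeasure \<kappa> UNIV \<noteq> 0"
    "\<And>B. B \<in> sets borel \<Longrightarrow> emeasure \<kappa> B \<le> emeasure \<nu> B"
    "\<And>B. B \<in> sets borel \<Longrightarrow> emeasure (shift x \<kappa>) B \<le> emeasure \<nu> B"
    by (rule overlaps_shift_obtain[OF \<nu> ov]; rule that; assumption)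
  have id: "shift (- x) (shift x \<kappa>) = \<kappa>"
  proof (rule measure_eqI)
    fix B assume "B \<in> sets (shift (- x) (shift x \<kappa>))"
    then have B: "B \<in> sets (borel :: 'a measure)" by simp
    show "emeasure (shift (- x) (shift x \<kappa>)) B = emeasure \<kappa> B"
      unfolding shift_shift[OF \<kappa>(1)] emeasure_shift_vimage[OF \<kappa>(1) B] by (simp add: vimage_def)
  qed (simp add: \<kappa>(1))
  have "overlaps \<nu> (shift (- (- x)) \<nu>)"
  proof (rule overlaps_shiftI[OF \<nu>, where \<kappa> = "shift x \<kappa>"])
    show "emeasure (shift x \<kappa>) UNIV \<noteq> 0" using \<kappa>(2) by (simp add: emeasure_shift_vimage[OF \<kappa>(1)])
  qed (use \<kappa> in \<open>simp_all add: id\<close>)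
  then show ?thesis by simp
qed

lemma overlap_set_subgroup:
  fixes \<mu> :: "'a::{polish_space,topological_ab_group_add} measure"
  assumes \<mu>: "prob_space \<mu>" "sets \<mu> = sets borel"
  shows "is_subgroup (overlap_set \<mu>)"
  unfolding is_subgroup_def
proof (intro conjI ballI)
  have p: "prob_space (conv_power \<mu> n)" "sets (conv_power \<mu> n) = sets borel" for n
    by (simp_all add: prob_space_conv_power[OF \<mu>])
  have 0: "shift 0 (conv_power \<mu> 1) = conv_power \<mu> 1"
    by (rule measure_eqI) (simp_all add: emeasure_shift_vimage[OF p(2)] vimage_def del: conv_power.simps One_nat_def)
  have "emeasure (conv_power \<mu> 1) UNIV \<noteq> 0"
    using prob_space.emeasure_space_1[OF p(1)[of 1]] by (simp del: conv_power.simps One_nat_def)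
  then have "overlaps (conv_power \<mu> 1) (shift (- 0) (conv_power \<mu> 1))"
    by (intro overlaps_shiftI[where \<kappa> = "conv_power \<mu> 1"]) (simp_all add: 0 del: conv_power.simps One_nat_def)
  then show "0 \<in> overlap_set \<mu>" unfolding overlap_set_def by blast
  fix x assume x: "x \<in> overlap_set \<mu>"
  then obtain n where n: "n \<ge> 1" "overlaps (conv_power \<mu> n) (shift (- x) (conv_power \<mu> n))"
    unfolding overlap_set_def by blast
  show "- x \<in> overlap_set \<mu>"
    unfolding overlap_set_def using n(1) overlaps_shift_uminus[OF p(2) n(2)] by auto
  fix y assume "y \<in> overlap_set \<mu>"
  then obtain m where m: "m \<ge> 1" "overlaps (conv_power \<mu> m) (shift (- y) (conv_power \<mu> m))"
    unfolding overlap_set_def by blast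
  have "overlaps (conv_power \<mu> (n + m)) (shift (- (x + y)) (conv_power \<mu> (n + m)))"
    unfolding conv_power_add[OF \<mu>] by (rule overlaps_conv[OF p p n(2) m(2)])
  then show "x + y \<in> overlap_set \<mu>"
    unfolding overlap_set_def using n(1) by (auto intro!: exI[of _ "n + m"])
qed

section \<open>Overlap and mutual singularity\<close>

text \<open>
  On either side of a Hahn decomposition the smaller of the two measures, restricted to that
  side, is a common minorant.
\<close>

lemma not_overlaps_iff_singular:
  fixes \<nu>1 \<nu>2 :: "'a::topological_space measure"
  assumes fin: "finite_measure \<nu>1" "finite_measure \<nu>2" and sets: "sets \<nu>1 = sets borel" "sets \<nu>2 = sets borel"
  shows "\<not> overlaps \<nu>1 \<nu>2 \<longleftrightarrow> (\<exists>B\<in>sets borel. emeasure \<nu>1 B = 0 \<and> emeasure \<nu>2 (- B) = 0)"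
proof
  assume no: "\<not> overlaps \<nu>1 \<nu>2"
  obtain Y where Y: "Y \<in> sets borel"
    and le: "\<And>X. X \<in> sets borel \<Longrightarrow> X \<subseteq> Y \<Longrightarrow> emeasure \<nu>2 X \<le> emeasure \<nu>1 X"
    and ge: "\<And>X. X \<in> sets borel \<Longrightarrow> X \<inter> Y = {} \<Longrightarrow> emeasure \<nu>1 X \<le> emeasure \<nu>2 X"
    using finite_unsigned_Hahn_decomposition[OF fin] sets by metis
  have nY: "- Y \<in> sets borel" using Y by auto
  have zero: "emeasure \<sigma> Z = 0"
    if \<sigma>: "sets \<sigma> = sets borel" and Z: "Z \<in> sets borel"
      and l: "\<And>X. X \<in> sets borel \<Longrightarrow> X \<subseteq> Z \<Longrightarrow> emeasure \<sigma> X \<le> emeasure \<nu>1 X \<and> emeasure \<sigma> X \<le> emeasure \<nu>2 X" for \<sigma> Z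
  proof (rule ccontr)
    assume "emeasure \<sigma> Z \<noteq> 0"
    have r: "emeasure (density \<sigma> (indicator Z)) B = emeasure \<sigma> (B \<inter> Z)" if B: "B \<in> sets borel" for B
    proof -
      have "emeasure (density \<sigma> (indicator Z)) B = (\<integral>\<^sup>+x. indicator Z x * indicator B x \<partial>\<sigma>)"
        by (rule emeasure_density) (use B Z \<sigma> in auto)
      also have "\<dots> = (\<integral>\<^sup>+x. indicator (B \<inter> Z) x \<partial>\<sigma>)"
        by (rule nn_integral_cong) (simp split: split_indicator)
      also have "\<dots> = emeasure \<sigma> (B \<inter> Z)"
        by (rule nn_integral_indicator) (use B Z \<sigma> in auto)
      finally show ?thesis .
    qed
    have "overlaps \<nu>1 \<nu>2"
      unfolding overlaps_def
    proof (intro exI[of _ "density \<sigma> (indicator Z)"] conjI ballI)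
      show "emeasure (density \<sigma> (indicator Z)) UNIV \<noteq> 0" using r[of UNIV] \<open>emeasure \<sigma> Z \<noteq> 0\<close> by simp
      fix B :: "'a set" assume B: "B \<in> sets borel"
      have "emeasure \<nu>1 (B \<inter> Z) \<le> emeasure \<nu>1 B" "emeasure \<nu>2 (B \<inter> Z) \<le> emeasure \<nu>2 B"
        using B sets by (auto intro!: emeasure_mono)
      then show "emeasure (density \<sigma> (indicator Z)) B \<le> emeasure \<nu>1 B" "emeasure (density \<sigma> (indicator Z)) B \<le> emeasure \<nu>2 B"
        using l[of "B \<inter> Z"] B Z by (auto simp: r intro: order_trans)
    qed (simp add: \<sigma>)
    then show False using no by simp
  qed
  have "emeasure \<nu>2 Y = 0" by (rule zero[OF sets(2) Y]) (use le in auto)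
  moreover have "emeasure \<nu>1 (- Y) = 0" by (rule zero[OF sets(1) nY]) (use ge in auto)
  ultimately show "\<exists>B\<in>sets borel. emeasure \<nu>1 B = 0 \<and> emeasure \<nu>2 (- B) = 0"
    using nY by (intro bexI[of _ "- Y"]) auto
next
  assume "\<exists>B\<in>sets borel. emeasure \<nu>1 B = 0 \<and> emeasure \<nu>2 (- B) = 0"
  then obtain B where B: "B \<in> sets borel" "emeasure \<nu>1 B = 0" "emeasure \<nu>2 (- B) = 0" by blast
  show "\<not> overlaps \<nu>1 \<nu>2"
  proof
    assume "overlaps \<nu>1 \<nu>2"
    then obtain \<kappa> where \<kappa>: "sets \<kappa> = sets borel" "emeasure \<kappa> UNIV \<noteq> 0"
      "\<And>B. B \<in> sets borel \<Longrightarrow> emeasure \<kappa> B \<le> emeasure \<nu>1 B \<and> emeasure \<kappa> B \<le> emeasure \<nu>2 B"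
      unfolding overlaps_def by blast
    have nB: "- B \<in> sets borel" using B(1) by auto
    have "emeasure \<kappa> (B \<union> - B) \<le> emeasure \<kappa> B + emeasure \<kappa> (- B)"
      by (rule emeasure_subadditive) (use B(1) nB \<kappa>(1) in auto)
    also have "\<dots> = 0" using \<kappa>(3)[OF B(1)] \<kappa>(3)[OF nB] B(2,3) by simp
    finally show False using \<kappa>(2) by simp
  qed
qed

section \<open>Measurability of the overlap set\<close>

text \<open>
  If \<open>\<nu>\<close> and its translate are mutually singular, regularity separates them up to any error by an
  open set, and by compactness even by a finite union of sets from a countable basis.  So
  singularity is expressed by countably many conditions on the measures of translates of
  countably many open sets, and these depend measurably on the translation.
\<close>

lemma overlaps_shift_measurable:
  fixes \<nu> :: "'a::{polish_space,topological_ab_group_add} measure"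
  assumes \<nu>: "prob_space \<nu>" "sets \<nu> = sets borel"
  shows "{x. overlaps \<nu> (shift (- x) \<nu>)} \<in> sets borel"
proof -
  interpret \<nu>: prob_space \<nu> by fact
  have sp: "space \<nu> = UNIV" using sets_eq_imp_space_eq[OF \<nu>(2)] by simp
  obtain \<B> :: "'a set set" where \<B>: "countable \<B>" "topological_basis \<B>"
    using ex_countable_basis by blast
  define \<U> where "\<U> = Union ` {F. finite F \<and> F \<subseteq> \<B>}"
  have \<U>: "countable \<U>"
    unfolding \<U>_def using countable_Collect_finite_subset[OF \<B>(1)] by (intro countable_image) (simp add: conj_commute)
  have \<U>_open: "open U" if "U \<in> \<U>" for U
    using that topological_basis_open[OF \<B>(2)] unfolding \<U>_def by (auto intro!: open_Union)
  have fin_shift: "finite_measure (shift z \<nu>)" for z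
    unfolding shift_def using measurable_translate measurable_cong_sets[OF \<nu>(2) refl]
    by (intro \<nu>.finite_measure_distr) blast
  have compl: "measure \<nu> (- X) = 1 - measure \<nu> X" if "X \<in> sets borel" for X
    using \<nu>.prob_compl[of X] that \<nu>(2) by (simp add: sp Compl_eq_Diff_UNIV)
  \<comment> \<open>\<open>good x\<close> says that \<open>\<nu>\<close> and its translate by \<open>- x\<close> are mutually singular.\<close>
  define good where "good x \<longleftrightarrow> (\<forall>m::nat. \<exists>U\<in>\<U>. emeasure \<nu> (- U) < ennreal (inverse (Suc m)) \<and>
    emeasure \<nu> ((\<lambda>y. - x + y) -` U) < ennreal (inverse (Suc m)))" for x
  have "\<not> overlaps \<nu> (shift (- x) \<nu>) \<longleftrightarrow> good x" for x
  proof
    assume "\<not> overlaps \<nu> (shift (- x) \<nu>)"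
    then obtain B where B: "B \<in> sets borel" "emeasure \<nu> B = 0" "emeasure (shift (- x) \<nu>) (- B) = 0"
      unfolding not_overlaps_iff_singular[OF \<nu>.finite_measure_axioms fin_shift \<nu>(2) sets_shift] by blast
    have nB: "- B \<in> sets borel" using B(1) by auto
    show "good x"
      unfolding good_def
    proof
      fix m :: nat
      define r :: real where "r = inverse (real (Suc m))"
      have r: "0 < r" "r \<le> 1" by (simp_all add: r_def field_simps)
      define e where "e = ennreal r"
      have e: "0 < e" using r by (simp add: e_def)
      have "emeasure \<nu> (- B) = 1"
        using compl[OF B(1)] B(2) by (simp add: \<nu>.emeasure_eq_measure)
      then have "1 = (SUP K\<in>{K. K \<subseteq> - B \<and> compact K}. emeasure \<nu> K)"
        using inner_regular[OF \<nu>(2) _ nB] \<nu>.emeasure_space_1 by simp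
      moreover have "ennreal (1 - r) < ennreal 1"
        using r by (subst ennreal_less_iff) auto
      ultimately have "ennreal (1 - r) < (SUP K\<in>{K. K \<subseteq> - B \<and> compact K}. emeasure \<nu> K)"
        by simp
      then obtain K where K: "K \<subseteq> - B" "compact K" "ennreal (1 - r) < emeasure \<nu> K"
        unfolding less_SUP_iff by blast
      have Kb: "K \<in> sets borel" using K(2) by (simp add: borel_compact)
      have "1 - r < measure \<nu> K" using K(3) r by (simp add: \<nu>.emeasure_eq_measure ennreal_less_iff)
      then have K1: "emeasure \<nu> (- K) < e"
        unfolding e_def \<nu>.emeasure_eq_measure compl[OF Kb] using r \<nu>.prob_le_1[of K] by (subst ennreal_less_iff) auto
      have "emeasure (shift (- x) \<nu>) K \<le> emeasure (shift (- x) \<nu>) (- B)"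
        by (rule emeasure_mono) (use K nB in auto)
      then have "emeasure (shift (- x) \<nu>) K = 0" using B(3) by simp
      then have "(INF U\<in>{U. K \<subseteq> U \<and> open U}. emeasure (shift (- x) \<nu>) U) < e"
        using outer_regular[OF sets_shift _ Kb, of "- x" \<nu>] finite_measure.emeasure_finite[OF fin_shift] e by auto
      then obtain W where W: "K \<subseteq> W" "open W" "emeasure (shift (- x) \<nu>) W < e"
        by (auto simp: INF_less_iff)
      obtain \<F> where F: "\<F> \<subseteq> \<B>" "W = \<Union>\<F>"
        using \<B>(2) W(2) unfolding topological_basis_def by blast
      obtain F where F': "F \<subseteq> \<F>" "finite F" "K \<subseteq> \<Union>F"
        using compactE[OF K(2), of \<F>] W(1) F topological_basis_open[OF \<B>(2)] by blast
      show "\<exists>U\<in>\<U>. emeasure \<nu> (- U) < ennreal (inverse (Suc m)) \<and> emeasure \<nu> ((\<lambda>y. - x + y) -` U) < ennreal (inverse (Suc m))"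
      proof (rule bexI[of _ "\<Union>F"], intro conjI)
        show U: "\<Union>F \<in> \<U>" unfolding \<U>_def using F F' by blast
        from \<U>_open[OF U] have Ub: "\<Union>F \<in> sets borel" by (rule borel_open)
        have "emeasure \<nu> (- \<Union>F) \<le> emeasure \<nu> (- K)"
          by (rule emeasure_mono) (use F' Kb \<nu>(2) in auto)
        then show "emeasure \<nu> (- \<Union>F) < ennreal (inverse (Suc m))" using K1 unfolding e_def r_def by (rule le_less_trans)
        have "emeasure (shift (- x) \<nu>) (\<Union>F) \<le> emeasure (shift (- x) \<nu>) W"
          by (rule emeasure_mono) (use F F' W in auto)
        then show "emeasure \<nu> ((\<lambda>y. - x + y) -` \<Union>F) < ennreal (inverse (Suc m))"
          using W(3) unfolding e_def r_def emeasure_shift_vimage[OF \<nu>(2) Ub] by (rule le_less_trans)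
      qed
    qed
  next
    assume g: "good x"
    show "\<not> overlaps \<nu> (shift (- x) \<nu>)"
    proof
      assume "overlaps \<nu> (shift (- x) \<nu>)"
      then obtain \<kappa> where \<kappa>: "sets \<kappa> = sets borel" "emeasure \<kappa> UNIV \<noteq> 0"
        "\<And>B. B \<in> sets borel \<Longrightarrow> emeasure \<kappa> B \<le> emeasure \<nu> B \<and> emeasure \<kappa> B \<le> emeasure (shift (- x) \<nu>) B"
        unfolding overlaps_def by blast
      have le: "emeasure \<kappa> UNIV \<le> ennreal (2 * inverse (Suc m))" for m
      proof -
        obtain U where U: "U \<in> \<U>" "emeasure \<nu> (- U) < ennreal (inverse (Suc m))"
          "emeasure \<nu> ((\<lambda>y. - x + y) -` U) < ennreal (inverse (Suc m))"
          using g unfolding good_def by blast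
        have Ub: "U \<in> sets borel" "- U \<in> sets borel" using \<U>_open[OF U(1)] by auto
        have "emeasure \<kappa> (U \<union> - U) \<le> emeasure \<kappa> U + emeasure \<kappa> (- U)"
          by (rule emeasure_subadditive) (use Ub \<kappa>(1) in auto)
        also have "\<dots> \<le> ennreal (inverse (Suc m)) + ennreal (inverse (Suc m))"
        proof (rule add_mono)
          have "emeasure \<kappa> U \<le> emeasure \<nu> ((\<lambda>y. - x + y) -` U)"
            using \<kappa>(3)[OF Ub(1)] unfolding emeasure_shift_vimage[OF \<nu>(2) Ub(1)] by (rule conjunct2)
          then show "emeasure \<kappa> U \<le> ennreal (inverse (Suc m))"
            using U(3) by (rule less_imp_le[OF le_less_trans])
          show "emeasure \<kappa> (- U) \<le> ennreal (inverse (Suc m))"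
            using \<kappa>(3)[OF Ub(2), THEN conjunct1] U(2) by (rule less_imp_le[OF le_less_trans])
        qed
        also have "\<dots> = ennreal (2 * inverse (Suc m))"
          by (subst ennreal_plus[symmetric]) auto
        finally show ?thesis by simp
      qed
      have "emeasure \<kappa> UNIV \<le> 0"
      proof (rule tendsto_lowerbound[OF _ _ sequentially_bot])
        have "(\<lambda>m. 2 * inverse (real (Suc m))) \<longlonglongrightarrow> 2 * 0"
          by (intro tendsto_intros LIMSEQ_inverse_real_of_nat)
        then show "(\<lambda>m. ennreal (2 * inverse (Suc m))) \<longlonglongrightarrow> 0"
          using tendsto_ennrealI by fastforce
        show "\<forall>\<^sub>F m in sequentially. emeasure \<kappa> UNIV \<le> ennreal (2 * inverse (Suc m))"
          using le by simp
      qed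
      then show False using \<kappa>(2) by simp
    qed
  qed
  then have eq: "{x. overlaps \<nu> (shift (- x) \<nu>)} = {x. \<not> good x}" by blast
  have [measurable]: "(\<lambda>x. emeasure \<nu> ((\<lambda>y. - x + y) -` U)) \<in> borel_measurable borel" if U: "U \<in> \<U>" for U
  proof -
    have "U \<in> sets borel" using \<U>_open[OF U] by simp
    then have "(\<lambda>x. \<integral>\<^sup>+y. indicator U (x + y) \<partial>\<nu>) \<in> borel_measurable borel"
      by (rule emeasure_conv_measurable(1)[OF \<nu>.finite_measure_axioms \<nu>(2)])
    moreover have "(uminus :: 'a \<Rightarrow> 'a) \<in> borel_measurable borel"
      by (intro borel_measurable_continuous_onI continuous_intros)
    ultimately have "(\<lambda>x. \<integral>\<^sup>+y. indicator U (- x + y) \<partial>\<nu>) \<in> borel_measurable borel"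
      using measurable_compose by blast
    moreover have "(\<integral>\<^sup>+y. indicator U (- x + y) \<partial>\<nu>) = emeasure \<nu> ((\<lambda>y. - x + y) -` U)" for x
    proof -
      have "(\<integral>\<^sup>+y. indicator U (- x + y) \<partial>\<nu>) = (\<integral>\<^sup>+y. indicator ((\<lambda>y. - x + y) -` U) y \<partial>\<nu>)"
        by (simp add: indicator_def)
      also have "\<dots> = emeasure \<nu> ((\<lambda>y. - x + y) -` U)"
        by (rule nn_integral_indicator) (use sets_translate_vimage[OF \<open>U \<in> sets borel\<close>, of "- x"] \<nu>(2) in simp)
      finally show ?thesis .
    qed
    ultimately show ?thesis by simp
  qed
  have "{x\<in>space borel. good x} \<in> sets borel"
    unfolding good_def using \<U>
    by (intro sets.sets_Collect_countable_All sets.sets_Collect_countable_Bex sets.sets_Collect_conj) measurable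
  then have "{x. good x} \<in> sets borel" by simp
  then have "- {x. good x} \<in> sets borel" by auto
  then show ?thesis unfolding eq by (simp add: Collect_neg_eq)
qed

lemma overlap_set_measurable:
  fixes \<mu> :: "'a::{polish_space,topological_ab_group_add} measure"
  assumes \<mu>: "prob_space \<mu>" "sets \<mu> = sets borel"
  shows "overlap_set \<mu> \<in> sets borel"
proof -
  have "overlap_set \<mu> = (\<Union>n\<in>{1..}. {x. overlaps (conv_power \<mu> n) (shift (- x) (conv_power \<mu> n))})"
    unfolding overlap_set_def by auto
  also have "\<dots> \<in> sets borel"
    by (rule sets.countable_UN') (auto intro: overlaps_shift_measurable[OF prob_space_conv_power[OF \<mu>] sets_conv_power])
  finally show ?thesis .
qed

section \<open>Purely atomic step laws\<close>

primrec sums_of :: "'a::ab_group_add set \<Rightarrow> nat \<Rightarrow> 'a set" where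
  "sums_of A 0 = {0}"
| "sums_of A (Suc n) = (\<lambda>(x, a). x + a) ` (sums_of A n \<times> A)"

text \<open>
  \<open>\<mu>\<^sup>n\<close> lives on the countable set of sums of \<open>n\<close> atoms.  A minorant with a translate below \<open>\<mu>\<^sup>n\<close> has a
  point \<open>z\<close> for which \<open>z\<close> and \<open>x + z\<close> are such sums, and any two sums of \<open>n\<close> atoms differ by an element
  of the generated subgroup.  Conversely, for atoms \<open>a\<close> and \<open>a'\<close> a point mass at \<open>a'\<close> and its
  translate by \<open>a - a'\<close> fit below \<open>\<mu>\<close>.
\<close>

lemma overlap_set_purely_atomic:
  fixes \<mu> :: "'a::{polish_space,topological_ab_group_add} measure"
  assumes \<mu>: "prob_space \<mu>" "sets \<mu> = sets borel" and pa: "purely_atomic \<mu>"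
  shows "overlap_set \<mu> = group_closure {a - a' | a a'. a \<in> atoms \<mu> \<and> a' \<in> atoms \<mu>}"
proof -
  interpret \<mu>: prob_space \<mu> by fact
  define A where "A = atoms \<mu>"
  let ?D = "{a - a' | a a'. a \<in> A \<and> a' \<in> A}"
  have sp: "space \<mu> = UNIV" using sets_eq_imp_space_eq[OF \<mu>(2)] by simp
  have AE: "AE x in \<mu>. x \<in> A" using pa by (simp add: purely_atomic_def A_def)
  have "countable A"
    using \<mu>.countable_support unfolding A_def atoms_def
    by (simp add: \<mu>.emeasure_eq_measure zero_less_measure_iff)
  have pc: "prob_space (conv_power \<mu> n)" for n by (rule prob_space_conv_power[OF \<mu>])
  have C: "countable (sums_of A n)" for n
    by (induction n) (auto intro!: countable_image countable_SIGMA simp: \<open>countable A\<close>)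
  have borelC: "sums_of A n \<in> sets borel" for n
  proof -
    have "(\<Union>x\<in>sums_of A n. {x}) \<in> sets borel" using C by (intro sets.countable_UN') auto
    then show ?thesis by simp
  qed
  have supp: "emeasure (conv_power \<mu> n) (- sums_of A n) = 0" for n
  proof (induction n)
    case 0
    show ?case by simp
  next
    case (Suc n)
    have b: "- sums_of A n \<in> sets borel" "- sums_of A (Suc n) \<in> sets borel"
      using borelC[of n] borelC[of "Suc n"] by (auto simp del: sums_of.simps)
    have "AE x in conv_power \<mu> n. x \<in> sums_of A n"
      using Suc b by (intro AE_I[of _ _ "- sums_of A n"]) auto
    then have "AE x in conv_power \<mu> n. (\<integral>\<^sup>+y. indicator (- sums_of A (Suc n)) (x + y) \<partial>\<mu>) = 0"
    proof eventually_elim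
      case (elim x)
      have "AE y in \<mu>. indicator (- sums_of A (Suc n)) (x + y) = (0::ennreal)"
        using AE by eventually_elim (use elim in \<open>auto simp: indicator_def\<close>)
      then have "(\<integral>\<^sup>+y. indicator (- sums_of A (Suc n)) (x + y) \<partial>\<mu>) = (\<integral>\<^sup>+y. 0 \<partial>\<mu>)"
        by (rule nn_integral_cong_AE)
      then show ?case by simp
    qed
    then have "(\<integral>\<^sup>+x. \<integral>\<^sup>+y. indicator (- sums_of A (Suc n)) (x + y) \<partial>\<mu> \<partial>conv_power \<mu> n) = (\<integral>\<^sup>+x. 0 \<partial>conv_power \<mu> n)"
      by (rule nn_integral_cong_AE)
    then show ?case
      unfolding conv_power.simps emeasure_conv[OF sets_conv_power \<mu>(2) \<mu>.finite_measure_axioms b(2)] by simp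
  qed
  have "A \<noteq> {}"
  proof
    assume "A = {}"
    then have "AE x in \<mu>. False" using AE by simp
    then show False using \<mu>.AE_False by simp
  qed
  then obtain a0 where a0: "a0 \<in> A" by blast
  have coset: "x - (\<Sum>i<n. a0) \<in> group_closure ?D" if "x \<in> sums_of A n" for x n
    using that
  proof (induction n arbitrary: x)
    case (Suc n)
    then obtain y a where y: "y \<in> sums_of A n" "a \<in> A" "x = y + a" by auto
    have "a - a0 \<in> group_closure ?D" using y(2) a0 by (intro group_closure.base) blast
    from group_closure_add[OF Suc.IH[OF y(1)] this] show ?case by (simp add: y(3) algebra_simps)
  qed simp
  have sg: "is_subgroup (overlap_set \<mu>)" by (rule overlap_set_subgroup[OF \<mu>])
  show ?thesis
    unfolding A_def[symmetric]
  proof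
    show "overlap_set \<mu> \<subseteq> group_closure ?D"
    proof
      fix x assume "x \<in> overlap_set \<mu>"
      then obtain n where "overlaps (conv_power \<mu> n) (shift (- x) (conv_power \<mu> n))"
        unfolding overlap_set_def by blast
      then obtain \<kappa> where \<kappa>: "sets \<kappa> = sets borel" "emeasure \<kappa> UNIV \<noteq> 0"
        "\<And>B. B \<in> sets borel \<Longrightarrow> emeasure \<kappa> B \<le> emeasure (conv_power \<mu> n) B \<and> emeasure \<kappa> B \<le> emeasure (shift (- x) (conv_power \<mu> n)) B"
        unfolding overlaps_def by blast
      let ?N1 = "- sums_of A n" and ?N2 = "(\<lambda>y. x + y) -` (- sums_of A n)"
      have b: "?N1 \<in> sets borel" using borelC[of n] by auto
      have b2: "?N2 \<in> sets borel" by (rule sets_translate_vimage[OF b])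
      have "emeasure \<kappa> ?N1 = 0" using \<kappa>(3)[OF b] supp[of n] by simp
      moreover have "emeasure \<kappa> ?N2 = 0"
      proof -
        have "(\<lambda>y. - x + y) -` ?N2 = ?N1" by auto
        then have "emeasure (shift (- x) (conv_power \<mu> n)) ?N2 = 0"
          unfolding emeasure_shift_vimage[OF sets_conv_power b2] using supp[of n] by (simp only:)
        then show ?thesis using \<kappa>(3)[OF b2] by simp
      qed
      ultimately have "emeasure \<kappa> (?N1 \<union> ?N2) = 0"
        using emeasure_subadditive[of ?N1 \<kappa> ?N2] b b2 \<kappa>(1) by simp
      then have "?N1 \<union> ?N2 \<noteq> UNIV" using \<kappa>(2) by metis
      then obtain z where z: "z \<in> sums_of A n" "x + z \<in> sums_of A n" by blast
      from group_closure.diff[OF coset[OF z(2)] coset[OF z(1)]]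
      show "x \<in> group_closure ?D" by simp
    qed
    show "group_closure ?D \<subseteq> overlap_set \<mu>"
    proof
      fix x assume "x \<in> group_closure ?D"
      then show "x \<in> overlap_set \<mu>"
      proof induction
        case (base s)
        show ?case
        proof (cases "s = 0")
          case True
          then show ?thesis using sg by (simp add: is_subgroup_def)
        next
          case False
          then obtain a a' where a: "a \<in> A" "a' \<in> A" "s = a - a'" using base by blast
          define t where "t = min (emeasure \<mu> {a}) (emeasure \<mu> {a'})"
          have t: "t \<noteq> 0" using a by (auto simp: t_def A_def atoms_def min_def)
          have m1: "conv_power \<mu> 1 = \<mu>"
          proof (rule measure_eqI)
            fix B assume "B \<in> sets (conv_power \<mu> 1)"
            then have B: "B \<in> sets (borel :: 'a measure)" by simp
            have "emeasure (conv_power \<mu> 1) B = (\<integral>\<^sup>+x. \<integral>\<^sup>+y. indicator B (x + y) \<partial>\<mu> \<partial>return borel 0)"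
              using emeasure_conv[OF _ \<mu>(2) \<mu>.finite_measure_axioms B, of "return borel 0"] by simp
            also have "\<dots> = (\<integral>\<^sup>+y. indicator B (0 + y) \<partial>\<mu>)"
              by (rule nn_integral_return) (use emeasure_conv_measurable(1)[OF \<mu>.finite_measure_axioms \<mu>(2) B] in auto)
            finally show "emeasure (conv_power \<mu> 1) B = emeasure \<mu> B" using B \<mu>(2) by simp
          qed (simp add: \<mu>(2))
          let ?\<kappa> = "scale_measure t (return borel a')"
          have atom: "emeasure \<mu> {c} \<le> emeasure \<mu> B" if "c \<in> B" "B \<in> sets borel" for c B
            using that \<mu>(2) by (intro emeasure_mono) auto
          have "overlaps \<mu> (shift (- s) \<mu>)"
          proof (rule overlaps_shiftI[OF \<mu>(2), where \<kappa> = ?\<kappa>])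
            show "emeasure ?\<kappa> UNIV \<noteq> 0" using t by simp
            show "emeasure ?\<kappa> B \<le> emeasure \<mu> B" if B: "B \<in> sets borel" for B
              using atom[OF _ B, of a'] B by (auto simp: indicator_def t_def min_le_iff_disj)
            show "emeasure (shift s ?\<kappa>) B \<le> emeasure \<mu> B" if B: "B \<in> sets borel" for B
              using atom[OF _ B, of a] B a(3) sets_translate_vimage[OF B, of s]
              by (subst emeasure_shift_vimage) (auto simp: indicator_def t_def min_le_iff_disj)
          qed simp
          then show ?thesis unfolding overlap_set_def using m1 by (auto intro!: exI[of _ "1::nat"] simp del: conv_power.simps)
        qed
      next
        case (diff s t)
        have "s + - t \<in> overlap_set \<mu>" using sg diff.IH unfolding is_subgroup_def by blast
        then show ?case by simp
      qed
    qed
  qed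
qed

section \<open>Haar measure and spread-out step laws\<close>

lemma compact_vicinity_cover:
  assumes "locally_compact_space (euclidean :: 'a::polish_space topology)"
  obtains \<V> :: "'a::polish_space set set" where "countable \<V>" "\<Union>\<V> = UNIV" "\<And>V. V \<in> \<V> \<Longrightarrow> open V"
    "\<And>V. V \<in> \<V> \<Longrightarrow> \<exists>K. compact K \<and> V \<subseteq> K"
proof -
  define \<G> where "\<G> = {V :: 'a set. open V \<and> (\<exists>K. compact K \<and> V \<subseteq> K)}"
  have "\<exists>V\<in>\<G>. x \<in> V" for x
    using assms unfolding locally_compact_space_def \<G>_def by fastforce
  then have cover: "\<Union>\<G> = UNIV" by blast
  obtain \<V> where V: "\<V> \<subseteq> \<G>" "countable \<V>" "\<Union>\<V> = \<Union>\<G>"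
    using Lindelof[of \<G>] unfolding \<G>_def by blast
  show ?thesis
  proof (rule that[of \<V>])
    show "\<Union>\<V> = UNIV" using V(3) cover by simp
    fix V assume "V \<in> \<V>"
    then have "V \<in> \<G>" using V(1) by (rule subsetD[rotated])
    then show "open V" "\<exists>K. compact K \<and> V \<subseteq> K" by (simp_all add: \<G>_def)
  qed (rule V(2))
qed

context
  fixes \<eta> :: "'a::{polish_space,topological_ab_group_add} measure"
  assumes lc: "locally_compact_space (euclidean :: 'a topology)"
    and haar: "haar_measure \<eta>"
begin

lemma haar_sets: "sets \<eta> = sets borel"
  using haar by (simp add: haar_measure_def)

lemma haar_space: "space \<eta> = UNIV"
  using sets_eq_imp_space_eq[OF haar_sets] by simp

lemma haar_compact: "compact K \<Longrightarrow> emeasure \<eta> K < \<infinity>"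
  using haar by (simp add: haar_measure_def)

lemma haar_translate_vimage:
  assumes "B \<in> sets borel"
  shows "emeasure \<eta> ((\<lambda>y. x + y) -` B) = emeasure \<eta> B"
proof -
  have "(\<lambda>y. x + y) -` B = (\<lambda>y. - x + y) ` B"
  proof (intro equalityI subsetI)
    fix y assume "y \<in> (\<lambda>y. x + y) -` B"
    then show "y \<in> (\<lambda>y. - x + y) ` B" by (intro image_eqI[of _ _ "x + y"]) auto
  qed auto
  moreover have "emeasure \<eta> ((\<lambda>y. - x + y) ` B) = emeasure \<eta> B"
    using haar assms unfolding haar_measure_def by blast
  ultimately show ?thesis by (simp only:)
qed

lemma haar_finite_cover:
  obtains \<V> :: "'a set set" where "countable \<V>" "\<Union>\<V> = UNIV" "\<And>V. V \<in> \<V> \<Longrightarrow> open V"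
    "\<And>V. V \<in> \<V> \<Longrightarrow> emeasure \<eta> V < \<infinity>"
proof -
  obtain \<V> :: "'a set set" where \<V>: "countable \<V>" "\<Union>\<V> = UNIV" "\<And>V. V \<in> \<V> \<Longrightarrow> open V"
    "\<And>V. V \<in> \<V> \<Longrightarrow> \<exists>K. compact K \<and> V \<subseteq> K"
    by (rule compact_vicinity_cover[OF lc]; rule that; assumption)
  have "emeasure \<eta> V < \<infinity>" if mem: "V \<in> \<V>" for V
  proof -
    obtain K where K: "compact K" "V \<subseteq> K" using \<V>(4)[OF mem] by blast
    have "emeasure \<eta> V \<le> emeasure \<eta> K"
      by (rule emeasure_mono) (use K in \<open>auto simp: haar_sets borel_compact\<close>)
    then show ?thesis using haar_compact[OF K(1)] by (rule le_less_trans)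
  qed
  with \<V>(1-3) show ?thesis by (rule that)
qed

lemma haar_sigma_finite: "sigma_finite_measure \<eta>"
proof -
  obtain \<V> :: "'a set set" where \<V>: "countable \<V>" "\<Union>\<V> = UNIV" "\<And>V. V \<in> \<V> \<Longrightarrow> open V"
    "\<And>V. V \<in> \<V> \<Longrightarrow> emeasure \<eta> V < \<infinity>"
    by (rule haar_finite_cover; rule that; assumption)
  show ?thesis
    by unfold_locales (use \<V> in \<open>auto intro!: exI[of _ \<V>] simp: haar_sets haar_space less_top\<close>)
qed

text \<open>
  The dichotomy behind Lebesgue's decomposition.  If \<open>\<nu>\<close> dominates no positive multiple of \<open>\<eta>\<close> on a
  set of positive measure, then on a set \<open>V\<close> of finite measure the Hahn sets for \<open>\<nu>\<close> and \<open>c * \<eta>\<close> are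
  null sets of \<open>\<eta>\<close>, while \<open>\<nu>\<close> has at most mass \<open>c * \<eta> V\<close> on the rest of \<open>V\<close>.  Let \<open>c\<close> tend to zero.
\<close>

lemma singular_or_minorized:
  assumes \<nu>: "finite_measure \<nu>" "sets \<nu> = sets borel"
  shows "(\<exists>N\<in>sets borel. emeasure \<eta> N = 0 \<and> emeasure \<nu> (- N) = 0) \<or>
    (\<exists>Y\<in>sets borel. \<exists>c>0. emeasure \<eta> Y \<noteq> 0 \<and>
      (\<forall>B\<in>sets borel. ennreal c * emeasure \<eta> (B \<inter> Y) \<le> emeasure \<nu> B))"
proof (rule disjCI)
  assume no: "\<not> (\<exists>Y\<in>sets borel. \<exists>c>0. emeasure \<eta> Y \<noteq> 0 \<and>
      (\<forall>B\<in>sets borel. ennreal c * emeasure \<eta> (B \<inter> Y) \<le> emeasure \<nu> B))"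
  interpret \<nu>: finite_measure \<nu> by fact
  obtain \<V> :: "'a set set" where \<V>: "countable \<V>" "\<Union>\<V> = UNIV" "\<And>V. V \<in> \<V> \<Longrightarrow> open V"
    "\<And>V. V \<in> \<V> \<Longrightarrow> emeasure \<eta> V < \<infinity>"
    by (rule haar_finite_cover; rule that; assumption)
  have "\<exists>N\<in>sets borel. emeasure \<eta> N = 0 \<and> emeasure \<nu> (V - N) = 0" if V: "V \<in> \<V>" for V
  proof -
    have Vb: "V \<in> sets borel" using \<V>(3)[OF V] by simp
    define c where "c m = inverse (real (Suc m))" for m
    have c: "c m > 0" for m by (simp add: c_def)
    have "\<exists>Y\<in>sets borel. Y \<subseteq> V \<and> emeasure \<eta> Y = 0 \<and> emeasure \<nu> (V - Y) \<le> ennreal (c m) * emeasure \<eta> V" for m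
    proof -
      let ?S = "scale_measure (ennreal (c m)) \<eta>"
      have "emeasure ?S V \<noteq> top"
        using \<V>(4)[OF V] by (simp add: ennreal_mult_eq_top_iff)
      then obtain Y where Y: "Y \<in> sets borel" "Y \<subseteq> V"
        and le: "\<And>X. X \<in> sets borel \<Longrightarrow> X \<subseteq> Y \<Longrightarrow> emeasure ?S X \<le> emeasure \<nu> X"
        and ge: "\<And>X. X \<in> sets borel \<Longrightarrow> X \<subseteq> V \<Longrightarrow> X \<inter> Y = {} \<Longrightarrow> emeasure \<nu> X \<le> emeasure ?S X"
        using unsigned_Hahn_decomposition[of ?S \<nu> V] Vb \<nu>(2) haar_sets by auto
      have "ennreal (c m) * emeasure \<eta> (B \<inter> Y) \<le> emeasure \<nu> B" if B: "B \<in> sets borel" for B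
      proof -
        have "ennreal (c m) * emeasure \<eta> (B \<inter> Y) \<le> emeasure \<nu> (B \<inter> Y)"
          using le[of "B \<inter> Y"] B Y by simp
        also have "\<dots> \<le> emeasure \<nu> B" by (rule emeasure_mono) (use B \<nu>(2) in auto)
        finally show ?thesis .
      qed
      then have "emeasure \<eta> Y = 0" using no Y(1) c[of m] by blast
      moreover have "emeasure \<nu> (V - Y) \<le> ennreal (c m) * emeasure \<eta> V"
      proof -
        have "emeasure \<nu> (V - Y) \<le> ennreal (c m) * emeasure \<eta> (V - Y)"
          using ge[of "V - Y"] Vb Y by auto
        also have "\<dots> \<le> ennreal (c m) * emeasure \<eta> V"
          by (intro mult_left_mono emeasure_mono) (use Vb haar_sets in auto)
        finally show ?thesis .
      qed
      ultimately show ?thesis using Y by blast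
    qed
    then obtain Y where Y: "\<And>m. Y m \<in> sets borel" "\<And>m. emeasure \<eta> (Y m) = 0"
      "\<And>m. emeasure \<nu> (V - Y m) \<le> ennreal (c m) * emeasure \<eta> V" by metis
    have N: "(\<Union>m. Y m) \<in> sets borel" using Y(1) by auto
    have "emeasure \<eta> (\<Union>m. Y m) = 0"
      by (rule emeasure_UN_eq_0) (use Y haar_sets in auto)
    moreover have "emeasure \<nu> (V - (\<Union>m. Y m)) = 0"
    proof -
      obtain a where a: "emeasure \<eta> V = ennreal a" "0 \<le> a"
        using \<V>(4)[OF V] by (cases "emeasure \<eta> V") auto
      have le: "emeasure \<nu> (V - (\<Union>m. Y m)) \<le> ennreal (c m * a)" for m
      proof -
        have "emeasure \<nu> (V - (\<Union>m. Y m)) \<le> emeasure \<nu> (V - Y m)"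
          by (rule emeasure_mono) (use Vb Y \<nu>(2) in auto)
        also have "\<dots> \<le> ennreal (c m) * ennreal a" using Y(3)[of m] a by simp
        finally show ?thesis using a c[of m] by (simp add: ennreal_mult)
      qed
      have "(\<lambda>m. c m * a) \<longlonglongrightarrow> 0 * a"
        unfolding c_def by (intro tendsto_intros LIMSEQ_inverse_real_of_nat)
      then have "(\<lambda>m. ennreal (c m * a)) \<longlonglongrightarrow> ennreal 0" by (intro tendsto_ennrealI) simp
      then have "emeasure \<nu> (V - (\<Union>m. Y m)) \<le> ennreal 0"
        by (rule tendsto_lowerbound) (use le in auto)
      then show ?thesis by simp
    qed
    ultimately show ?thesis using N by blast
  qed
  then obtain N where N: "\<And>V. V \<in> \<V> \<Longrightarrow> N V \<in> sets borel" "\<And>V. V \<in> \<V> \<Longrightarrow> emeasure \<eta> (N V) = 0"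
    "\<And>V. V \<in> \<V> \<Longrightarrow> emeasure \<nu> (V - N V) = 0" by metis
  have Nb: "(\<Union>V\<in>\<V>. N V) \<in> sets borel" by (rule sets.countable_UN'[OF \<V>(1)]) (use N in auto)
  define Z where "Z = (\<Union>V\<in>\<V>. N V)"
  have "Z \<in> null_sets \<eta>"
    unfolding Z_def by (rule null_sets_UN'[OF \<V>(1)]) (use N haar_sets in auto)
  then have Z: "emeasure \<eta> Z = 0" by (rule null_setsD1)
  have "(\<Union>V\<in>\<V>. V - N V) \<in> null_sets \<nu>"
    by (rule null_sets_UN'[OF \<V>(1)]) (use N \<V> \<nu>(2) in auto)
  moreover have "- Z \<in> sets \<nu>" unfolding Z_def \<nu>(2) by (rule borel_comp[OF Nb])
  moreover have "- Z \<subseteq> (\<Union>V\<in>\<V>. V - N V)"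
    using \<V>(2) by (auto simp: Z_def)
  ultimately have "- Z \<in> null_sets \<nu>" by (rule null_sets_subset)
  then have "emeasure \<nu> (- Z) = 0" by (rule null_setsD1)
  with Z Nb show "\<exists>N\<in>sets borel. emeasure \<eta> N = 0 \<and> emeasure \<nu> (- N) = 0"
    unfolding Z_def by blast
qed

text \<open>
  The density can be taken to be a multiple of an indicator function.
\<close>

lemma spread_out_iff_minorized:
  "spread_out \<eta> \<mu> \<longleftrightarrow> (\<exists>n\<ge>1. \<exists>Y\<in>sets borel. \<exists>c>0. emeasure \<eta> Y \<noteq> 0 \<and>
      (\<forall>B\<in>sets borel. ennreal c * emeasure \<eta> (B \<inter> Y) \<le> emeasure (conv_power \<mu> n) B))"
proof
  assume "spread_out \<eta> \<mu>"
  then obtain n and f :: "'a \<Rightarrow> real" where n: "n \<ge> 1" and f: "f \<in> borel_measurable borel" "\<And>x. f x \<ge> 0" "\<not> (AE x in \<eta>. f x = 0)"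
    "\<And>B. B \<in> sets borel \<Longrightarrow> (\<integral>\<^sup>+x\<in>B. ennreal (f x) \<partial>\<eta>) \<le> emeasure (conv_power \<mu> n) B"
    unfolding spread_out_def by blast
  define Y where "Y m = {x. inverse (real (Suc m)) < f x}" for m
  have Yb: "Y m \<in> sets borel" for m
    using measurable_sets[OF f(1), of "{inverse (real (Suc m))<..}"] by (simp add: Y_def vimage_def)
  have "\<exists>m. emeasure \<eta> (Y m) \<noteq> 0"
  proof (rule ccontr)
    assume "\<not> (\<exists>m. emeasure \<eta> (Y m) \<noteq> 0)"
    then have "(\<Union>m. Y m) \<in> null_sets \<eta>" using Yb haar_sets by (intro null_sets_UN) auto
    then have "AE x in \<eta>. x \<notin> (\<Union>m. Y m)" by (rule AE_not_in)
    then have "AE x in \<eta>. f x = 0"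
    proof eventually_elim
      case (elim x)
      show ?case
      proof (rule ccontr)
        assume "f x \<noteq> 0"
        then obtain m where "inverse (real (Suc m)) < f x"
          using f(2)[of x] reals_Archimedean[of "f x"] by auto
        then show False using elim by (auto simp: Y_def)
      qed
    qed
    then show False using f(3) by simp
  qed
  then obtain m where m: "emeasure \<eta> (Y m) \<noteq> 0" by blast
  have "ennreal (inverse (real (Suc m))) * emeasure \<eta> (B \<inter> Y m) \<le> emeasure (conv_power \<mu> n) B"
    if B: "B \<in> sets borel" for B
  proof -
    have "ennreal (inverse (real (Suc m))) * emeasure \<eta> (B \<inter> Y m)
       = (\<integral>\<^sup>+x. ennreal (inverse (real (Suc m))) * indicator (B \<inter> Y m) x \<partial>\<eta>)"
      by (rule nn_integral_cmult_indicator[symmetric]) (use B Yb haar_sets in auto)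
    also have "\<dots> \<le> (\<integral>\<^sup>+x\<in>B. ennreal (f x) \<partial>\<eta>)"
      by (intro nn_integral_mono) (auto simp: indicator_def Y_def intro!: ennreal_leI)
    also have "\<dots> \<le> emeasure (conv_power \<mu> n) B" by (rule f(4)[OF B])
    finally show ?thesis .
  qed
  then show "\<exists>n\<ge>1. \<exists>Y\<in>sets borel. \<exists>c>0. emeasure \<eta> Y \<noteq> 0 \<and>
      (\<forall>B\<in>sets borel. ennreal c * emeasure \<eta> (B \<inter> Y) \<le> emeasure (conv_power \<mu> n) B)"
    using n m Yb by (intro exI[of _ n] conjI bexI[of _ "Y m"] exI[of _ "inverse (real (Suc m))"] ballI) auto
next
  assume "\<exists>n\<ge>1. \<exists>Y\<in>sets borel. \<exists>c>0. emeasure \<eta> Y \<noteq> 0 \<and>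
      (\<forall>B\<in>sets borel. ennreal c * emeasure \<eta> (B \<inter> Y) \<le> emeasure (conv_power \<mu> n) B)"
  then obtain n Y and c :: real where n: "n \<ge> 1" and Y: "Y \<in> sets borel" "emeasure \<eta> Y \<noteq> 0" and c: "c > 0"
    "\<And>B. B \<in> sets borel \<Longrightarrow> ennreal c * emeasure \<eta> (B \<inter> Y) \<le> emeasure (conv_power \<mu> n) B" by blast
  show "spread_out \<eta> \<mu>"
    unfolding spread_out_def
  proof (intro exI[of _ n] conjI n exI[of _ "\<lambda>x. c * indicator Y x"] allI ballI)
    show "(\<lambda>x. c * indicator Y x) \<in> borel_measurable borel" using Y(1) by simp
    show "0 \<le> c * indicator Y x" for x using c(1) by simp
    show "\<not> (AE x in \<eta>. c * indicator Y x = 0)"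
    proof
      assume "AE x in \<eta>. c * indicator Y x = 0"
      then have "AE x in \<eta>. x \<notin> Y" by eventually_elim (use c(1) in \<open>auto simp: indicator_def split: if_splits\<close>)
      then have "Y \<in> null_sets \<eta>" using Y(1) haar_sets by (subst (asm) AE_iff_null_sets[symmetric]) auto
      then show False using Y(2) by auto
    qed
    fix B :: "'a set" assume B: "B \<in> sets borel"
    have "(\<integral>\<^sup>+x\<in>B. ennreal (c * indicator Y x) \<partial>\<eta>) = (\<integral>\<^sup>+x. ennreal c * indicator (B \<inter> Y) x \<partial>\<eta>)"
      by (intro nn_integral_cong) (auto simp: indicator_def)
    also have "\<dots> = ennreal c * emeasure \<eta> (B \<inter> Y)"
      by (rule nn_integral_cmult_indicator) (use B Y haar_sets in auto)
    finally show "(\<integral>\<^sup>+x\<in>B. ennreal (c * indicator Y x) \<partial>\<eta>) \<le> emeasure (conv_power \<mu> n) B"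
      using c(2)[OF B] by simp
  qed
qed

text \<open>
  If \<open>\<mu>\<close> is not spread out, every \<open>\<mu>\<^sup>n\<close> is concentrated on a set \<open>N\<close> of Haar measure zero.  By
  Fubini and invariance, almost every translate of \<open>\<mu>\<^sup>n\<close> gives no mass to \<open>N\<close> and is therefore
  singular to \<open>\<mu>\<^sup>n\<close>.  So almost no translation is an overlap.
\<close>

lemma spread_out_if_overlap_set_UNIV:
  assumes \<mu>: "prob_space \<mu>" "sets \<mu> = sets borel" and UNIV: "overlap_set \<mu> = UNIV"
  shows "spread_out \<eta> \<mu>"
proof (rule ccontr)
  assume no: "\<not> spread_out \<eta> \<mu>"
  interpret \<eta>: sigma_finite_measure \<eta> by (rule haar_sigma_finite)
  have "AE x in \<eta>. \<not> overlaps (conv_power \<mu> n) (shift x (conv_power \<mu> n))" if n: "n \<ge> 1" for n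
  proof -
    let ?\<nu> = "conv_power \<mu> n"
    interpret \<nu>: prob_space ?\<nu> by (rule prob_space_conv_power[OF \<mu>])
    obtain N where N: "N \<in> sets borel" "emeasure \<eta> N = 0" "emeasure ?\<nu> (- N) = 0"
      using singular_or_minorized[OF \<nu>.finite_measure_axioms sets_conv_power] no n
      unfolding spread_out_iff_minorized by blast
    interpret P: pair_sigma_finite \<eta> ?\<nu> ..
    have m: "(\<lambda>(x, y). x + y) \<in> borel_measurable (\<eta> \<Otimes>\<^sub>M ?\<nu>)"
      by (rule measurable_add_pair[OF haar_sets sets_conv_power])
    have iN: "(indicator N :: 'a \<Rightarrow> ennreal) \<in> borel_measurable borel" using N(1) by simp
    have m2: "(\<lambda>(x, y). indicator N (x + y) :: ennreal) \<in> borel_measurable (\<eta> \<Otimes>\<^sub>M ?\<nu>)"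
      using measurable_compose[OF m iN] by (simp add: split_beta')
    have vN: "(\<integral>\<^sup>+y. indicator N (x + y) \<partial>?\<nu>) = emeasure (shift x ?\<nu>) N" for x
    proof -
      have "(\<integral>\<^sup>+y. indicator N (x + y) \<partial>?\<nu>) = (\<integral>\<^sup>+y. indicator ((\<lambda>y. x + y) -` N) y \<partial>?\<nu>)"
        by (simp add: indicator_def)
      also have "\<dots> = emeasure ?\<nu> ((\<lambda>y. x + y) -` N)"
        by (rule nn_integral_indicator) (simp add: sets_translate_vimage[OF N(1)])
      finally show ?thesis by (simp add: emeasure_shift_vimage[OF sets_conv_power N(1)])
    qed
    have "(\<integral>\<^sup>+x. emeasure (shift x ?\<nu>) N \<partial>\<eta>) = (\<integral>\<^sup>+x. \<integral>\<^sup>+y. indicator N (x + y) \<partial>?\<nu> \<partial>\<eta>)"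
      by (simp add: vN)
    also have "\<dots> = (\<integral>\<^sup>+y. \<integral>\<^sup>+x. indicator N (x + y) \<partial>\<eta> \<partial>?\<nu>)"
      using P.Fubini'[OF m2] by simp
    also have "\<dots> = (\<integral>\<^sup>+y. 0 \<partial>?\<nu>)"
    proof (rule nn_integral_cong)
      fix y
      have "(\<integral>\<^sup>+x. indicator N (x + y) \<partial>\<eta>) = (\<integral>\<^sup>+x. indicator ((\<lambda>x. y + x) -` N) x \<partial>\<eta>)"
        by (simp add: indicator_def add.commute)
      also have "\<dots> = emeasure \<eta> ((\<lambda>x. y + x) -` N)"
        by (rule nn_integral_indicator) (simp add: haar_sets sets_translate_vimage[OF N(1)])
      finally show "(\<integral>\<^sup>+x. indicator N (x + y) \<partial>\<eta>) = 0"
        using N(2) by (simp add: haar_translate_vimage[OF N(1)])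
    qed
    finally have int0: "(\<integral>\<^sup>+x. emeasure (shift x ?\<nu>) N \<partial>\<eta>) = 0" by simp
    have "(\<lambda>x. emeasure (shift x ?\<nu>) N) \<in> borel_measurable \<eta>"
      using emeasure_conv_measurable(1)[OF \<nu>.finite_measure_axioms sets_conv_power N(1)]
      unfolding vN measurable_cong_sets[OF haar_sets refl] .
    then have "AE x in \<eta>. emeasure (shift x ?\<nu>) N = 0"
      using int0 by (subst (asm) nn_integral_0_iff_AE) auto
    then show ?thesis
    proof eventually_elim
      case (elim x)
      have t: "(\<lambda>v. x + v) \<in> measurable ?\<nu> borel"
        using measurable_translate by (simp cong: measurable_cong_sets)
      have "finite_measure (shift x ?\<nu>)" unfolding shift_def by (rule \<nu>.finite_measure_distr[OF t])
      moreover have "- N \<in> sets borel" using N(1) by auto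
      ultimately show ?case
        using not_overlaps_iff_singular[OF \<nu>.finite_measure_axioms _ sets_conv_power sets_shift] N elim
        by (metis double_complement)
    qed
  qed
  then have none: "AE x in \<eta>. \<forall>n\<in>{1..}. \<not> overlaps (conv_power \<mu> n) (shift x (conv_power \<mu> n))"
    by (subst AE_ball_countable) auto
  have ex: "\<exists>n\<in>{1..}. overlaps (conv_power \<mu> n) (shift x (conv_power \<mu> n))" for x
  proof -
    have "- x \<in> overlap_set \<mu>" using UNIV by simp
    then show ?thesis unfolding overlap_set_def by auto
  qed
  from none have "AE x in \<eta>. False" by eventually_elim (use ex in blast)
  then have "UNIV \<in> null_sets \<eta>"
    using AE_iff_null_sets[of UNIV \<eta>] haar_sets by simp
  then have "emeasure \<eta> B = 0" if "B \<in> sets borel" for B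
    using null_sets_subset[of UNIV \<eta> B] that haar_sets by auto
  then have "\<eta> = null_measure borel" by (intro measure_eqI) (simp_all add: haar_sets)
  then show False using haar by (simp add: haar_measure_def)
qed

text \<open>
  A Steinhaus argument.  Let \<open>\<mu>\<^sup>n\<close> dominate a multiple of \<open>\<eta>\<close> on a compact set \<open>K\<close> of positive measure.
  For small \<open>x\<close> the translate of \<open>K\<close> by \<open>x\<close> stays in a neighbourhood of \<open>K\<close> with less than twice its
  measure, so it meets \<open>K\<close> in positive measure, and \<open>\<eta>\<close> on the intersection provides an overlap.
  Hence the subgroup of overlaps is open; open subgroups are closed.
\<close>

lemma overlap_set_UNIV_if_spread_out:
  assumes \<mu>: "prob_space \<mu>" "sets \<mu> = sets borel"
    and conn: "connected (UNIV :: 'a set)" and so: "spread_out \<eta> \<mu>"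
  shows "overlap_set \<mu> = UNIV"
proof -
  obtain n Y and c :: real where n: "n \<ge> 1" and Y: "Y \<in> sets borel" "emeasure \<eta> Y \<noteq> 0" and c: "c > 0"
    "\<And>B. B \<in> sets borel \<Longrightarrow> ennreal c * emeasure \<eta> (B \<inter> Y) \<le> emeasure (conv_power \<mu> n) B"
    using so unfolding spread_out_iff_minorized by blast
  obtain \<V> :: "'a set set" where \<V>: "countable \<V>" "\<Union>\<V> = UNIV" "\<And>V. V \<in> \<V> \<Longrightarrow> open V"
    "\<And>V. V \<in> \<V> \<Longrightarrow> emeasure \<eta> V < \<infinity>"
    by (rule haar_finite_cover; rule that; assumption)
  \<comment> \<open>Regularity theorems are for finite measures, so \<open>\<eta>\<close> is restricted to sets of finite measure.\<close>
  define res where "res V = density \<eta> (indicator V)" for V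
  have res: "sets (res V) = sets borel" "space (res V) = UNIV" for V
    by (simp_all add: res_def haar_sets haar_space)
  have eres: "emeasure (res V) B = emeasure \<eta> (B \<inter> V)" if "V \<in> sets borel" "B \<in> sets borel" for V B
  proof -
    have "emeasure (res V) B = (\<integral>\<^sup>+x. indicator V x * indicator B x \<partial>\<eta>)"
      unfolding res_def by (rule emeasure_density) (use that haar_sets in auto)
    also have "\<dots> = (\<integral>\<^sup>+x. indicator (B \<inter> V) x \<partial>\<eta>)"
      by (rule nn_integral_cong) (simp split: split_indicator)
    also have "\<dots> = emeasure \<eta> (B \<inter> V)"
      by (rule nn_integral_indicator) (use that haar_sets in auto)
    finally show ?thesis .
  qed
  have "\<exists>V\<in>\<V>. emeasure \<eta> (Y \<inter> V) \<noteq> 0"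
  proof (rule ccontr)
    assume "\<not> (\<exists>V\<in>\<V>. emeasure \<eta> (Y \<inter> V) \<noteq> 0)"
    then have "(\<Union>V\<in>\<V>. Y \<inter> V) \<in> null_sets \<eta>"
      by (intro null_sets_UN'[OF \<V>(1)]) (use \<V>(3) Y(1) haar_sets in auto)
    moreover have "(\<Union>V\<in>\<V>. Y \<inter> V) = Y" using \<V>(2) by blast
    ultimately show False using Y(2) by auto
  qed
  then obtain V where V: "V \<in> \<V>" "emeasure \<eta> (Y \<inter> V) \<noteq> 0" by blast
  have Vb: "V \<in> sets borel" using \<V>(3)[OF V(1)] by simp
  have "emeasure (res V) Y = (SUP K\<in>{K. K \<subseteq> Y \<and> compact K}. emeasure (res V) K)"
    by (rule inner_regular[OF res(1) _ Y(1)]) (use \<V>(4)[OF V(1)] in \<open>simp add: res eres[OF Vb] less_top\<close>)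
  moreover have "0 < emeasure (res V) Y" using V(2) by (simp add: eres[OF Vb Y(1)] zero_less_iff_neq_zero)
  ultimately obtain K where K: "K \<subseteq> Y" "compact K" "0 < emeasure (res V) K"
    by (auto simp: less_SUP_iff)
  have Kb: "K \<in> sets borel" using K(2) by (rule borel_compact)
  have "emeasure (res V) K \<le> emeasure \<eta> K"
    unfolding eres[OF Vb Kb] by (rule emeasure_mono) (use Kb haar_sets in auto)
  then have Kpos: "0 < emeasure \<eta> K" using K(3) by (rule less_le_trans[rotated])
  have Kfin: "emeasure \<eta> K < \<infinity>" by (rule haar_compact[OF K(2)])
  obtain \<F> where F: "\<F> \<subseteq> \<V>" "finite \<F>" "K \<subseteq> \<Union>\<F>"
    by (rule compactE[OF K(2), of \<V>]) (use \<V>(2,3) in auto)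
  define W where "W = \<Union>\<F>"
  have W: "open W" unfolding W_def using F \<V>(3) by blast
  have Wb: "W \<in> sets borel" using W by simp
  have Wfin: "emeasure \<eta> W < \<infinity>"
  proof -
    have "emeasure \<eta> (\<Union>V\<in>\<F>. V) \<le> (\<Sum>V\<in>\<F>. emeasure \<eta> V)"
      by (rule emeasure_subadditive_finite) (use F \<V>(3) haar_sets in auto)
    also have "\<dots> < \<infinity>" using F \<V>(4) by (auto simp: less_top[symmetric])
    finally show ?thesis by (simp add: W_def)
  qed
  have KW: "K \<inter> W = K" using F(3) by (auto simp: W_def)
  have "emeasure \<eta> K < 2 * emeasure \<eta> K"
  proof -
    obtain a where "emeasure \<eta> K = ennreal a" "0 < a"
      using Kpos Kfin by (cases "emeasure \<eta> K") auto
    then show ?thesis by (simp add: ennreal_less_iff flip: ennreal_numeral ennreal_mult'')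
  qed
  moreover have "emeasure (res W) K = (INF U\<in>{U. K \<subseteq> U \<and> open U}. emeasure (res W) U)"
    by (rule outer_regular[OF res(1) _ Kb]) (use Wfin in \<open>simp add: res eres[OF Wb] less_top\<close>)
  ultimately obtain U where U: "K \<subseteq> U" "open U" "emeasure (res W) U < 2 * emeasure \<eta> K"
    by (auto simp: eres[OF Wb Kb] KW INF_less_iff)
  define O' where "O' = U \<inter> W"
  have O': "open O'" "K \<subseteq> O'" "emeasure \<eta> O' < 2 * emeasure \<eta> K"
    using U W KW eres[OF Wb borel_open[OF U(2)]] by (auto simp: O'_def)
  have tube_open: "open ((\<lambda>p. fst p + snd p) -` O')"
    by (intro open_vimage O'(1) continuous_intros)
  have "{0} \<times> K \<subseteq> (\<lambda>p. fst p + snd p) -` O'" using O'(2) by auto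
  then obtain X0 where X0: "0 \<in> X0" "open X0" "X0 \<times> K \<subseteq> (\<lambda>p. fst p + snd p) -` O'"
    using Elementary_Topology.tube_lemma[OF K(2) tube_open] by meson
  have sg: "is_subgroup (overlap_set \<mu>)" by (rule overlap_set_subgroup[OF \<mu>])
  have near: "x \<in> overlap_set \<mu>" if x: "x \<in> X0" for x
  proof -
    define K' where "K' = (\<lambda>y. - x + y) -` K"
    have K'b: "K' \<in> sets borel" unfolding K'_def by (rule sets_translate_vimage[OF Kb])
    have K'm: "emeasure \<eta> K' = emeasure \<eta> K" unfolding K'_def by (rule haar_translate_vimage[OF Kb])
    have "K' \<subseteq> O'"
    proof
      fix y assume "y \<in> K'"
      then have "(x, - x + y) \<in> X0 \<times> K" using x by (simp add: K'_def)
      then show "y \<in> O'" using X0(3) by auto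
    qed
    \<comment> \<open>Otherwise \<open>K\<close> and \<open>K'\<close> would be disjoint up to a null set inside \<open>O'\<close>, which is too small.\<close>
    have pos: "emeasure \<eta> (K \<inter> K') \<noteq> 0"
    proof
      assume "emeasure \<eta> (K \<inter> K') = 0"
      then have "K \<inter> K' \<in> null_sets \<eta>" using Kb K'b haar_sets by auto
      then have "emeasure \<eta> (K' - K) = emeasure \<eta> K'"
        using emeasure_Diff_null_set[of "K \<inter> K'" \<eta> K'] K'b haar_sets by (simp add: Diff_Int2 Diff_Int)
      then have "2 * emeasure \<eta> K = emeasure \<eta> K + emeasure \<eta> (K' - K)"
        by (simp add: K'm mult_2)
      also have "\<dots> = emeasure \<eta> (K \<union> (K' - K))"
        by (rule plus_emeasure) (use Kb K'b haar_sets in auto)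
      also have "\<dots> \<le> emeasure \<eta> O'"
        by (rule emeasure_mono) (use O' \<open>K' \<subseteq> O'\<close> haar_sets in auto)
      finally show False using O'(3) by simp
    qed
    have "overlaps (conv_power \<mu> n) (shift (- (- x)) (conv_power \<mu> n))"
    proof (rule overlaps_shiftI[where \<kappa> = "scale_measure (ennreal c) (res (K \<inter> K'))"])
      have KKb: "K \<inter> K' \<in> sets borel" using Kb K'b by simp
      have mono: "ennreal c * emeasure \<eta> B' \<le> emeasure (conv_power \<mu> n) B"
        if "B' \<subseteq> B \<inter> K" "B' \<in> sets borel" "B \<in> sets borel" for B B'
      proof -
        have "ennreal c * emeasure \<eta> B' \<le> ennreal c * emeasure \<eta> (B \<inter> Y)"
          by (intro mult_left_mono emeasure_mono) (use that K(1) Y(1) haar_sets in auto)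
        also have "\<dots> \<le> emeasure (conv_power \<mu> n) B" by (rule c(2)[OF that(3)])
        finally show ?thesis .
      qed
      show "sets (scale_measure (ennreal c) (res (K \<inter> K'))) = sets borel" by (simp add: res)
      show "emeasure (scale_measure (ennreal c) (res (K \<inter> K'))) UNIV \<noteq> 0"
        using pos c(1) by (simp add: eres[OF KKb])
      fix B :: "'a set" assume B: "B \<in> sets borel"
      show "emeasure (scale_measure (ennreal c) (res (K \<inter> K'))) B \<le> emeasure (conv_power \<mu> n) B"
        using mono[of "B \<inter> (K \<inter> K')" B] B KKb by (auto simp: eres[OF KKb B])
      have tb: "(\<lambda>y. - x + y) -` B \<in> sets borel" by (rule sets_translate_vimage[OF B])
      let ?Z = "(\<lambda>y. - x + y) -` B \<inter> (K \<inter> K')"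
      have Zb: "?Z \<in> sets borel" using tb KKb by (rule sets.Int)
      have "emeasure (shift (- x) (scale_measure (ennreal c) (res (K \<inter> K')))) B = ennreal c * emeasure \<eta> ?Z"
      proof -
        have s: "sets (scale_measure (ennreal c) (res (K \<inter> K'))) = sets borel" by (simp add: res)
        show ?thesis
          unfolding emeasure_shift_vimage[OF s B] emeasure_scale_measure eres[OF KKb tb] ..
      qed
      also have "emeasure \<eta> ?Z = emeasure \<eta> ((\<lambda>y. x + y) -` ?Z)"
        by (rule haar_translate_vimage[OF Zb, symmetric])
      also have "ennreal c * \<dots> \<le> emeasure (conv_power \<mu> n) B"
        by (rule mono[OF _ sets_translate_vimage[OF Zb] B]) (auto simp: K'_def)
      finally show "emeasure (shift (- x) (scale_measure (ennreal c) (res (K \<inter> K')))) B \<le> emeasure (conv_power \<mu> n) B" .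
    qed simp
    then have "- x \<in> overlap_set \<mu>" unfolding overlap_set_def using n by blast
    then have "- (- x) \<in> overlap_set \<mu>" using sg unfolding is_subgroup_def by blast
    then show ?thesis by simp
  qed
  have nbh: "open ((\<lambda>y. - h + y) -` X0)" for h
    by (intro open_vimage X0(2) continuous_intros)
  have "open (overlap_set \<mu>)"
  proof (subst open_subopen, intro ballI)
    fix h assume h: "h \<in> overlap_set \<mu>"
    have "(\<lambda>y. - h + y) -` X0 \<subseteq> overlap_set \<mu>"
    proof
      fix y assume "y \<in> (\<lambda>y. - h + y) -` X0"
      then have "h + (- h + y) \<in> overlap_set \<mu>" using near h sg unfolding is_subgroup_def by blast
      then show "y \<in> overlap_set \<mu>" by simp
    qed
    then show "\<exists>T. open T \<and> h \<in> T \<and> T \<subseteq> overlap_set \<mu>"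
      using nbh[of h] X0(1) by (intro exI[of _ "(\<lambda>y. - h + y) -` X0"]) auto
  qed
  moreover have "open (- overlap_set \<mu>)"
  proof (subst open_subopen, intro ballI)
    fix h assume h: "h \<in> - overlap_set \<mu>"
    have "(\<lambda>y. - h + y) -` X0 \<subseteq> - overlap_set \<mu>"
    proof
      fix y assume "y \<in> (\<lambda>y. - h + y) -` X0"
      then have z: "- h + y \<in> overlap_set \<mu>" using near by blast
      show "y \<in> - overlap_set \<mu>"
      proof
        assume "y \<in> overlap_set \<mu>"
        then have "y + - (- h + y) \<in> overlap_set \<mu>" using z sg unfolding is_subgroup_def by blast
        then show False using h by simp
      qed
    qed
    then show "\<exists>T. open T \<and> h \<in> T \<and> T \<subseteq> - overlap_set \<mu>"
      using nbh[of h] X0(1) by (intro exI[of _ "(\<lambda>y. - h + y) -` X0"]) auto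
  qed
  moreover have "0 \<in> overlap_set \<mu>" using sg by (simp add: is_subgroup_def)
  ultimately show ?thesis
    using connectedD[OF conn, of "overlap_set \<mu>" "- overlap_set \<mu>"] by auto
qed

end

section \<open>The coupling set is the overlap set\<close>

text \<open>
  With positive probability the walks have met by some time \<open>n\<close>, and the law of the common position
  on that event lies below the laws of both positions.
\<close>

lemma coupling_set_subset_overlap_set:
  fixes \<mu> :: "'a::{polish_space,topological_ab_group_add} measure"
  assumes \<mu>: "prob_space \<mu>" "sets \<mu> = sets borel"
  shows "coupling_set \<mu> \<subseteq> overlap_set \<mu>"
proof
  fix x assume "x \<in> coupling_set \<mu>"
  then obtain M :: "((nat \<Rightarrow> 'a) \<times> (nat \<Rightarrow> 'a) \<times> enat) measure" and S Sx T where
    M: "prob_space M"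
    and S: "S \<in> measurable M (\<Pi>\<^sub>M i\<in>UNIV. borel)" "distr M (\<Pi>\<^sub>M i\<in>UNIV. borel) S = RW 0 \<mu>"
    and Sx: "Sx \<in> measurable M (\<Pi>\<^sub>M i\<in>UNIV. borel)" "distr M (\<Pi>\<^sub>M i\<in>UNIV. borel) Sx = RW x \<mu>"
    and T: "T \<in> measurable M (count_space UNIV)"
    and eq: "\<And>\<omega> n. \<omega> \<in> space M \<Longrightarrow> T \<omega> \<le> enat n \<Longrightarrow> S \<omega> n = Sx \<omega> n"
    and fin: "AE \<omega> in M. T \<omega> < \<infinity>"
    unfolding coupling_set_def successful_exact_coupling_def exact_coupling_def by blast
  interpret M: prob_space M by fact
  define Q where "Q n = {\<omega>\<in>space M. T \<omega> \<le> enat n}" for n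
  have Qs: "Q n \<in> sets M" for n
    using measurable_sets[OF T, of "{..enat n}"] by (simp add: Q_def vimage_def Int_def conj_commute)
  have "\<exists>n. emeasure M (Q n) \<noteq> 0"
  proof (rule ccontr)
    assume "\<not> (\<exists>n. emeasure M (Q n) \<noteq> 0)"
    then have "(\<Union>n. Q n) \<in> null_sets M" using Qs by (intro null_sets_UN) auto
    then have "AE \<omega> in M. \<omega> \<notin> (\<Union>n. Q n)" by (rule AE_not_in)
    then have "AE \<omega> in M. False"
      using fin AE_space
    proof eventually_elim
      case (elim \<omega>)
      then show ?case by (cases "T \<omega>") (auto simp: Q_def)
    qed
    then show False using M.AE_False by simp
  qed
  then obtain m where m: "emeasure M (Q m) \<noteq> 0" by blast
  \<comment> \<open>The exponent of an overlap has to be positive.\<close>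
  define n where "n = Suc m"
  have "emeasure M (Q m) \<le> emeasure M (Q n)"
  proof (rule emeasure_mono[OF _ Qs])
    have "enat m \<le> enat n" by (simp add: n_def)
    then show "Q m \<subseteq> Q n" unfolding Q_def using order_trans by blast
  qed
  then have Qn: "emeasure M (Q n) \<noteq> 0" using m by auto
  have coord: "(\<lambda>\<omega>. Z \<omega> n) \<in> borel_measurable M" if "Z \<in> measurable M (\<Pi>\<^sub>M i\<in>UNIV. borel)" for Z :: "_ \<Rightarrow> nat \<Rightarrow> 'a"
    using measurable_compose[OF that measurable_component_singleton[of n]] by simp
  have law: "distr M borel (\<lambda>\<omega>. Z \<omega> n) = shift z (conv_power \<mu> n)"
    if Z: "Z \<in> measurable M (\<Pi>\<^sub>M i\<in>UNIV. borel)" "distr M (\<Pi>\<^sub>M i\<in>UNIV. borel) Z = RW z \<mu>" for Z and z :: 'a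
  proof -
    have "distr M borel (\<lambda>\<omega>. Z \<omega> n) = distr (distr M (\<Pi>\<^sub>M i\<in>UNIV. borel) Z) borel (\<lambda>s. s n)"
      by (subst distr_distr[OF _ Z(1)]) (auto simp: comp_def)
    then show ?thesis unfolding Z(2) RW_marginal[OF \<mu>] .
  qed
  define \<kappa> where "\<kappa> = distr (restrict_space M (Q n)) borel (\<lambda>\<omega>. S \<omega> n)"
  have \<kappa>: "emeasure \<kappa> B = emeasure M {\<omega>\<in>space M. T \<omega> \<le> enat n \<and> S \<omega> n \<in> B}" if "B \<in> sets borel" for B
    unfolding \<kappa>_def Q_def
    by (rule emeasure_distr_restrict_space[OF coord[OF S(1)] _ that]) (use Qs[of n] in \<open>simp add: Q_def\<close>)
  have le: "emeasure \<kappa> B \<le> emeasure (shift z (conv_power \<mu> n)) B"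
    if Z: "Z \<in> measurable M (\<Pi>\<^sub>M i\<in>UNIV. borel)" "distr M (\<Pi>\<^sub>M i\<in>UNIV. borel) Z = RW z \<mu>"
      and ZS: "\<And>\<omega>. \<omega> \<in> space M \<Longrightarrow> T \<omega> \<le> enat n \<Longrightarrow> S \<omega> n = Z \<omega> n" and B: "B \<in> sets borel"
    for Z and z :: 'a and B
  proof -
    have "emeasure \<kappa> B \<le> emeasure M ((\<lambda>\<omega>. Z \<omega> n) -` B \<inter> space M)"
      unfolding \<kappa>[OF B] by (rule emeasure_mono[OF _ measurable_sets[OF coord[OF Z(1)] B]]) (auto simp: ZS)
    also have "\<dots> = emeasure (shift z (conv_power \<mu> n)) B"
      unfolding law[OF Z, symmetric] by (rule emeasure_distr[OF coord[OF Z(1)] B, symmetric])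
    finally show ?thesis .
  qed
  have s0: "shift 0 (conv_power \<mu> n) = conv_power \<mu> n"
    by (rule measure_eqI) (simp_all add: emeasure_shift_vimage vimage_def)
  have "overlaps (conv_power \<mu> n) (shift x (conv_power \<mu> n))"
    unfolding overlaps_def
  proof (intro exI[of _ \<kappa>] conjI ballI)
    show "sets \<kappa> = sets borel" by (simp add: \<kappa>_def)
    show "emeasure \<kappa> UNIV \<noteq> 0" using \<kappa>[of UNIV] Qn by (simp add: Q_def)
    fix B :: "'a set" assume B: "B \<in> sets borel"
    show "emeasure \<kappa> B \<le> emeasure (conv_power \<mu> n) B" using le[OF S _ B] by (simp add: s0)
    show "emeasure \<kappa> B \<le> emeasure (shift x (conv_power \<mu> n)) B" by (rule le[OF Sx eq B])
  qed
  then have "overlaps (conv_power \<mu> n) (shift (- x) (conv_power \<mu> n))"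
    using overlaps_shift_uminus[OF sets_conv_power, of \<mu> n "- x"] by simp
  then show "x \<in> overlap_set \<mu>" unfolding overlap_set_def by (auto simp: n_def)
qed

lemma overlap_set_subset_coupling_set:
  fixes \<mu> :: "'a::{polish_space,topological_ab_group_add} measure"
  assumes \<mu>: "prob_space \<mu>" "sets \<mu> = sets borel"
  shows "overlap_set \<mu> \<subseteq> coupling_set \<mu>"
proof
  fix x assume "x \<in> overlap_set \<mu>"
  then obtain n0 where n0: "n0 \<ge> 1" "overlaps (conv_power \<mu> n0) (shift (- x) (conv_power \<mu> n0))"
    unfolding overlap_set_def by blast
  obtain C where C: "C > 0" and rate: "\<forall>n\<ge>1. translation_gap_le (conv_power \<mu> n) x (C / sqrt (real n))"
    by (rule merging_rate_sqrt[OF \<mu> n0]; rule that; assumption)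
  \<comment> \<open>At time \<open>0\<close> the laws may be mutually singular, and \<open>2\<close> is the trivial bound.\<close>
  define e where "e n = (if n = 0 then 2 else C / sqrt (real n))" for n
  have lim: "e \<longlonglongrightarrow> 0"
  proof (rule Lim_transform_eventually)
    have "(\<lambda>n. C * inverse (sqrt (real n))) \<longlonglongrightarrow> C * 0"
      by (intro tendsto_intros tendsto_inverse_0_at_top filterlim_compose[OF sqrt_at_top filterlim_real_sequentially])
    then show "(\<lambda>n. C * inverse (sqrt (real n))) \<longlonglongrightarrow> 0" by simp
    show "\<forall>\<^sub>F n in sequentially. C * inverse (sqrt (real n)) = e n"
      using eventually_gt_at_top[of 0] by eventually_elim (simp add: e_def field_simps)
  qed
  let ?E = "\<Pi>\<^sub>M i\<in>(UNIV::nat set). (borel :: 'a measure)"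
  have merge: "\<bar>(\<integral>s. indicator B (\<lambda>n. s (n + k)) \<partial>RW 0 \<mu>) - (\<integral>s. indicator B (\<lambda>n. s (n + k)) \<partial>RW x \<mu>)\<bar> \<le> e k"
    if B: "B \<in> sets ?E" for k B
  proof -
    obtain G :: "'a \<Rightarrow> real" where G: "G \<in> borel_measurable borel" "\<And>z. \<bar>G z\<bar> \<le> 1"
      "\<And>x. (\<integral>s. indicator B (\<lambda>n. s (n + k)) \<partial>RW x \<mu>) = (\<integral>z. G (z + x) \<partial>conv_power \<mu> k)"
      by (rule RW_tail[OF \<mu> B]; rule that; assumption)
    interpret K: prob_space "conv_power \<mu> k" by (rule prob_space_conv_power[OF \<mu>])
    have gm: "(\<lambda>z. G (z + y)) \<in> borel_measurable borel" for y using G(1) by measurable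
    have int: "integrable (conv_power \<mu> k) (\<lambda>z. G (z + y))" for y
      using G(2) gm[of y] by (intro K.integrable_const_bound[where B = 1]) (auto cong: measurable_cong_sets)
    have "(\<integral>s. indicator B (\<lambda>n. s (n + k)) \<partial>RW 0 \<mu>) - (\<integral>s. indicator B (\<lambda>n. s (n + k)) \<partial>RW x \<mu>)
        = (\<integral>z. G z - G (z + x) \<partial>conv_power \<mu> k)"
      unfolding G(3) using int[of 0] int[of x] by simp
    also have "\<bar>\<dots>\<bar> \<le> e k"
    proof (cases "k = 0")
      case False
      then show ?thesis using rate G(1,2) by (simp add: e_def translation_gap_le_def)
    next
      case True
      have "\<bar>\<integral>z. G z - G (z + x) \<partial>conv_power \<mu> k\<bar> \<le> (\<integral>z. \<bar>G z - G (z + x)\<bar> \<partial>conv_power \<mu> k)"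
        by (rule integral_abs_bound)
      also have "\<dots> \<le> (\<integral>z. 2 \<partial>conv_power \<mu> k)"
      proof (rule integral_mono)
        show "\<bar>G z - G (z + x)\<bar> \<le> 2" for z using G(2)[of z] G(2)[of "z + x"] by linarith
      qed (use int[of 0] int[of x] in auto)
      finally show ?thesis using True K.prob_space by (simp add: e_def)
    qed
    finally show ?thesis .
  qed
  obtain M :: "((nat \<times> (nat \<Rightarrow> 'a)) \<times> real \<times> real) measure" and S S' T where
    c: "prob_space M" "S \<in> measurable M ?E" "S' \<in> measurable M ?E" "distr M ?E S = RW 0 \<mu>" "distr M ?E S' = RW x \<mu>"
    "T \<in> measurable M (count_space UNIV)"
    "\<And>\<omega> n. T \<omega> \<le> enat n \<Longrightarrow> S \<omega> n = S' \<omega> n" "AE \<omega> in M. T \<omega> < \<infinity>"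
    by (rule coupling_of_merging_laws[OF prob_space_RW[OF \<mu>] sets_RW prob_space_RW[OF \<mu>] sets_RW merge lim];
      (rule that; assumption)?)
  have "successful_exact_coupling \<mu> 0 x M S S' T"
    unfolding successful_exact_coupling_def exact_coupling_def using c by auto
  then show "x \<in> coupling_set \<mu>" by (rule successful_exact_coupling_imp_coupling_set)
qed

lemma coupling_set_eq_overlap_set:
  assumes "prob_space \<mu>" "sets \<mu> = sets borel"
  shows "coupling_set \<mu> = overlap_set \<mu>"
  using coupling_set_subset_overlap_set[OF assms] overlap_set_subset_coupling_set[OF assms] by blast

text \<open>
  The factor \<open>2\<close> arises because the norm is the difference of the supremum and the infimum.
\<close>

lemma tv_norm_RW_le:
  fixes \<mu> :: "'a::{polish_space,topological_ab_group_add} measure"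
  assumes \<mu>: "prob_space \<mu>" "sets \<mu> = sets borel"
    and gap: "translation_gap_le (conv_power \<mu> n) x e"
  shows "tv_norm (\<lambda>B. \<P>(s in RW 0 \<mu>. s n \<in> B) - \<P>(s in RW x \<mu>. s n \<in> B)) \<le> 2 * e"
proof -
  interpret K: prob_space "conv_power \<mu> n" by (rule prob_space_conv_power[OF \<mu>])
  have P: "\<P>(s in RW y \<mu>. s n \<in> B) = (\<integral>z. indicator B (z + y) \<partial>conv_power \<mu> n)"
    if B: "B \<in> sets borel" for y B
  proof -
    have cm: "(\<lambda>s. s n) \<in> borel_measurable (RW y \<mu>)"
      unfolding measurable_cong_sets[OF sets_RW refl] by simp
    have tb: "(\<lambda>z. y + z) -` B \<in> sets borel" by (rule sets_translate_vimage[OF B])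
    have "\<P>(s in RW y \<mu>. s n \<in> B) = measure (distr (RW y \<mu>) borel (\<lambda>s. s n)) B"
      by (subst measure_distr[OF cm B]) (simp add: vimage_def Int_def conj_commute)
    also have "\<dots> = measure (conv_power \<mu> n) ((\<lambda>z. y + z) -` B)"
      unfolding RW_marginal[OF \<mu>] measure_def emeasure_shift_vimage[OF sets_conv_power B] ..
    also have "\<dots> = (\<integral>z. indicator ((\<lambda>z. y + z) -` B) z \<partial>conv_power \<mu> n)"
      using tb by simp
    also have "\<dots> = (\<integral>z. indicator B (z + y) \<partial>conv_power \<mu> n)"
      by (rule Bochner_Integration.integral_cong) (simp_all add: indicator_def add.commute)
    finally show ?thesis .
  qed
  have bound: "\<bar>\<P>(s in RW 0 \<mu>. s n \<in> B) - \<P>(s in RW x \<mu>. s n \<in> B)\<bar> \<le> e" if B: "B \<in> sets borel" for B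
  proof -
    have im: "(\<lambda>z. indicat_real B (z + y)) \<in> borel_measurable borel" for y
      using measurable_compose[OF measurable_translate, of "indicat_real B" borel y] B by (simp add: add.commute)
    have int: "integrable (conv_power \<mu> n) (\<lambda>z. indicat_real B (z + y))" for y
      using im[of y] by (intro K.integrable_const_bound[where B = 1]) (auto simp: indicator_def cong: measurable_cong_sets)
    have "\<P>(s in RW 0 \<mu>. s n \<in> B) - \<P>(s in RW x \<mu>. s n \<in> B)
       = (\<integral>z. indicat_real B z - indicat_real B (z + x) \<partial>conv_power \<mu> n)"
      unfolding P[OF B] using int[of 0] int[of x] by simp
    then show ?thesis
      using gap[unfolded translation_gap_le_def, rule_format, of "indicat_real B"] B by (simp add: indicator_def)
  qed
  have "(SUP B\<in>sets (borel :: 'a measure). \<P>(s in RW 0 \<mu>. s n \<in> B) - \<P>(s in RW x \<mu>. s n \<in> B)) \<le> e"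
    by (rule cSUP_least) (use bound in \<open>fastforce simp: abs_le_iff\<close>)+
  moreover have "- e \<le> (INF B\<in>sets (borel :: 'a measure). \<P>(s in RW 0 \<mu>. s n \<in> B) - \<P>(s in RW x \<mu>. s n \<in> B))"
    by (rule cINF_greatest) (use bound in \<open>fastforce simp: abs_le_iff\<close>)+
  ultimately show ?thesis unfolding tv_norm_def by linarith
qed

theorem theorem1p3:
  fixes \<mu> :: "'a::{polish_space,topological_ab_group_add} measure"
  assumes "prob_space \<mu>" and "sets \<mu> = sets borel"
  shows
    "coupling_set \<mu> =
       {x. \<exists>n\<ge>1. inf (conv_power \<mu> n) (shift (- x) (conv_power \<mu> n)) \<noteq> null_measure borel}
     \<and>
     (\<forall>x\<in>coupling_set \<mu>. \<forall>n0\<ge>1.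
        inf (conv_power \<mu> n0) (shift (- x) (conv_power \<mu> n0)) \<noteq> null_measure borel \<longrightarrow>
        (\<exists>C>0.
           (\<not> finite_order x \<longrightarrow>
              (\<forall>n\<ge>1. tv_norm (\<lambda>B. \<P>(s in RW 0 \<mu>. s n \<in> B) - \<P>(s in RW x \<mu>. s n \<in> B))
                 \<le> C / sqrt (real n))) \<and>
           (finite_order x \<longrightarrow>
              (\<exists>\<rho>. 0 < \<rho> \<and> \<rho> < 1 \<and>
                (\<forall>n\<ge>1. tv_norm (\<lambda>B. \<P>(s in RW 0 \<mu>. s n \<in> B) - \<P>(s in RW x \<mu>. s n \<in> B))
                   \<le> C * \<rho> ^ n)))))
     \<and>
     (locally_compact_space (euclidean :: 'a topology) \<longrightarrow>
        (\<forall>\<eta>::'a measure. haar_measure \<eta> \<longrightarrow>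
           (coupling_set \<mu> = UNIV \<longrightarrow> spread_out \<eta> \<mu>) \<and>
           (connected (UNIV :: 'a set) \<longrightarrow> spread_out \<eta> \<mu> \<longrightarrow> coupling_set \<mu> = UNIV)))
     \<and>
     (purely_atomic \<mu> \<longrightarrow>
        coupling_set \<mu> = group_closure {a - a' | a a'. a \<in> atoms \<mu> \<and> a' \<in> atoms \<mu>})
     \<and>
     coupling_set \<mu> \<in> sets borel \<and> is_subgroup (coupling_set \<mu>)"
proof -
  have ov: "inf (conv_power \<mu> n) (shift (- x) (conv_power \<mu> n)) \<noteq> null_measure borel
      \<longleftrightarrow> overlaps (conv_power \<mu> n) (shift (- x) (conv_power \<mu> n))" for n x
    by (rule inf_neq_null_measure_iff[OF sets_conv_power sets_shift])
  have eq: "coupling_set \<mu> = overlap_set \<mu>"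
    by (rule coupling_set_eq_overlap_set[OF assms])
  have a: "coupling_set \<mu> = {x. \<exists>n\<ge>1. inf (conv_power \<mu> n) (shift (- x) (conv_power \<mu> n)) \<noteq> null_measure borel}"
    unfolding eq ov overlap_set_def ..
  have b: "\<exists>C>0.
      (\<not> finite_order x \<longrightarrow>
        (\<forall>n\<ge>1. tv_norm (\<lambda>B. \<P>(s in RW 0 \<mu>. s n \<in> B) - \<P>(s in RW x \<mu>. s n \<in> B)) \<le> C / sqrt (real n))) \<and>
      (finite_order x \<longrightarrow>
        (\<exists>\<rho>. 0 < \<rho> \<and> \<rho> < 1 \<and>
          (\<forall>n\<ge>1. tv_norm (\<lambda>B. \<P>(s in RW 0 \<mu>. s n \<in> B) - \<P>(s in RW x \<mu>. s n \<in> B)) \<le> C * \<rho> ^ n)))"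
    if n0: "n0 \<ge> 1" and neq: "inf (conv_power \<mu> n0) (shift (- x) (conv_power \<mu> n0)) \<noteq> null_measure borel" for x n0
  proof (cases "finite_order x")
    case False
    obtain C where C: "C > 0" and rate: "\<forall>n\<ge>1. translation_gap_le (conv_power \<mu> n) x (C / sqrt (real n))"
      by (rule merging_rate_sqrt[OF assms n0 neq[unfolded ov]]; rule that; assumption)
    have "tv_norm (\<lambda>B. \<P>(s in RW 0 \<mu>. s n \<in> B) - \<P>(s in RW x \<mu>. s n \<in> B)) \<le> 2 * (C / sqrt (real n))"
      if "n \<ge> 1" for n
      using rate that by (intro tv_norm_RW_le[OF assms]) blast
    then show ?thesis using False C by (intro exI[of _ "2 * C"]) auto
  next
    case True
    obtain C \<rho> where C: "C > 0" and \<rho>: "0 < \<rho>" "\<rho> < 1"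
      and rate: "\<forall>n. translation_gap_le (conv_power \<mu> n) x (C * \<rho> ^ n)"
      by (rule merging_rate_geometric[OF assms n0 neq[unfolded ov] True]; rule that; assumption)
    have "tv_norm (\<lambda>B. \<P>(s in RW 0 \<mu>. s n \<in> B) - \<P>(s in RW x \<mu>. s n \<in> B)) \<le> 2 * (C * \<rho> ^ n)" for n
      using rate by (intro tv_norm_RW_le[OF assms]) blast
    then show ?thesis using True C \<rho> by (intro exI[of _ "2 * C"]) (auto simp: mult.assoc)
  qed
  have c: "(coupling_set \<mu> = UNIV \<longrightarrow> spread_out \<eta> \<mu>) \<and>
      (connected (UNIV :: 'a set) \<longrightarrow> spread_out \<eta> \<mu> \<longrightarrow> coupling_set \<mu> = UNIV)"
    if lc: "locally_compact_space (euclidean :: 'a topology)" and h: "haar_measure \<eta>" for \<eta> :: "'a measure"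
    unfolding eq
    using spread_out_if_overlap_set_UNIV[OF lc h assms] overlap_set_UNIV_if_spread_out[OF lc h assms] by blast
  have d: "purely_atomic \<mu> \<longrightarrow> coupling_set \<mu> = group_closure {a - a' | a a'. a \<in> atoms \<mu> \<and> a' \<in> atoms \<mu>}"
    unfolding eq using overlap_set_purely_atomic[OF assms] by blast
  have e: "coupling_set \<mu> \<in> sets borel \<and> is_subgroup (coupling_set \<mu>)"
    unfolding eq using overlap_set_measurable[OF assms] overlap_set_subgroup[OF assms] by blast
  show ?thesis
    by (intro conjI ballI allI impI)
      (rule a, rule b, assumption, assumption, use c in blast, use c in blast, use d in blast, use e in blast, use e in blast)
qed

end
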